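(* Let $W=\{W_t:t\ge0\}$ be a standard real Brownian motion on a complete probability space, let $\xi\in\mathbb{R}$, let $b:[0,\infty)\times\mathbb{R}\to[0,\infty)$ and $f:[0,\infty)\to\mathbb{R}$, and let $I_t=\int_0^tf(s)\,dW_s$. Assume that the equation $$X_t^\xi=\xi+\int_0^tb(s,X_s^\xi)\,ds+I_t,\quad t\ge0,$$ has a unique solution that may blow up in finite time, and let $\tau_\xi$ be its explosion time. Let $\lambda>0$ and let $u:[0,\infty)\times\mathbb{R}\to\mathbb{R}$ be a bounded function that is a solution of the partial differential equation $$-\frac{\partial u}{\partial t}(t,x)=\frac12f^2(t)\frac{\partial^2u}{\partial x^2}(t,x)+b(t,x)\frac{\partial u}{\partial x}(t,x)-\lambda u(t,x),\quad t>0,\ x\in\mathbb{R},$$ $$u(t,\infty)=1 .$$ Then $$\lambda\int_0^\infty P(\tau_\xi\le s)\,e^{-\lambda s}\,ds=u(0,\xi).$$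
   Context: Standing assumptions on the data of the equation: $b(s,x)$ is locally Lipschitz in $x$ uniformly on $s\in[0,T]$ for each $T>0$, $b(\cdot,x)$ is continuous for each $x$, and $f$ is continuous with $\int_0^\infty f^2(s)\,ds=\infty$ and $\sum_{n=M}^\infty\Upsilon(n)^{-p}\left(\int_n^{n+2}f^2(s)\,ds\right)^{p/2}<\infty$ for some $M,p>0$, where $\Upsilon(t)=\sqrt{2\left(\int_0^tf^2(s)\,ds\right)\log\log\left(e^e\vee\int_0^tf^2(s)\,ds\right)}$ ($n$ runs over integers, $M$ is a positive integer). The explosion time $\tau_\xi$ is the stopping time up to which the equation has a solution and such that $\limsup_{t\uparrow\tau_\xi}|X_t^\xi|=\infty$ on $[\tau_\xi<\infty]$ (with $\tau_\xi=\infty$ if there is no explosion); since $b\ge0$, one has $X^\xi_{\tau_\xi-}=\infty$ on $[\tau_\xi<\infty]$. The solution $u$ is understood in the classical sense ($u$ continuous on $[0,\infty)\times\mathbb{R}$, once continuously differentiable in $t$ and twice in $x$ on $(0,\infty)\times\mathbb{R}$), and $u(t,\infty)$ denotes the boundary value of $u$ as $x\to\infty$.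
   Formalization: The condition u(t,∞)=1 is taken as a continuous boundary value: u(s,x)→1 as (s,x)→(t,∞) jointly, for every t>0; with the limit x→∞ only for each fixed t the claim can fail when exploding paths focus at one time. *)

theory Defs
  imports "HOL-Probability.Probability"
begin

text \<open>Time is represented by \<open>real\<close>; only the values of processes and coefficients at
  nonnegative times are constrained.\<close>

definition standard_brownian_motion :: "'a measure \<Rightarrow> (real \<Rightarrow> 'a \<Rightarrow> real) \<Rightarrow> bool" where
  "standard_brownian_motion P W \<longleftrightarrow>
     (\<forall>t\<ge>0. W t \<in> borel_measurable P) \<and>
     (AE \<omega> in P. W 0 \<omega> = 0) \<and>
     (\<forall>s t. 0 \<le> s \<and> s < t \<longrightarrow>
        distributed P lborel (\<lambda>\<omega>. W t \<omega> - W s \<omega>) (normal_density 0 (sqrt (t - s)))) \<and>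
     (\<forall>(n::nat) r. 0 \<le> r 0 \<and> (\<forall>i<n. r i \<le> r (Suc i)) \<longrightarrow>
        prob_space.indep_vars P (\<lambda>_. borel) (\<lambda>i \<omega>. W (r (Suc i)) \<omega> - W (r i) \<omega>) {..<n}) \<and>
     (AE \<omega> in P. continuous_on {0..} (\<lambda>t. W t \<omega>))"

text \<open>The completed natural filtration. It is indexed by \<open>ereal\<close> because explosion
  times may be infinite and a \<open>stopping_time\<close> has the type of the index.\<close>

definition brownian_filtration ::
  "'a measure \<Rightarrow> (real \<Rightarrow> 'a \<Rightarrow> real) \<Rightarrow> ereal \<Rightarrow> 'a measure" where
  "brownian_filtration P W t = sigma (space P)
     ({W s -` A \<inter> space P | s A. 0 \<le> s \<and> ereal s \<le> t \<and> A \<in> sets borel} \<union> null_sets P)"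

text \<open>The list of triples \<open>(c, a, b)\<close> stands for the step function that is the sum of the
  functions \<open>c * indicator {a<..b}\<close>; the intervals may overlap.\<close>

type_synonym step = "(real \<times> real \<times> real) list"

definition step_fun :: "step \<Rightarrow> real \<Rightarrow> real" where
  "step_fun \<phi> s = (\<Sum>(c, a, b)\<leftarrow>\<phi>. c * indicator {a<..b} s)"

definition step_wiener :: "(real \<Rightarrow> 'a \<Rightarrow> real) \<Rightarrow> step \<Rightarrow> 'a \<Rightarrow> real" where
  "step_wiener W \<phi> \<omega> = (\<Sum>(c, a, b)\<leftarrow>\<phi>. c * (W b \<omega> - W a \<omega>))"

text \<open>The integral over \<open>[0, t]\<close> of a deterministic \<open>f\<close> against \<open>W\<close>: the mean-square limit of the
  integrals of step functions that converge to \<open>f\<close> in mean square. The isometry makes it almost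
  surely independent of the approximating sequence.\<close>

definition is_wiener_integral ::
  "'a measure \<Rightarrow> (real \<Rightarrow> 'a \<Rightarrow> real) \<Rightarrow> (real \<Rightarrow> real) \<Rightarrow> real \<Rightarrow> ('a \<Rightarrow> real) \<Rightarrow> bool" where
  "is_wiener_integral P W f t J \<longleftrightarrow>
     J \<in> borel_measurable P \<and>
     (\<exists>\<phi> :: nat \<Rightarrow> step.
        (\<forall>n. \<forall>(c, a, b) \<in> set (\<phi> n). 0 \<le> a \<and> a \<le> b \<and> b \<le> t) \<and>
        (\<lambda>n. \<integral>\<^sup>+ s\<in>{0..t}. ennreal ((step_fun (\<phi> n) s - f s)\<^sup>2) \<partial>lborel) \<longlonglongrightarrow> 0 \<and>
        (\<lambda>n. \<integral>\<^sup>+ \<omega>. ennreal ((step_wiener W (\<phi> n) \<omega> - J \<omega>)\<^sup>2) \<partial>P) \<longlonglongrightarrow> 0)"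

definition wiener_integral_process ::
  "'a measure \<Rightarrow> (real \<Rightarrow> 'a \<Rightarrow> real) \<Rightarrow> (real \<Rightarrow> real) \<Rightarrow> (real \<Rightarrow> 'a \<Rightarrow> real) \<Rightarrow> bool" where
  "wiener_integral_process P W f I \<longleftrightarrow>
     (\<forall>t\<ge>0. is_wiener_integral P W f t (I t)) \<and>
     (AE \<omega> in P. continuous_on {0..} (\<lambda>t. I t \<omega>))"

definition Upsilon :: "(real \<Rightarrow> real) \<Rightarrow> real \<Rightarrow> real" where
  "Upsilon f t =
     sqrt (2 * integral {0..t} (\<lambda>s. (f s)\<^sup>2) *
           ln (ln (max (exp (exp 1)) (integral {0..t} (\<lambda>s. (f s)\<^sup>2)))))"

text \<open>Positivity of \<open>Upsilon f N\<close> makes all the negative powers meaningful, since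
  \<open>0 powr (- p) = 0\<close>. It costs no generality: \<open>Upsilon f\<close> is nondecreasing, and it is
  eventually positive unless \<open>f\<close> vanishes almost everywhere.\<close>

definition noise_growth_condition :: "(real \<Rightarrow> real) \<Rightarrow> bool" where
  "noise_growth_condition f \<longleftrightarrow>
     (\<integral>\<^sup>+ s\<in>{0..}. ennreal ((f s)\<^sup>2) \<partial>lborel) = \<infinity> \<and>
     (\<exists>(N::nat) (p::real). 0 < N \<and> 0 < p \<and> 0 < Upsilon f (real N) \<and>
        summable (\<lambda>k. Upsilon f (real (N + k)) powr (- p) *
          integral {real (N + k)..real (N + k) + 2} (\<lambda>s. (f s)\<^sup>2) powr (p / 2)))"

definition locally_lipschitz_unif :: "(real \<Rightarrow> real \<Rightarrow> real) \<Rightarrow> bool" where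
  "locally_lipschitz_unif b \<longleftrightarrow>
     (\<forall>T>0. \<forall>R>0. \<exists>L. \<forall>s\<in>{0..T}. L-lipschitz_on {-R..R} (b s))"

text \<open>\<open>X\<close> solves the equation up to its explosion time \<open>\<tau>\<close>; the values of \<open>X\<close> at and after
  \<open>\<tau>\<close> are irrelevant.\<close>

definition solution_up_to_explosion ::
  "'a measure \<Rightarrow> (real \<Rightarrow> 'a \<Rightarrow> real) \<Rightarrow> (real \<Rightarrow> real \<Rightarrow> real) \<Rightarrow> (real \<Rightarrow> 'a \<Rightarrow> real) \<Rightarrow> real \<Rightarrow>
   (real \<Rightarrow> 'a \<Rightarrow> real) \<Rightarrow> ('a \<Rightarrow> ereal) \<Rightarrow> bool" where
  "solution_up_to_explosion P W b I \<xi> X \<tau> \<longleftrightarrow>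
     stopping_time (brownian_filtration P W) \<tau> \<and>
     (\<forall>t\<ge>0. (\<lambda>\<omega>. if ereal t < \<tau> \<omega> then X t \<omega> else 0)
        \<in> borel_measurable (brownian_filtration P W (ereal t))) \<and>
     (AE \<omega> in P.
        0 < \<tau> \<omega> \<and>
        continuous_on {t. 0 \<le> t \<and> ereal t < \<tau> \<omega>} (\<lambda>t. X t \<omega>) \<and>
        (\<forall>t\<ge>0. ereal t < \<tau> \<omega> \<longrightarrow>
           X t \<omega> = \<xi> + integral {0..t} (\<lambda>s. b s (X s \<omega>)) + I t \<omega>) \<and>
        (\<tau> \<omega> < \<infinity> \<longrightarrow>
           Limsup (at_left (real_of_ereal (\<tau> \<omega>))) (\<lambda>t. ereal \<bar>X t \<omega>\<bar>) = \<infinity>))"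

definition unique_solution_up_to_explosion ::
  "'a measure \<Rightarrow> (real \<Rightarrow> 'a \<Rightarrow> real) \<Rightarrow> (real \<Rightarrow> real \<Rightarrow> real) \<Rightarrow> (real \<Rightarrow> 'a \<Rightarrow> real) \<Rightarrow> real \<Rightarrow>
   (real \<Rightarrow> 'a \<Rightarrow> real) \<Rightarrow> ('a \<Rightarrow> ereal) \<Rightarrow> bool" where
  "unique_solution_up_to_explosion P W b I \<xi> X \<tau> \<longleftrightarrow>
     solution_up_to_explosion P W b I \<xi> X \<tau> \<and>
     (\<forall>Y \<sigma>. solution_up_to_explosion P W b I \<xi> Y \<sigma> \<longrightarrow>
        (AE \<omega> in P. \<sigma> \<omega> = \<tau> \<omega> \<and> (\<forall>t\<ge>0. ereal t < \<tau> \<omega> \<longrightarrow> Y t \<omega> = X t \<omega>)))"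

text \<open>\<open>u\<close> is continuous on \<open>[0,\<infinity>) \<times> \<real>\<close> and of class \<open>C\<^sup>1\<^sup>,\<^sup>2\<close> on \<open>(0,\<infinity>) \<times> \<real>\<close>, with the
  partial derivatives \<open>ut\<close>, \<open>ux\<close> and \<open>uxx\<close>.\<close>

definition classical_derivatives ::
  "(real \<Rightarrow> real \<Rightarrow> real) \<Rightarrow> (real \<Rightarrow> real \<Rightarrow> real) \<Rightarrow> (real \<Rightarrow> real \<Rightarrow> real) \<Rightarrow>
   (real \<Rightarrow> real \<Rightarrow> real) \<Rightarrow> bool" where
  "classical_derivatives u ut ux uxx \<longleftrightarrow>
     continuous_on ({0..} \<times> UNIV) (\<lambda>(t, x). u t x) \<and>
     (\<forall>t>0. \<forall>x.
        ((\<lambda>s. u s x) has_real_derivative ut t x) (at t) \<and>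
        (u t has_real_derivative ux t x) (at x) \<and>
        (ux t has_real_derivative uxx t x) (at x)) \<and>
     continuous_on ({0<..} \<times> UNIV) (\<lambda>(t, x). ut t x) \<and>
     continuous_on ({0<..} \<times> UNIV) (\<lambda>(t, x). ux t x) \<and>
     continuous_on ({0<..} \<times> UNIV) (\<lambda>(t, x). uxx t x)"

text \<open>The boundary condition \<open>u(t,\<infinity>) = g(t)\<close> for \<open>t > 0\<close>. A boundary value is attained by
  continuous extension to the boundary line \<open>x = \<infinity>\<close>, so the limit is taken jointly in time and
  space. Limits in \<open>x\<close> for each fixed \<open>t\<close> would say nothing about \<open>u\<close> along an exploding
  path, where \<open>t\<close> and \<open>x\<close> vary together.\<close>

definition boundary_value_at_infinity ::
  "(real \<Rightarrow> real \<Rightarrow> real) \<Rightarrow> (real \<Rightarrow> real) \<Rightarrow> bool" where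
  "boundary_value_at_infinity u g \<longleftrightarrow>
     (\<forall>t>0. ((\<lambda>(s, x). u s x) \<longlongrightarrow> g t) (nhds t \<times>\<^sub>F at_top))"

end

theory Submission
  imports Defs
begin

text \<open>Put \<open>U(t, x) = exp (- lam * t) * u t x\<close>. The equation for \<open>u\<close> says that \<open>U\<close> solves
\<open>U\<^sub>t + f\<^sup>2 U\<^sub>x\<^sub>x / 2 + b U\<^sub>x = 0\<close>, the backward equation of the diffusion \<open>X\<close>, so \<open>U(t, X\<^sub>t)\<close> is
a bounded martingale up to explosion. Let \<open>\<sigma>\<^sub>n\<close> be the exit time from \<open>[-n, n]\<close>, cut off at time \<open>n\<close>;
then \<open>u(0, \<xi>)\<close> is the expectation of \<open>U(\<sigma>\<^sub>n, X(\<sigma>\<^sub>n))\<close> (\<open>optional_stopping\<close>). Now let \<open>n\<close> grow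
(\<open>discounted_exit_value_tendsto\<close>). If \<open>\<tau> = \<infinity>\<close>, the discount factor sends the value to \<open>0\<close>. If
\<open>\<tau> < \<infinity>\<close>, then \<open>X\<close> explodes upwards, because its drift is nonnegative and its noise is continuous, and
the boundary condition sends the value to \<open>exp (- lam * \<tau>)\<close>. Hence \<open>u(0, \<xi>)\<close> is the Laplace transform of
\<open>\<tau>\<close> at \<open>lam\<close>, which Fubini's theorem rewrites as the integral of the distribution function
(\<open>laplace_transform_eq_distribution_integral\<close>).

Since the noise is additive with a deterministic coefficient, the martingale identity needs no
stochastic integral of a random integrand. Cut the time axis by a grid of mesh \<open>h\<close> and telescope
\<open>U(t, X\<^sub>t)\<close> up to the first grid point by which the path has left \<open>[-R, R]\<close>. In each step, replace
\<open>X(t + h)\<close> by its Euler prediction \<open>X\<^sub>t + b(t, X\<^sub>t) h + (I(t + h) - I\<^sub>t)\<close> from time \<open>t\<close>. Two things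
remain to be seen.

The expected gain of a predicted step is \<open>o(h)\<close> (\<open>expected_gain_small\<close>): the noise increment is
independent of the past and centred, its variance is the integral of \<open>f\<^sup>2\<close>, and its fourth moment is
\<open>O(h\<^sup>2)\<close> (\<open>increment_moments\<close>). So in a second-order Taylor expansion of \<open>U\<close> (\<open>ito_taylor_bound\<close>) the
leading terms cancel in the mean by the backward equation.

The errors of the predictions add up to \<open>o(1)\<close>. Both points share the noise, so they differ only by the
oscillation of the drift over one step. Along a fixed path, continuity makes the sum small
(\<open>prediction_error_sum_tendsto\<close>), and the sum is bounded uniformly in the path
(\<open>prediction_error_sum_bound\<close>), so its expectation tends to \<open>0\<close>.

As \<open>U\<close> is differentiable only for \<open>t > 0\<close>, the grid starts at some \<open>\<epsilon> > 0\<close>, and \<open>\<epsilon>\<close> tends to \<open>0\<close> at the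
end, by continuity of \<open>U\<close> at time \<open>0\<close>.\<close>

section \<open>Step functions and their Brownian integrals\<close>

definition steps_after :: "real \<Rightarrow> step \<Rightarrow> bool" where
  "steps_after s \<phi> \<longleftrightarrow> (\<forall>(c, a, b) \<in> set \<phi>. s \<le> a \<and> a \<le> b)"

lemma steps_afterD: "steps_after s \<phi> \<Longrightarrow> (c, a, b) \<in> set \<phi> \<Longrightarrow> s \<le> a \<and> a \<le> b"
  by (auto simp: steps_after_def)

lemma steps_after_mono: "steps_after t \<phi> \<Longrightarrow> s \<le> t \<Longrightarrow> steps_after s \<phi>"
  by (fastforce simp: steps_after_def)

text \<open>The intervals of a step may overlap. Over a grid that contains all endpoints, the same coefficients \<open>d\<close>
rewrite \<open>\<Sum> c (w b - w a)\<close> for every \<open>w\<close> at once. With \<open>w\<close> a Brownian path this is the integral of the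
step; with \<open>w t = of_bool (s \<le> t)\<close> it is the step function at \<open>s\<close>. This is what links the two in the
isometry.\<close>

lemma step_refinement:
  fixes r :: "nat \<Rightarrow> real"
  assumes r: "strict_mono_on {..n} r"
    and "\<And>c a b. (c, a, b) \<in> set \<phi> \<Longrightarrow> a \<in> r ` {..n} \<and> b \<in> r ` {..n} \<and> a \<le> b"
  shows "\<exists>d. \<forall>w :: real \<Rightarrow> real.
    (\<Sum>(c, a, b)\<leftarrow>\<phi>. c * (w b - w a)) = (\<Sum>i<n. d i * (w (r (Suc i)) - w (r i)))"
  using assms(2)
proof (induction \<phi>)
  case Nil
  show ?case by (auto intro!: exI[of _ "\<lambda>_. 0"])
next
  case (Cons x \<phi>)
  obtain c a b where x: "x = (c, a, b)" by (cases x)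
  obtain d where d: "\<And>w :: real \<Rightarrow> real.
    (\<Sum>(c, a, b)\<leftarrow>\<phi>. c * (w b - w a)) = (\<Sum>i<n. d i * (w (r (Suc i)) - w (r i)))"
  proof -
    have "\<exists>d. \<forall>w :: real \<Rightarrow> real.
      (\<Sum>(c, a, b)\<leftarrow>\<phi>. c * (w b - w a)) = (\<Sum>i<n. d i * (w (r (Suc i)) - w (r i)))"
    proof (rule Cons.IH)
      fix c a b assume "(c, a, b) \<in> set \<phi>"
      then show "a \<in> r ` {..n} \<and> b \<in> r ` {..n} \<and> a \<le> b"
        using Cons.prems[of c a b] by simp
    qed
    with that show thesis by blast
  qed
  obtain j k where jk: "j \<le> n" "k \<le> n" "a = r j" "b = r k" and ab: "a \<le> b"
    using Cons.prems[of c a b] x by auto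
  have "j \<le> k"
    using jk ab r by (meson atMost_iff leD not_le_imp_less strict_mono_onD)
  have "w b - w a = (\<Sum>i<n. (if j \<le> i \<and> i < k then 1 else 0) * (w (r (Suc i)) - w (r i)))" for w :: "real \<Rightarrow> real"
  proof -
    have "(\<Sum>i<n. (if j \<le> i \<and> i < k then 1 else 0) * (w (r (Suc i)) - w (r i)))
        = (\<Sum>i\<in>{j..<k}. w (r (Suc i)) - w (r i))"
      using jk by (intro sum.mono_neutral_cong_right) auto
    also have "\<dots> = w (r k) - w (r j)"
      using \<open>j \<le> k\<close> sum_Suc_diff'[of j k "\<lambda>i. w (r i)"] by simp
    finally show ?thesis using jk by simp
  qed
  then have "\<forall>w :: real \<Rightarrow> real.
    (\<Sum>(c, a, b)\<leftarrow>x # \<phi>. c * (w b - w a))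
    = (\<Sum>i<n. (c * (if j \<le> i \<and> i < k then 1 else 0) + d i) * (w (r (Suc i)) - w (r i)))"
    by (simp only: x d list.map sum_list.Cons prod.case distrib_right sum.distrib sum_distrib_left mult.assoc)
      simp
  then show ?case
    by (intro exI[of _ "\<lambda>i. c * (if j \<le> i \<and> i < k then 1 else 0) + d i"])
qed

lemma finite_set_enumeration:
  fixes E :: "real set"
  assumes "finite E" "E \<noteq> {}"
  shows "\<exists>n r. strict_mono_on {..n::nat} r \<and> r ` {..n} = E"
proof -
  let ?l = "sorted_list_of_set E"
  have len: "length ?l = card E" "0 < card E" using assms by (auto simp: card_gt_0_iff)
  have "strict_mono_on {..card E - 1} ((!) ?l)"
    using sorted_wrt_nth_less[OF strict_sorted_list_of_set[of E]] len
    by (auto intro!: strict_mono_onI)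
  moreover have "(!) ?l ` {..card E - 1} = E"
  proof -
    have "{..card E - 1} = {..<length ?l}" using len by auto
    then have "(!) ?l ` {..card E - 1} = set ?l" by (auto simp: set_conv_nth)
    then show ?thesis using assms by simp
  qed
  ultimately show ?thesis by blast
qed

lemma strict_mono_on_Suc: "strict_mono_on {..n} (r :: nat \<Rightarrow> real) \<Longrightarrow> i < n \<Longrightarrow> r i < r (Suc i)"
  by (rule strict_mono_onD) auto

lemma step_fun_increments:
  assumes "\<And>c a b. (c, a, b) \<in> set \<phi> \<Longrightarrow> a \<le> b"
  shows "step_fun \<phi> s = (\<Sum>(c, a, b)\<leftarrow>\<phi>. c * (of_bool (s \<le> b) - of_bool (s \<le> a)))"
  unfolding step_fun_def
proof (intro arg_cong[where f = sum_list] map_cong refl)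
  fix x assume "x \<in> set \<phi>"
  moreover obtain c a b where "x = (c, a, b)" by (cases x)
  ultimately show "(case x of (c, a, b) \<Rightarrow> c * indicator {a<..b} s)
     = (case x of (c, a, b) \<Rightarrow> c * (of_bool (s \<le> b) - of_bool (s \<le> a)))"
    using assms[of c a b] by (auto simp: indicator_def)
qed

lemma has_bochner_integral_square_disjoint_steps:
  fixes r :: "nat \<Rightarrow> real"
  assumes r: "strict_mono_on {..n} r"
  shows "has_bochner_integral lborel
    (\<lambda>s. (\<Sum>i<n. d i * (of_bool (s \<le> r (Suc i)) - of_bool (s \<le> r i)))\<^sup>2)
    (\<Sum>i<n. (d i)\<^sup>2 * (r (Suc i) - r i))"
proof -
  have lt: "r i < r (Suc i)" if "i < n" for i
    using strict_mono_on_Suc[OF r that] .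
  have le: "r (Suc i) \<le> r j" if "i < j" "j < n" for i j
    using strict_mono_on_leD[OF r, of "Suc i" j] that by auto
  have "(\<Sum>i<n. d i * (of_bool (s \<le> r (Suc i)) - of_bool (s \<le> r i)))\<^sup>2
     = (\<Sum>i<n. (d i)\<^sup>2 * indicator {r i<..r (Suc i)} s)" for s
  proof -
    let ?e = "\<lambda>i. indicator {r i<..r (Suc i)} s :: real"
    have disj: "?e i * ?e j = 0" if "i \<noteq> j" "i < n" "j < n" for i j
      using le[of i j] le[of j i] that by (auto simp: indicator_def neq_iff)
    have "(\<Sum>i<n. d i * (of_bool (s \<le> r (Suc i)) - of_bool (s \<le> r i))) = (\<Sum>i<n. d i * ?e i)"
    proof (intro sum.cong refl)
      fix i assume "i \<in> {..<n}"
      then have "r i < r (Suc i)" using lt by simp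
      then show "d i * (of_bool (s \<le> r (Suc i)) - of_bool (s \<le> r i)) = d i * ?e i"
        by (auto simp: indicator_def)
    qed
    then have "(\<Sum>i<n. d i * (of_bool (s \<le> r (Suc i)) - of_bool (s \<le> r i)))\<^sup>2
      = (\<Sum>i<n. \<Sum>j<n. d i * d j * (?e i * ?e j))"
      by (simp only: power2_eq_square sum_product mult_ac)
    also have "\<dots> = (\<Sum>i<n. \<Sum>j<n. if j = i then (d i)\<^sup>2 * ?e i else 0)"
      using disj by (intro sum.cong refl) (auto simp: power2_eq_square indicator_def)
    also have "\<dots> = (\<Sum>i<n. (d i)\<^sup>2 * ?e i)" by simp
    finally show ?thesis .
  qed
  moreover have "has_bochner_integral lborel (\<lambda>s. \<Sum>i<n. (d i)\<^sup>2 * indicator {r i<..r (Suc i)} s)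
     (\<Sum>i<n. (d i)\<^sup>2 * (r (Suc i) - r i))"
  proof (intro has_bochner_integral_sum has_bochner_integral_mult_right)
    fix i assume i: "i \<in> {..<n}"
    have "has_bochner_integral lborel (indicator {r i<..r (Suc i)}) (measure lborel {r i<..r (Suc i)})"
      using lt[of i] i by (intro has_bochner_integral_real_indicator) auto
    then show "has_bochner_integral lborel (indicator {r i<..r (Suc i)} :: real \<Rightarrow> real) (r (Suc i) - r i)"
      using lt[of i] i by simp
  qed
  ultimately show ?thesis by simp
qed

lemma (in prob_space) centred_normal_moments:
  assumes D: "distributed M lborel S (normal_density 0 \<sigma>)" and "0 < \<sigma>"
  shows "integrable M S" "expectation S = 0"
    "integrable M (\<lambda>x. (S x)\<^sup>2)" "expectation (\<lambda>x. (S x)\<^sup>2) = \<sigma>\<^sup>2"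
    "integrable M (\<lambda>x. (S x) ^ 4)" "expectation (\<lambda>x. (S x) ^ 4) = 3 * (\<sigma>\<^sup>2)\<^sup>2"
proof -
  have int: "integrable M (\<lambda>x. (S x) ^ k)" for k
    using distributed_integrable[OF D, of "\<lambda>x. x ^ k"] integrable_normal_moment[OF \<open>0 < \<sigma>\<close>, of 0 k]
    by (simp add: normal_density_nonneg)
  have ex: "expectation (\<lambda>x. (S x) ^ k) = (\<integral>x. normal_density 0 \<sigma> x * x ^ k \<partial>lborel)" for k
    using distributed_integral[OF D, of "\<lambda>x. x ^ k"] by (simp add: normal_density_nonneg)
  show "integrable M S" "integrable M (\<lambda>x. (S x)\<^sup>2)" "integrable M (\<lambda>x. (S x) ^ 4)"
    using int[of 1] int[of 2] int[of 4] by auto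
  show "expectation S = 0"
    using ex[of 1] integral_normal_moment_odd[OF \<open>0 < \<sigma>\<close>, of 0 0] by simp
  show "expectation (\<lambda>x. (S x)\<^sup>2) = \<sigma>\<^sup>2"
    using ex[of 2] integral_normal_moment_even[OF \<open>0 < \<sigma>\<close>, of 0 1] by simp
  show "expectation (\<lambda>x. (S x) ^ 4) = 3 * (\<sigma>\<^sup>2)\<^sup>2"
    using ex[of 4] integral_normal_moment_even[OF \<open>0 < \<sigma>\<close>, of 0 2] \<open>0 < \<sigma>\<close>
    by (simp add: fact_numeral field_simps)
qed

locale brownian = prob_space P + complete_measure P for P :: "'a measure" +
  fixes W :: "real \<Rightarrow> 'a \<Rightarrow> real"
  assumes brownian: "standard_brownian_motion P W"
begin

lemma W_measurable: "0 \<le> t \<Longrightarrow> W t \<in> borel_measurable P"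
  using brownian by (auto simp: standard_brownian_motion_def)

lemma W_0: "AE \<omega> in P. W 0 \<omega> = 0"
  using brownian by (auto simp: standard_brownian_motion_def)

lemma W_increment:
  "0 \<le> s \<Longrightarrow> s < t \<Longrightarrow> distributed P lborel (\<lambda>\<omega>. W t \<omega> - W s \<omega>) (normal_density 0 (sqrt (t - s)))"
  using brownian by (auto simp: standard_brownian_motion_def)

lemma W_indep:
  "0 \<le> r 0 \<Longrightarrow> (\<And>i. i < n \<Longrightarrow> r i \<le> r (Suc i)) \<Longrightarrow>
    indep_vars (\<lambda>_. borel) (\<lambda>i \<omega>. W (r (Suc i)) \<omega> - W (r i) \<omega>) {..<n::nat}"
  using brownian by (auto simp: standard_brownian_motion_def)

lemma step_wiener_measurable:
  assumes "steps_after 0 \<phi>"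
  shows "step_wiener W \<phi> \<in> borel_measurable P"
  using assms
proof (induction \<phi>)
  case Nil
  then show ?case by (simp add: step_wiener_def[abs_def])
next
  case (Cons x \<phi>)
  obtain c a b where x: "x = (c, a, b)" by (cases x)
  have [measurable]: "W a \<in> borel_measurable P" "W b \<in> borel_measurable P" "step_wiener W \<phi> \<in> borel_measurable P"
    using Cons x by (auto simp: steps_after_def intro!: W_measurable)
  have "step_wiener W (x # \<phi>) = (\<lambda>\<omega>. c * (W b \<omega> - W a \<omega>) + step_wiener W \<phi> \<omega>)"
    by (auto simp: step_wiener_def x)
  then show ?case by simp
qed

text \<open>Over a grid of all endpoints the integral is a sum of independent centred normal variables, so it is centred
normal, and its variance is the integral of the square of the step function. Only the coefficients that do
not vanish are kept, because a normal law must have positive variance; if none remains, the integral is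
\<open>0\<close>.\<close>

lemma step_wiener_moments:
  assumes "steps_after 0 \<phi>"
  defines "v \<equiv> \<integral>s. (step_fun \<phi> s)\<^sup>2 \<partial>lborel"
  shows "integrable lborel (\<lambda>s. (step_fun \<phi> s)\<^sup>2)"
    "integrable P (step_wiener W \<phi>)" "expectation (step_wiener W \<phi>) = 0"
    "integrable P (\<lambda>x. (step_wiener W \<phi> x)\<^sup>2)" "expectation (\<lambda>x. (step_wiener W \<phi> x)\<^sup>2) = v"
    "integrable P (\<lambda>x. (step_wiener W \<phi> x) ^ 4)" "expectation (\<lambda>x. (step_wiener W \<phi> x) ^ 4) = 3 * v\<^sup>2"
proof -
  note \<phi> = steps_afterD[OF assms(1)]
  define E where "E = insert 0 ((\<lambda>(c, a, b). a) ` set \<phi> \<union> (\<lambda>(c, a, b). b) ` set \<phi>)"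
  have E: "finite E" "E \<noteq> {}" "\<And>x. x \<in> E \<Longrightarrow> 0 \<le> x"
    using \<phi> by (auto simp: E_def split: prod.splits) (meson \<phi> order_trans)
  obtain n :: nat and r where r: "strict_mono_on {..n} r" "r ` {..n} = E"
    using finite_set_enumeration[OF E(1,2)] by blast
  have "\<exists>d. \<forall>w :: real \<Rightarrow> real.
    (\<Sum>(c, a, b)\<leftarrow>\<phi>. c * (w b - w a)) = (\<Sum>i<n. d i * (w (r (Suc i)) - w (r i)))"
    using \<phi> by (intro step_refinement r(1)) (force simp: r(2) E_def)+
  then obtain d where d: "\<And>w :: real \<Rightarrow> real.
    (\<Sum>(c, a, b)\<leftarrow>\<phi>. c * (w b - w a)) = (\<Sum>i<n. d i * (w (r (Suc i)) - w (r i)))"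
    by blast
  define V where "V = (\<Sum>i<n. (d i)\<^sup>2 * (r (Suc i) - r i))"
  have "has_bochner_integral lborel (\<lambda>s. (step_fun \<phi> s)\<^sup>2) V"
    using has_bochner_integral_square_disjoint_steps[OF r(1), of d] step_fun_increments[of \<phi>] \<phi>
    by (subst step_fun_increments) (auto simp: d V_def)
  then have step_int: "integrable lborel (\<lambda>s. (step_fun \<phi> s)\<^sup>2)" and v: "v = V"
    by (auto simp: v_def has_bochner_integral_iff)
  have S: "step_wiener W \<phi> \<omega> = (\<Sum>i<n. d i * (W (r (Suc i)) \<omega> - W (r i) \<omega>))" for \<omega>
    using d[of "\<lambda>t. W t \<omega>"] by (simp add: step_wiener_def)
  define J where "J = {i. i < n \<and> d i \<noteq> 0}"
  have SJ: "step_wiener W \<phi> = (\<lambda>\<omega>. \<Sum>i\<in>J. d i * (W (r (Suc i)) \<omega> - W (r i) \<omega>))"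
    unfolding J_def by (intro ext) (auto simp: S intro!: sum.mono_neutral_right)
  have VJ: "V = (\<Sum>i\<in>J. (d i)\<^sup>2 * (r (Suc i) - r i))"
    unfolding J_def V_def by (intro sum.mono_neutral_right) auto
  have lt: "r i < r (Suc i)" if "i < n" for i
    using strict_mono_on_Suc[OF r(1) that] .
  have r0: "0 \<le> r i" if "i \<le> n" for i
    using E(3) r(2) that by blast
  have moments: "integrable P (step_wiener W \<phi>) \<and> expectation (step_wiener W \<phi>) = 0 \<and>
    integrable P (\<lambda>x. (step_wiener W \<phi> x)\<^sup>2) \<and> expectation (\<lambda>x. (step_wiener W \<phi> x)\<^sup>2) = V \<and>
    integrable P (\<lambda>x. (step_wiener W \<phi> x) ^ 4) \<and> expectation (\<lambda>x. (step_wiener W \<phi> x) ^ 4) = 3 * V\<^sup>2"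
  proof (cases "J = {}")
    case True
    then show ?thesis by (simp add: SJ VJ)
  next
    case False
    have J: "finite J" "J \<subseteq> {..<n}" by (auto simp: J_def)
    have ind: "indep_vars (\<lambda>_. borel) (\<lambda>i \<omega>. d i * (W (r (Suc i)) \<omega> - W (r i) \<omega>)) J"
      using indep_vars_compose2[OF indep_vars_subset[OF W_indep[of r n] J(2)], of "\<lambda>i x. d i * x" "\<lambda>_. borel"]
        r0 lt less_imp_le by fastforce
    have dist: "distributed P lborel (\<lambda>\<omega>. d i * (W (r (Suc i)) \<omega> - W (r i) \<omega>))
        (normal_density 0 (\<bar>d i\<bar> * sqrt (r (Suc i) - r i)))" if "i \<in> J" for i
      using normal_density_affine[OF W_increment[of "r i" "r (Suc i)"], of "d i" 0] that lt[of i] r0[of i]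
      by (auto simp: J_def)
    have pos: "0 < \<bar>d i\<bar> * sqrt (r (Suc i) - r i)" if "i \<in> J" for i
      using that lt[of i] by (auto simp: J_def)
    have "distributed P lborel (step_wiener W \<phi>)
       (normal_density (\<Sum>i\<in>J. 0) (sqrt (\<Sum>i\<in>J. (\<bar>d i\<bar> * sqrt (r (Suc i) - r i))\<^sup>2)))"
      unfolding SJ by (intro sum_indep_normal J(1) False ind pos dist)
    moreover have "(\<Sum>i\<in>J. (\<bar>d i\<bar> * sqrt (r (Suc i) - r i))\<^sup>2) = V"
      unfolding VJ using lt by (intro sum.cong refl) (auto simp: J_def power_mult_distrib less_imp_le)
    ultimately have D: "distributed P lborel (step_wiener W \<phi>) (normal_density 0 (sqrt V))"
      by simp
    have "0 < V"
      unfolding VJ using J False lt by (intro sum_pos) (auto simp: J_def)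
    then show ?thesis
      using centred_normal_moments[OF D] by simp
  qed
  show "integrable lborel (\<lambda>s. (step_fun \<phi> s)\<^sup>2)"
    "integrable P (step_wiener W \<phi>)" "expectation (step_wiener W \<phi>) = 0"
    "integrable P (\<lambda>x. (step_wiener W \<phi> x)\<^sup>2)" "expectation (\<lambda>x. (step_wiener W \<phi> x)\<^sup>2) = v"
    "integrable P (\<lambda>x. (step_wiener W \<phi> x) ^ 4)" "expectation (\<lambda>x. (step_wiener W \<phi> x) ^ 4) = 3 * v\<^sup>2"
    using moments step_int by (simp_all add: v)
qed

end

section \<open>Independence of the past\<close>

context brownian begin

lemma sets_filtration_subset: "sets (brownian_filtration P W e) \<subseteq> sets P"
  and space_filtration: "space (brownian_filtration P W e) = space P"
  and sets_filtration: "sets (brownian_filtration P W e) = sigma_sets (space P)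
     ({W s -` A \<inter> space P | s A. 0 \<le> s \<and> ereal s \<le> e \<and> A \<in> sets borel} \<union> null_sets P)"
proof -
  let ?G = "\<lambda>e. {W s -` A \<inter> space P | s A. 0 \<le> s \<and> ereal s \<le> e \<and> A \<in> sets borel} \<union> null_sets P"
  have G: "?G e \<subseteq> sets P" for e
    using measurable_sets[OF W_measurable] by auto
  then have "?G e \<subseteq> Pow (space P)" for e
    using sets.space_closed by blast
  then show *: "sets (brownian_filtration P W e) = sigma_sets (space P) (?G e)"
    and "space (brownian_filtration P W e) = space P" for e
    by (simp_all add: brownian_filtration_def sets_measure_of space_measure_of)
  show "sets (brownian_filtration P W e) \<subseteq> sets P"
    unfolding * by (rule sets.sigma_sets_subset[OF G])
qed

lemma filtration_measurable:
  assumes "h \<in> measurable (brownian_filtration P W e) N"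
  shows "h \<in> measurable P N"
  using assms measurable_mono[of N N "brownian_filtration P W e" P]
  by (auto simp: space_filtration sets_filtration_subset)

text \<open>Place the times in \<open>S\<close>, the time \<open>t\<close> and the endpoints of \<open>\<phi>\<close> on one grid. Positions up to \<open>t\<close> are
sums of the increments before \<open>t\<close>, the integral of \<open>\<phi>\<close> is a combination of the increments after \<open>t\<close>, and
disjoint groups of independent variables are independent.\<close>

lemma past_positions_indep_step_wiener:
  assumes S: "finite S" "S \<subseteq> {0..t}" and t: "0 \<le> t"
    and "steps_after t \<phi>"
    and C: "C \<in> sets (Pi\<^sub>M S (\<lambda>_. borel))" and A: "A \<in> sets borel"
  shows "prob {\<omega> \<in> space P. (\<lambda>s\<in>S. W s \<omega> - W 0 \<omega>) \<in> C \<and> step_wiener W \<phi> \<omega> \<in> A}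
    = prob {\<omega> \<in> space P. (\<lambda>s\<in>S. W s \<omega> - W 0 \<omega>) \<in> C} * prob {\<omega> \<in> space P. step_wiener W \<phi> \<omega> \<in> A}"
proof -
  note \<phi> = steps_afterD[OF \<open>steps_after t \<phi>\<close>]
  define E where "E = {0, t} \<union> S \<union> ((\<lambda>(c, a, b). a) ` set \<phi> \<union> (\<lambda>(c, a, b). b) ` set \<phi>)"
  have "0 \<le> a \<and> 0 \<le> b" if "(c, a, b) \<in> set \<phi>" for c a b
    using \<phi>[OF that] t by linarith
  then have E: "finite E" "E \<noteq> {}" "\<And>x. x \<in> E \<Longrightarrow> 0 \<le> x"
    using S t by (auto simp: E_def split: prod.splits)
  obtain n :: nat and r where r: "strict_mono_on {..n} r" "r ` {..n} = E"
    using finite_set_enumeration[OF E(1,2)] by blast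
  have less_iff: "r i < r j \<longleftrightarrow> i < j" and le_iff: "r i \<le> r j \<longleftrightarrow> i \<le> j" if "i \<le> n" "j \<le> n" for i j
    using strict_mono_on_less[OF r(1), of i j] strict_mono_on_less_eq[OF r(1), of i j] that by auto
  have r0: "r 0 = 0"
  proof -
    have "0 \<in> r ` {..n}" unfolding r(2) by (simp add: E_def)
    then obtain i where "i \<le> n" "r i = 0" by auto
    then have "r 0 \<le> 0" using le_iff[of 0 i] by auto
    moreover have "r 0 \<in> E" using r(2) by blast
    ultimately show ?thesis using E(3) by fastforce
  qed
  have "t \<in> r ` {..n}" unfolding r(2) by (simp add: E_def)
  then obtain m where m: "m \<le> n" "r m = t" by auto
  define r' where "r' i = r (m + i)" for i
  have r': "strict_mono_on {..n - m} r'"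
    using m by (intro strict_mono_onI) (auto simp: r'_def less_iff)
  have "x \<in> r' ` {..n - m}" if x: "x \<in> E" "t \<le> x" for x
  proof -
    obtain i where i: "i \<le> n" "x = r i" using x r(2) by auto
    then have "m \<le> i" using x m le_iff[of m i] by auto
    then have "x = r' (i - m)" "i - m \<in> {..n - m}" using i by (auto simp: r'_def)
    then show ?thesis by blast
  qed
  moreover have "a \<in> E" "b \<in> E" "t \<le> a" "t \<le> b" "a \<le> b" if "(c, a, b) \<in> set \<phi>" for c a b
    using \<phi>[OF that] that by (force simp: E_def)+
  ultimately have "\<exists>d. \<forall>w :: real \<Rightarrow> real.
    (\<Sum>(c, a, b)\<leftarrow>\<phi>. c * (w b - w a)) = (\<Sum>i<n - m. d i * (w (r' (Suc i)) - w (r' i)))"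
    by (intro step_refinement r') blast
  then obtain d where d: "\<And>w :: real \<Rightarrow> real.
    (\<Sum>(c, a, b)\<leftarrow>\<phi>. c * (w b - w a)) = (\<Sum>i<n - m. d i * (w (r' (Suc i)) - w (r' i)))"
    by blast
  let ?\<Delta> = "\<lambda>i \<omega>. W (r (Suc i)) \<omega> - W (r i) \<omega>"
  have "indep_vars (\<lambda>_. borel) ?\<Delta> {..<n}"
    by (rule W_indep) (auto simp: r0 le_iff)
  then have ind: "indep_var (Pi\<^sub>M {..<m} (\<lambda>_. borel)) (\<lambda>\<omega>. \<lambda>i\<in>{..<m}. ?\<Delta> i \<omega>)
      (Pi\<^sub>M {m..<n} (\<lambda>_. borel)) (\<lambda>\<omega>. \<lambda>i\<in>{m..<n}. ?\<Delta> i \<omega>)"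
    using m by (intro indep_var_restrict) auto
  define Y1 where "Y1 z = (\<lambda>s\<in>S. \<Sum>i<m. of_bool (r i < s) * z i)" for z :: "nat \<Rightarrow> real"
  define Y2 where "Y2 z = (\<Sum>i<n - m. d i * z (m + i))" for z :: "nat \<Rightarrow> real"
  have Y1: "Y1 \<in> measurable (Pi\<^sub>M {..<m} (\<lambda>_. borel)) (Pi\<^sub>M S (\<lambda>_. borel))"
    unfolding Y1_def
    by (intro measurable_restrict borel_measurable_sum borel_measurable_times borel_measurable_const
        measurable_component_singleton)
  have Y2: "Y2 \<in> measurable (Pi\<^sub>M {m..<n} (\<lambda>_. borel)) borel"
    unfolding Y2_def
    by (intro borel_measurable_sum borel_measurable_times borel_measurable_const
        measurable_component_singleton) auto
  have "Y1 (\<lambda>i\<in>{..<m}. ?\<Delta> i \<omega>) = (\<lambda>s\<in>S. W s \<omega> - W 0 \<omega>)" for \<omega>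
    unfolding Y1_def
  proof (intro restrict_ext)
    fix s assume s: "s \<in> S"
    then have "s \<in> r ` {..n}" unfolding r(2) by (simp add: E_def)
    then obtain j where j: "j \<le> n" "s = r j" by auto
    then have "j \<le> m" using s S(2) m le_iff[of j m] by auto
    have "(\<Sum>i<m. of_bool (r i < s) * (\<lambda>i\<in>{..<m}. ?\<Delta> i \<omega>) i) = (\<Sum>i<j. ?\<Delta> i \<omega>)"
      using j \<open>j \<le> m\<close> m by (intro sum.mono_neutral_cong_right) (auto simp: less_iff)
    also have "\<dots> = W s \<omega> - W 0 \<omega>"
      using sum_lessThan_telescope[of "\<lambda>i. W (r i) \<omega>" j] j r0 by simp
    finally show "(\<Sum>i<m. of_bool (r i < s) * (\<lambda>i\<in>{..<m}. ?\<Delta> i \<omega>) i) = W s \<omega> - W 0 \<omega>" .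
  qed
  moreover have "Y2 (\<lambda>i\<in>{m..<n}. ?\<Delta> i \<omega>) = step_wiener W \<phi> \<omega>" for \<omega>
    using d[of "\<lambda>t. W t \<omega>"] by (auto simp: Y2_def step_wiener_def r'_def intro!: sum.cong)
  moreover have "prob ((\<lambda>\<omega>. (\<lambda>i\<in>{..<m}. ?\<Delta> i \<omega>, \<lambda>i\<in>{m..<n}. ?\<Delta> i \<omega>)) -`
      ((Y1 -` C \<inter> space (Pi\<^sub>M {..<m} (\<lambda>_. borel))) \<times> (Y2 -` A \<inter> space (Pi\<^sub>M {m..<n} (\<lambda>_. borel)))) \<inter> space P)
    = prob ((\<lambda>\<omega>. \<lambda>i\<in>{..<m}. ?\<Delta> i \<omega>) -` (Y1 -` C \<inter> space (Pi\<^sub>M {..<m} (\<lambda>_. borel))) \<inter> space P)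
      * prob ((\<lambda>\<omega>. \<lambda>i\<in>{m..<n}. ?\<Delta> i \<omega>) -` (Y2 -` A \<inter> space (Pi\<^sub>M {m..<n} (\<lambda>_. borel))) \<inter> space P)"
    by (intro indep_varD[OF ind] measurable_sets[OF Y1 C] measurable_sets[OF Y2 A])
  ultimately show ?thesis
    by (simp add: vimage_def Int_def space_PiM conj_commute cong: conj_cong)
qed

text \<open>A family that generates the filtration up to \<open>t\<close> and is closed under intersection. Equality up to a null set
brings in the null sets of the filtration and lets \<open>W\<close> be measured from \<open>W 0\<close>, which is \<open>0\<close> almost
surely.\<close>

definition past_events :: "real \<Rightarrow> 'a set set" where
  "past_events t = {B \<in> sets P. \<exists>S C. finite S \<and> S \<subseteq> {0..t} \<and> C \<in> sets (Pi\<^sub>M S (\<lambda>_. borel)) \<and>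
     (AE \<omega> in P. \<omega> \<in> B \<longleftrightarrow> (\<lambda>s\<in>S. W s \<omega> - W 0 \<omega>) \<in> C)}"

lemma past_eventsI:
  "B \<in> sets P \<Longrightarrow> finite S \<Longrightarrow> S \<subseteq> {0..t} \<Longrightarrow> C \<in> sets (Pi\<^sub>M S (\<lambda>_. borel)) \<Longrightarrow>
     (AE \<omega> in P. \<omega> \<in> B \<longleftrightarrow> (\<lambda>s\<in>S. W s \<omega> - W 0 \<omega>) \<in> C) \<Longrightarrow> B \<in> past_events t"
  unfolding past_events_def by blast

lemma Int_stable_past_events: "Int_stable (past_events t)"
proof (rule Int_stableI)
  fix A B assume "A \<in> past_events t" "B \<in> past_events t"
  then obtain S1 C1 S2 C2 where
    1: "A \<in> sets P" "finite S1" "S1 \<subseteq> {0..t}" "C1 \<in> sets (Pi\<^sub>M S1 (\<lambda>_. borel))"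
      "AE \<omega> in P. \<omega> \<in> A \<longleftrightarrow> (\<lambda>s\<in>S1. W s \<omega> - W 0 \<omega>) \<in> C1" and
    2: "B \<in> sets P" "finite S2" "S2 \<subseteq> {0..t}" "C2 \<in> sets (Pi\<^sub>M S2 (\<lambda>_. borel))"
      "AE \<omega> in P. \<omega> \<in> B \<longleftrightarrow> (\<lambda>s\<in>S2. W s \<omega> - W 0 \<omega>) \<in> C2"
    unfolding past_events_def by blast
  let ?M = "Pi\<^sub>M (S1 \<union> S2) (\<lambda>_. borel :: real measure)"
  have [measurable]: "(\<lambda>z. restrict z S1) \<in> measurable ?M (Pi\<^sub>M S1 (\<lambda>_. borel))"
    "(\<lambda>z. restrict z S2) \<in> measurable ?M (Pi\<^sub>M S2 (\<lambda>_. borel))"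
    by (auto intro!: measurable_restrict_subset)
  let ?C = "{z \<in> space ?M. restrict z S1 \<in> C1 \<and> restrict z S2 \<in> C2}"
  note [measurable] = 1(4) 2(4)
  show "A \<inter> B \<in> past_events t"
  proof (rule past_eventsI[of _ "S1 \<union> S2" _ ?C])
    show "AE \<omega> in P. \<omega> \<in> A \<inter> B \<longleftrightarrow> (\<lambda>s\<in>S1 \<union> S2. W s \<omega> - W 0 \<omega>) \<in> ?C"
      using 1(5) 2(5)
    proof eventually_elim
      case (elim \<omega>)
      have "restrict (\<lambda>s\<in>S1 \<union> S2. W s \<omega> - W 0 \<omega>) S1 = (\<lambda>s\<in>S1. W s \<omega> - W 0 \<omega>)"
        "restrict (\<lambda>s\<in>S1 \<union> S2. W s \<omega> - W 0 \<omega>) S2 = (\<lambda>s\<in>S2. W s \<omega> - W 0 \<omega>)"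
        by (auto simp: restrict_def)
      with elim show ?case by (simp add: space_PiM)
    qed
  qed (use 1 2 in \<open>auto\<close>)
qed

lemma filtration_subset_past_events:
  assumes "0 \<le> t"
  shows "sets (brownian_filtration P W (ereal t)) \<subseteq> sigma_sets (space P) (past_events t)"
  unfolding sets_filtration
proof (rule sigma_sets_mono', safe)
  fix s A assume s: "0 \<le> s" "ereal s \<le> ereal t" and A: "A \<in> sets (borel :: real measure)"
  let ?C = "{z \<in> space (Pi\<^sub>M {s} (\<lambda>_. borel)). z s \<in> A}"
  note [measurable] = A
  show "W s -` A \<inter> space P \<in> past_events t"
  proof (rule past_eventsI[of _ "{s}" _ ?C])
    show "W s -` A \<inter> space P \<in> sets P" using measurable_sets[OF W_measurable A] s by simp
    show "AE \<omega> in P. \<omega> \<in> W s -` A \<inter> space P \<longleftrightarrow> (\<lambda>s\<in>{s}. W s \<omega> - W 0 \<omega>) \<in> ?C"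
      using W_0 AE_space by eventually_elim (auto simp: space_PiM)
  qed (use s in \<open>auto\<close>)
next
  fix N assume "N \<in> null_sets P"
  then show "N \<in> past_events t"
    by (intro past_eventsI[of _ "{}" _ "{}"]) (auto dest: AE_not_in)
qed

lemma filtration_indep_step_wiener:
  assumes t: "0 \<le> t" and \<phi>: "steps_after t \<phi>"
    and h: "h \<in> borel_measurable (brownian_filtration P W (ereal t))"
  shows "indep_var borel h borel (step_wiener W \<phi>)"
proof -
  have S[measurable]: "step_wiener W \<phi> \<in> borel_measurable P"
    by (rule step_wiener_measurable[OF steps_after_mono[OF \<phi> t]])
  let ?G = "{step_wiener W \<phi> -` A \<inter> space P | A. A \<in> sets borel}"
  have "indep_set (past_events t) ?G"
  proof (rule indep_setI)
    fix B D assume "B \<in> past_events t" "D \<in> ?G"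
    then obtain S C A where B: "B \<in> sets P" "finite S" "S \<subseteq> {0..t}" "C \<in> sets (Pi\<^sub>M S (\<lambda>_. borel))"
      "AE \<omega> in P. \<omega> \<in> B \<longleftrightarrow> (\<lambda>s\<in>S. W s \<omega> - W 0 \<omega>) \<in> C"
      and D: "D = step_wiener W \<phi> -` A \<inter> space P" "A \<in> sets borel"
      unfolding past_events_def by blast
    let ?Z = "\<lambda>\<omega>. \<lambda>s\<in>S. W s \<omega> - W 0 \<omega>"
    have Z[measurable]: "?Z \<in> measurable P (Pi\<^sub>M S (\<lambda>_. borel))"
      using B(3) t by (intro measurable_restrict borel_measurable_diff W_measurable) auto
    note [measurable] = B(1,4) D(2)
    have "prob (B \<inter> D) = prob {\<omega> \<in> space P. ?Z \<omega> \<in> C \<and> step_wiener W \<phi> \<omega> \<in> A}"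
      using B(5) by (intro finite_measure_eq_AE) (auto simp: D)
    also have "\<dots> = prob {\<omega> \<in> space P. ?Z \<omega> \<in> C} * prob {\<omega> \<in> space P. step_wiener W \<phi> \<omega> \<in> A}"
      by (rule past_positions_indep_step_wiener[OF B(2,3) t \<phi> B(4) D(2)])
    also have "prob {\<omega> \<in> space P. ?Z \<omega> \<in> C} = prob B"
      using B(5) by (intro finite_measure_eq_AE) auto
    also have "{\<omega> \<in> space P. step_wiener W \<phi> \<omega> \<in> A} = D"
      by (auto simp: D)
    finally show "prob (B \<inter> D) = prob B * prob D" .
  qed (auto simp: past_events_def)
  moreover have "Int_stable ?G"
  proof (rule Int_stableI)
    fix X Y assume "X \<in> ?G" "Y \<in> ?G"
    then obtain A B where "X = step_wiener W \<phi> -` A \<inter> space P" "Y = step_wiener W \<phi> -` B \<inter> space P"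
      "A \<in> sets borel" "B \<in> sets borel" by blast
    then have "X \<inter> Y = step_wiener W \<phi> -` (A \<inter> B) \<inter> space P" "A \<inter> B \<in> sets borel" by auto
    then show "X \<inter> Y \<in> ?G" by blast
  qed
  ultimately have ind: "indep_set (sigma_sets (space P) (past_events t)) (sigma_sets (space P) ?G)"
    using Int_stable_past_events by (intro indep_set_sigma_sets) auto
  have "h -` A \<inter> space P \<in> sets (brownian_filtration P W (ereal t))" if "A \<in> sets borel" for A
    using measurable_sets[OF h that] by (simp add: space_filtration)
  then have "sigma_sets (space P) {h -` A \<inter> space P | A. A \<in> sets borel}
      \<subseteq> sets (brownian_filtration P W (ereal t))"
    using sets.sigma_sets_subset[of "{h -` A \<inter> space P | A. A \<in> sets borel}" "brownian_filtration P W (ereal t)"]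
    unfolding space_filtration by blast
  then have "sigma_sets (space P) {h -` A \<inter> space P | A. A \<in> sets borel}
      \<subseteq> sigma_sets (space P) (past_events t)"
    using filtration_subset_past_events[OF t] by blast
  then have "indep_set (sigma_sets (space P) {h -` A \<inter> space P | A. A \<in> sets borel})
      (sigma_sets (space P) ?G)"
    using ind unfolding indep_set_def by (rule_tac indep_sets_mono_sets) (auto split: bool.split)
  then show ?thesis
    unfolding indep_var_eq using S filtration_measurable[OF h] by simp
qed

end

section \<open>Mean-square limits\<close>

text \<open>For every \<open>d > 0\<close>, \<open>\<bar>a\<^sup>2 - b\<^sup>2\<bar> \<le> (1 + 1 / d) (a - b)\<^sup>2 + d b\<^sup>2\<close>. Integrated with the square root of the
mean-square error as \<open>d\<close>, this bounds the difference of the integrals by a null sequence.\<close>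

lemma L2_limit:
  fixes g :: "nat \<Rightarrow> 'a \<Rightarrow> real"
  assumes [measurable]: "\<And>n. g n \<in> borel_measurable M" "G \<in> borel_measurable M" "h \<in> borel_measurable M"
    and int: "\<And>n. integrable M (\<lambda>x. (g n x)\<^sup>2)"
    and lim: "(\<lambda>n. \<integral>\<^sup>+ x. ennreal ((g n x - G x)\<^sup>2) \<partial>M) \<longlonglongrightarrow> 0"
    and h: "\<And>x. \<bar>h x\<bar> \<le> (K::real)"
  shows "integrable M (\<lambda>x. (G x)\<^sup>2)"
    and "(\<lambda>n. \<integral>x. h x * (g n x)\<^sup>2 \<partial>M) \<longlonglongrightarrow> (\<integral>x. h x * (G x)\<^sup>2 \<partial>M)"
proof -
  let ?e = "\<lambda>n. \<integral>x. (g n x - G x)\<^sup>2 \<partial>M"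
  have "eventually (\<lambda>n. (\<integral>\<^sup>+ x. ennreal ((g n x - G x)\<^sup>2) \<partial>M) < 1) sequentially"
    by (rule order_tendstoD(2)[OF lim]) simp
  then have ev: "eventually (\<lambda>n. integrable M (\<lambda>x. (g n x - G x)\<^sup>2)) sequentially"
    by eventually_elim (auto intro!: integrableI_bounded intro: order_less_trans)
  have "?e = (\<lambda>n. enn2real (\<integral>\<^sup>+ x. ennreal ((g n x - G x)\<^sup>2) \<partial>M))"
    by (intro ext integral_eq_nn_integral) auto
  then have e: "?e \<longlonglongrightarrow> 0"
    using tendsto_enn2real[of _ 0] lim by simp
  have e0: "0 \<le> ?e n" for n by simp
  obtain m where m: "integrable M (\<lambda>x. (g m x - G x)\<^sup>2)"
    using eventually_happens'[OF _ ev] by auto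
  show G: "integrable M (\<lambda>x. (G x)\<^sup>2)"
  proof (rule Bochner_Integration.integrable_bound)
    show "integrable M (\<lambda>x. 2 * (g m x)\<^sup>2 + 2 * (g m x - G x)\<^sup>2)"
      using m int by auto
    have "(G x)\<^sup>2 \<le> 2 * (g m x)\<^sup>2 + 2 * (g m x - G x)\<^sup>2" for x
      using zero_le_power2[of "2 * g m x - G x"] by (simp add: power2_eq_square algebra_simps)
    then show "AE x in M. norm ((G x)\<^sup>2) \<le> norm (2 * (g m x)\<^sup>2 + 2 * (g m x - G x)\<^sup>2)"
      by simp
  qed auto
  have K: "0 \<le> K" if "x \<in> space M" for x using h[of x] by linarith
  have hint: "integrable M (\<lambda>x. h x * q x)" if "integrable M q" for q :: "'a \<Rightarrow> real"
  proof (rule Bochner_Integration.integrable_bound[where f = "\<lambda>x. K * q x"])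
    show "AE x in M. norm (h x * q x) \<le> norm (K * q x)"
      using h K by (auto simp: abs_mult intro!: mult_right_mono)
  qed (use that in auto)
  \<comment> \<open>The extra term keeps \<open>d\<close> positive when the mean-square error vanishes.\<close>
  let ?d = "\<lambda>n. sqrt (?e n) + inverse (real (Suc n))"
  let ?I = "\<integral>x. (G x)\<^sup>2 \<partial>M"
  have "eventually (\<lambda>n. \<bar>(\<integral>x. h x * (g n x)\<^sup>2 \<partial>M) - (\<integral>x. h x * (G x)\<^sup>2 \<partial>M)\<bar>
      \<le> \<bar>K\<bar> * (?e n + sqrt (?e n) + ?d n * ?I)) sequentially"
    using ev
  proof eventually_elim
    case (elim n)
    define d where "d = ?d n"
    define e where "e = ?e n"
    have d: "0 < d" unfolding d_def by (simp add: add_nonneg_pos)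
    have pt: "\<bar>(a::real)\<^sup>2 - b\<^sup>2\<bar> \<le> (1 + inverse d) * (a - b)\<^sup>2 + d * b\<^sup>2" for a b
    proof -
      have "0 \<le> (inverse d) * (\<bar>a - b\<bar> - d * \<bar>b\<bar>)\<^sup>2" using d by simp
      also have "\<dots> = inverse d * (a - b)\<^sup>2 + d * b\<^sup>2 - 2 * (\<bar>a - b\<bar> * \<bar>b\<bar>)"
        using d by (simp add: power2_diff power_mult_distrib field_simps power2_eq_square[of d])
      finally have "2 * \<bar>(a - b) * b\<bar> \<le> inverse d * (a - b)\<^sup>2 + d * b\<^sup>2" by (simp add: abs_mult)
      moreover have "a\<^sup>2 - b\<^sup>2 = (a - b)\<^sup>2 + 2 * ((a - b) * b)"
        by (simp add: power2_eq_square algebra_simps)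
      then have "\<bar>a\<^sup>2 - b\<^sup>2\<bar> \<le> (a - b)\<^sup>2 + 2 * \<bar>(a - b) * b\<bar>" by (smt (verit) zero_le_power2)
      ultimately show ?thesis unfolding distrib_right mult_1 by linarith
    qed
    have "\<bar>(\<integral>x. h x * (g n x)\<^sup>2 \<partial>M) - (\<integral>x. h x * (G x)\<^sup>2 \<partial>M)\<bar>
      = norm (\<integral>x. h x * ((g n x)\<^sup>2 - (G x)\<^sup>2) \<partial>M)"
      using hint[OF int] hint[OF G] by (simp add: right_diff_distrib)
    also have "\<dots> \<le> (\<integral>x. \<bar>K\<bar> * ((1 + inverse d) * (g n x - G x)\<^sup>2 + d * (G x)\<^sup>2) \<partial>M)"
    proof (rule order_trans[OF integral_norm_bound integral_mono])
      show "integrable M (\<lambda>x. norm (h x * ((g n x)\<^sup>2 - (G x)\<^sup>2)))" using int G by (intro integrable_norm hint) auto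
      show "integrable M (\<lambda>x. \<bar>K\<bar> * ((1 + inverse d) * (g n x - G x)\<^sup>2 + d * (G x)\<^sup>2))"
        using elim G by auto
      show "norm (h x * ((g n x)\<^sup>2 - (G x)\<^sup>2)) \<le> \<bar>K\<bar> * ((1 + inverse d) * (g n x - G x)\<^sup>2 + d * (G x)\<^sup>2)" for x
        unfolding real_norm_def abs_mult using h[of x] by (intro mult_mono pt) auto
    qed
    also have "\<dots> = \<bar>K\<bar> * ((1 + inverse d) * e + d * ?I)"
      using elim G by (simp add: e_def)
    also have "\<dots> \<le> \<bar>K\<bar> * (e + sqrt e + d * ?I)"
    proof -
      have "e = sqrt e * sqrt e" using e0[of n] by (simp add: e_def)
      also have "\<dots> \<le> d * sqrt e" using e0[of n] by (intro mult_right_mono) (auto simp: e_def d_def)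
      finally have "inverse d * e \<le> sqrt e"
        using d by (simp add: field_simps)
      then show ?thesis
        by (intro mult_left_mono) (auto simp: distrib_right)
    qed
    finally have "\<bar>(\<integral>x. h x * (g n x)\<^sup>2 \<partial>M) - (\<integral>x. h x * (G x)\<^sup>2 \<partial>M)\<bar> \<le> \<bar>K\<bar> * (e + sqrt e + d * ?I)" .
    then show ?case unfolding e_def d_def .
  qed
  then have bound: "eventually (\<lambda>n. norm ((\<integral>x. h x * (g n x)\<^sup>2 \<partial>M) - (\<integral>x. h x * (G x)\<^sup>2 \<partial>M))
      \<le> \<bar>K\<bar> * (?e n + sqrt (?e n) + ?d n * ?I)) sequentially"
    unfolding real_norm_def .
  have "(\<lambda>n. \<bar>K\<bar> * (?e n + sqrt (?e n) + ?d n * ?I)) \<longlonglongrightarrow> \<bar>K\<bar> * (0 + sqrt 0 + (sqrt 0 + 0) * ?I)"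
    by (intro tendsto_intros e LIMSEQ_inverse_real_of_nat)
  moreover have "\<bar>K\<bar> * (0 + sqrt 0 + (sqrt 0 + 0) * ?I) = 0" by simp
  ultimately have "(\<lambda>n. \<bar>K\<bar> * (?e n + sqrt (?e n) + ?d n * ?I)) \<longlonglongrightarrow> 0" by (rule back_subst)
  with bound have "(\<lambda>n. (\<integral>x. h x * (g n x)\<^sup>2 \<partial>M) - (\<integral>x. h x * (G x)\<^sup>2 \<partial>M)) \<longlonglongrightarrow> 0"
    by (rule Lim_null_comparison)
  then show "(\<lambda>n. \<integral>x. h x * (g n x)\<^sup>2 \<partial>M) \<longlonglongrightarrow> (\<integral>x. h x * (G x)\<^sup>2 \<partial>M)"
    by (rule LIM_zero_cancel)
qed

text \<open>Follows from the convergence of the squares by polarization: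
\<open>4 q = (q + 1)\<^sup>2 - (q - 1)\<^sup>2\<close>.\<close>

lemma (in finite_measure) L2_limit_integral:
  fixes g :: "nat \<Rightarrow> 'a \<Rightarrow> real"
  assumes [measurable]: "\<And>n. g n \<in> borel_measurable M" "G \<in> borel_measurable M" "h \<in> borel_measurable M"
    and int: "\<And>n. integrable M (\<lambda>x. (g n x)\<^sup>2)"
    and lim: "(\<lambda>n. \<integral>\<^sup>+ x. ennreal ((g n x - G x)\<^sup>2) \<partial>M) \<longlonglongrightarrow> 0"
    and h: "\<And>x. \<bar>h x\<bar> \<le> (K::real)"
  shows "(\<lambda>n. \<integral>x. h x * g n x \<partial>M) \<longlonglongrightarrow> (\<integral>x. h x * G x \<partial>M)"
proof -
  have sq: "integrable M (\<lambda>x. (q x + c)\<^sup>2)"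
    if [measurable]: "q \<in> borel_measurable M" and q: "integrable M (\<lambda>x. (q x)\<^sup>2)" for q and c :: real
  proof (rule Bochner_Integration.integrable_bound[where f = "\<lambda>x. 2 * (q x)\<^sup>2 + 2 * c\<^sup>2"])
    have "(q x + c)\<^sup>2 \<le> 2 * (q x)\<^sup>2 + 2 * c\<^sup>2" for x
      using zero_le_power2[of "q x - c"] by (simp add: power2_eq_square algebra_simps)
    then show "AE x in M. norm ((q x + c)\<^sup>2) \<le> norm (2 * (q x)\<^sup>2 + 2 * c\<^sup>2)" by simp
  qed (use q in auto)
  have G: "integrable M (\<lambda>x. (G x)\<^sup>2)"
    by (rule L2_limit(1)[OF assms])
  have hsq: "integrable M (\<lambda>x. h x * (q x + c)\<^sup>2)"
    if [measurable]: "q \<in> borel_measurable M" and q: "integrable M (\<lambda>x. (q x)\<^sup>2)" for q c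
  proof (rule Bochner_Integration.integrable_bound[where f = "\<lambda>x. K * (q x + c)\<^sup>2"])
    have "\<bar>h x\<bar> \<le> \<bar>K\<bar>" for x using h[of x] by linarith
    then show "AE x in M. norm (h x * (q x + c)\<^sup>2) \<le> norm (K * (q x + c)\<^sup>2)"
      by (auto simp: abs_mult intro!: mult_right_mono)
  qed (use sq[OF that] in auto)
  have L: "(\<lambda>n. \<integral>x. h x * (g n x + c)\<^sup>2 \<partial>M) \<longlonglongrightarrow> (\<integral>x. h x * (G x + c)\<^sup>2 \<partial>M)" for c
    by (rule L2_limit(2)[where K = K]) (use lim h sq[OF _ int] in auto)
  have pol: "(\<integral>x. h x * q x \<partial>M) = ((\<integral>x. h x * (q x + 1)\<^sup>2 \<partial>M) - (\<integral>x. h x * (q x + - 1)\<^sup>2 \<partial>M)) / 4"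
    if "q \<in> borel_measurable M" "integrable M (\<lambda>x. (q x)\<^sup>2)" for q
  proof -
    have "(\<integral>x. h x * (q x + 1)\<^sup>2 \<partial>M) - (\<integral>x. h x * (q x + - 1)\<^sup>2 \<partial>M)
      = (\<integral>x. h x * (q x + 1)\<^sup>2 - h x * (q x + - 1)\<^sup>2 \<partial>M)"
      by (rule Bochner_Integration.integral_diff[symmetric]; rule hsq[OF that])
    also have "\<dots> = (\<integral>x. 4 * (h x * q x) \<partial>M)"
      by (intro Bochner_Integration.integral_cong) (auto simp: power2_eq_square algebra_simps)
    finally show ?thesis by simp
  qed
  show ?thesis
    unfolding pol[OF assms(1) int] pol[OF assms(2) G] by (intro tendsto_intros L) simp
qed

section \<open>Increments of the Wiener integral\<close>

definition step_after :: "real \<Rightarrow> step \<Rightarrow> step" where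
  "step_after s = map (\<lambda>(c, a, b). (c, max a s, max b s))"

definition step_before :: "real \<Rightarrow> step \<Rightarrow> step" where
  "step_before s = map (\<lambda>(c, a, b). (c, min a s, min b s))"

definition step_neg :: "step \<Rightarrow> step" where
  "step_neg = map (\<lambda>(c, a, b). (- c, a, b))"

lemma step_wiener_split:
  "step_wiener W \<phi> \<omega> = step_wiener W (step_before s \<phi>) \<omega> + step_wiener W (step_after s \<phi>) \<omega>"
  by (induction \<phi>)
    (auto simp: step_wiener_def step_before_def step_after_def algebra_simps max_def min_def)

lemma step_wiener_append_neg:
  "step_wiener W (\<phi> @ step_neg \<psi>) \<omega> = step_wiener W \<phi> \<omega> - step_wiener W \<psi> \<omega>"
proof -
  have "step_wiener W (step_neg \<psi>) \<omega> = - step_wiener W \<psi> \<omega>"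
    by (induction \<psi>) (auto simp: step_wiener_def step_neg_def)
  then show ?thesis by (simp add: step_wiener_def)
qed

lemma step_fun_append_neg: "step_fun (\<phi> @ step_neg \<psi>) x = step_fun \<phi> x - step_fun \<psi> x"
proof -
  have "step_fun (step_neg \<psi>) x = - step_fun \<psi> x"
    by (induction \<psi>) (auto simp: step_fun_def step_neg_def)
  then show ?thesis by (simp add: step_fun_def)
qed

lemma step_fun_before: "step_fun (step_before s \<phi>) x = indicator {..s} x * step_fun \<phi> x"
  by (induction \<phi>) (auto simp: step_fun_def step_before_def indicator_def)

lemma step_fun_after: "step_fun (step_after s \<phi>) x = indicator {s<..} x * step_fun \<phi> x"
  by (induction \<phi>) (auto simp: step_fun_def step_after_def indicator_def max_def)

lemma step_fun_eq_0: "(\<And>c a b. (c, a, b) \<in> set \<phi> \<Longrightarrow> 0 \<le> a \<and> b \<le> t) \<Longrightarrow> x \<notin> {0..t} \<Longrightarrow> step_fun \<phi> x = 0"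
proof (induction \<phi>)
  case (Cons p \<phi>)
  obtain c a b where p: "p = (c, a, b)" by (cases p)
  have "x \<notin> {a<..b}" using Cons.prems(1)[of c a b] Cons.prems(2) p by auto
  moreover have "step_fun \<phi> x = 0" using Cons.prems by (intro Cons.IH) auto
  ultimately show ?case by (simp add: step_fun_def p)
qed (simp add: step_fun_def)

lemma step_fun_measurable[measurable]: "step_fun \<phi> \<in> borel_measurable borel"
proof (induction \<phi>)
  case (Cons x \<phi>)
  obtain c a b where "x = (c, a, b)" by (cases x)
  then have "step_fun (x # \<phi>) = (\<lambda>s. c * indicator {a<..b} s + step_fun \<phi> s)"
    by (auto simp: step_fun_def)
  then show ?case using Cons by simp
qed (simp add: step_fun_def[abs_def])

lemma square_triangle: "((x::real) + y + z)\<^sup>2 \<le> 3 * x\<^sup>2 + 3 * y\<^sup>2 + 3 * z\<^sup>2"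
  using zero_le_power2[of "x - y"] zero_le_power2[of "x - z"] zero_le_power2[of "y - z"]
  by (simp add: power2_eq_square algebra_simps)

lemma square_diff_le: "((x::real) - y)\<^sup>2 \<le> 2 * x\<^sup>2 + 2 * y\<^sup>2"
  using zero_le_power2[of "x + y"] by (simp add: power2_eq_square algebra_simps)

lemma tendsto_0_ennreal_le:
  fixes f g :: "nat \<Rightarrow> ennreal"
  assumes "\<And>n. f n \<le> g n" "g \<longlonglongrightarrow> l" "l = 0"
  shows "f \<longlonglongrightarrow> 0"
  by (rule tendsto_sandwich[OF _ _ tendsto_const assms(2)[unfolded assms(3)]]) (use assms in auto)

locale wiener_integral = brownian P W for P :: "'a measure" and W +
  fixes f :: "real \<Rightarrow> real" and I :: "real \<Rightarrow> 'a \<Rightarrow> real"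
  assumes f_cont: "continuous_on {0..} f"
    and I: "wiener_integral_process P W f I"
begin

lemma I_measurable: "0 \<le> t \<Longrightarrow> I t \<in> borel_measurable P"
  using I by (auto simp: wiener_integral_process_def is_wiener_integral_def)

lemma wiener_integral_at: "0 \<le> t \<Longrightarrow> is_wiener_integral P W f t (I t)"
  using I by (auto simp: wiener_integral_process_def)

text \<open>The integrals over \<open>[0, t]\<close> and \<open>[0, s]\<close> come with unrelated approximating steps \<open>\<phi>\<close> and \<open>\<psi>\<close>. Cut
\<open>\<phi>\<close> at \<open>s\<close>. Its part before \<open>s\<close> and \<open>\<psi>\<close> both approximate \<open>f\<close> on \<open>[0, s]\<close>, so by the isometry their
integrals differ little in mean square; its part after \<open>s\<close> therefore approximates the increment. That it only
uses increments of \<open>W\<close> after \<open>s\<close> is the source of independence.\<close>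

lemma increment_approximation:
  assumes s: "0 \<le> s" "s \<le> t"
  shows "\<exists>\<theta>. (\<forall>n. steps_after s (\<theta> n)) \<and>
    (\<lambda>n. \<integral>\<^sup>+ x. ennreal ((step_fun (\<theta> n) x - indicator {s<..t} x * f x)\<^sup>2) \<partial>lborel) \<longlonglongrightarrow> 0 \<and>
    (\<lambda>n. \<integral>\<^sup>+ \<omega>. ennreal ((step_wiener W (\<theta> n) \<omega> - (I t \<omega> - I s \<omega>))\<^sup>2) \<partial>P) \<longlonglongrightarrow> 0"
proof -
  have t: "0 \<le> t" using s by simp
  obtain \<phi> where \<phi>_all: "\<forall>n. \<forall>(c, a, b)\<in>set (\<phi> n). 0 \<le> a \<and> a \<le> b \<and> b \<le> t"
    and \<phi>_lim: "(\<lambda>n. \<integral>\<^sup>+ x\<in>{0..t}. ennreal ((step_fun (\<phi> n) x - f x)\<^sup>2) \<partial>lborel) \<longlonglongrightarrow> 0"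
    "(\<lambda>n. \<integral>\<^sup>+ \<omega>. ennreal ((step_wiener W (\<phi> n) \<omega> - I t \<omega>)\<^sup>2) \<partial>P) \<longlonglongrightarrow> 0"
    using wiener_integral_at[of t] s unfolding is_wiener_integral_def by auto
  have \<phi>: "0 \<le> a \<and> a \<le> b \<and> b \<le> t" if "(c, a, b) \<in> set (\<phi> n)" for n c a b
    using bspec[OF spec[OF \<phi>_all] that] by simp
  obtain \<psi> where \<psi>_all: "\<forall>n. \<forall>(c, a, b)\<in>set (\<psi> n). 0 \<le> a \<and> a \<le> b \<and> b \<le> s"
    and \<psi>_lim: "(\<lambda>n. \<integral>\<^sup>+ x\<in>{0..s}. ennreal ((step_fun (\<psi> n) x - f x)\<^sup>2) \<partial>lborel) \<longlonglongrightarrow> 0"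
    "(\<lambda>n. \<integral>\<^sup>+ \<omega>. ennreal ((step_wiener W (\<psi> n) \<omega> - I s \<omega>)\<^sup>2) \<partial>P) \<longlonglongrightarrow> 0"
    using wiener_integral_at[of s] s unfolding is_wiener_integral_def by auto
  have \<psi>: "0 \<le> a \<and> a \<le> b \<and> b \<le> s" if "(c, a, b) \<in> set (\<psi> n)" for n c a b
    using bspec[OF spec[OF \<psi>_all] that] by simp
  let ?\<theta> = "\<lambda>n. step_after s (\<phi> n)" and ?\<eta> = "\<lambda>n. step_before s (\<phi> n) @ step_neg (\<psi> n)"
  have \<theta>: "steps_after s (?\<theta> n)" for n
    by (auto simp: steps_after_def step_after_def max_def dest!: \<phi>)
  have \<eta>: "steps_after 0 (?\<eta> n)" for n
    using s by (auto simp: steps_after_def step_before_def step_neg_def min_def dest!: \<phi> \<psi>)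
  have \<phi>\<psi>: "steps_after 0 (\<phi> n)" "steps_after 0 (\<psi> n)" for n
    by (auto simp: steps_after_def dest!: \<phi> \<psi>)
  define f0 where "f0 x = f (max 0 x)" for x
  have "continuous_on UNIV f0"
    unfolding f0_def by (rule continuous_on_compose2[OF f_cont]) (auto intro!: continuous_intros)
  then have [measurable]: "f0 \<in> borel_measurable borel" by (rule borel_measurable_continuous_onI)
  have f0: "(\<integral>\<^sup>+ x\<in>{0..u}. ennreal ((step_fun \<rho> x - f x)\<^sup>2) \<partial>lborel)
      = (\<integral>\<^sup>+ x\<in>{0..u}. ennreal ((step_fun \<rho> x - f0 x)\<^sup>2) \<partial>lborel)" for \<rho> u
    by (intro nn_integral_cong) (auto simp: f0_def indicator_def)
  have "(\<integral>\<^sup>+ x. ennreal ((step_fun (?\<theta> n) x - indicator {s<..t} x * f x)\<^sup>2) \<partial>lborel)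
      \<le> (\<integral>\<^sup>+ x\<in>{0..t}. ennreal ((step_fun (\<phi> n) x - f x)\<^sup>2) \<partial>lborel)" for n
    using step_fun_eq_0[of "\<phi> n" t] \<phi> s
    by (intro nn_integral_mono) (auto simp: step_fun_after indicator_def)
  then have 1: "(\<lambda>n. \<integral>\<^sup>+ x. ennreal ((step_fun (?\<theta> n) x - indicator {s<..t} x * f x)\<^sup>2) \<partial>lborel) \<longlonglongrightarrow> 0"
    using \<phi>_lim(1) by (rule tendsto_0_ennreal_le) simp
  have [measurable]: "step_wiener W (\<phi> n) \<in> borel_measurable P" "step_wiener W (\<psi> n) \<in> borel_measurable P"
      "step_wiener W (?\<eta> n) \<in> borel_measurable P" "I t \<in> borel_measurable P" "I s \<in> borel_measurable P" for n
    using \<phi>\<psi> \<eta> t s by (auto intro!: step_wiener_measurable I_measurable)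
  have "(\<integral>\<^sup>+ \<omega>. ennreal ((step_wiener W (?\<eta> n) \<omega>)\<^sup>2) \<partial>P)
     \<le> 2 * (\<integral>\<^sup>+ x\<in>{0..t}. ennreal ((step_fun (\<phi> n) x - f x)\<^sup>2) \<partial>lborel)
      + 2 * (\<integral>\<^sup>+ x\<in>{0..s}. ennreal ((step_fun (\<psi> n) x - f x)\<^sup>2) \<partial>lborel)" for n
  proof -
    note m = step_wiener_moments[OF \<eta>[of n]]
    have "(\<integral>\<^sup>+ \<omega>. ennreal ((step_wiener W (?\<eta> n) \<omega>)\<^sup>2) \<partial>P) = ennreal (\<integral>x. (step_fun (?\<eta> n) x)\<^sup>2 \<partial>lborel)"
      using m(4,5) by (subst nn_integral_eq_integral) auto
    also have "\<dots> = (\<integral>\<^sup>+ x. ennreal ((step_fun (?\<eta> n) x)\<^sup>2) \<partial>lborel)"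
      using m(1) by (subst nn_integral_eq_integral) auto
    also have "\<dots> \<le> (\<integral>\<^sup>+ x. 2 * (ennreal ((step_fun (\<phi> n) x - f0 x)\<^sup>2) * indicator {0..t} x)
        + 2 * (ennreal ((step_fun (\<psi> n) x - f0 x)\<^sup>2) * indicator {0..s} x) \<partial>lborel)"
    proof (intro nn_integral_mono)
      fix x :: real
      show "ennreal ((step_fun (?\<eta> n) x)\<^sup>2) \<le> 2 * (ennreal ((step_fun (\<phi> n) x - f0 x)\<^sup>2) * indicator {0..t} x)
        + 2 * (ennreal ((step_fun (\<psi> n) x - f0 x)\<^sup>2) * indicator {0..s} x)"
      proof (cases "x \<in> {0..s}")
        case True
        have "(step_fun (?\<eta> n) x)\<^sup>2 \<le> 2 * (step_fun (\<phi> n) x - f0 x)\<^sup>2 + 2 * (step_fun (\<psi> n) x - f0 x)\<^sup>2"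
          using square_diff_le[of "step_fun (\<phi> n) x - f0 x" "step_fun (\<psi> n) x - f0 x"] True
          by (simp add: step_fun_append_neg step_fun_before)
        then have "ennreal ((step_fun (?\<eta> n) x)\<^sup>2)
          \<le> ennreal (2 * (step_fun (\<phi> n) x - f0 x)\<^sup>2 + 2 * (step_fun (\<psi> n) x - f0 x)\<^sup>2)"
          by (rule ennreal_leI)
        also have "\<dots> = 2 * ennreal ((step_fun (\<phi> n) x - f0 x)\<^sup>2) + 2 * ennreal ((step_fun (\<psi> n) x - f0 x)\<^sup>2)"
          by (simp add: ennreal_plus ennreal_mult)
        finally show ?thesis using True s by simp
      next
        case False
        then have "step_fun (?\<eta> n) x = 0"
          using step_fun_eq_0[of "\<phi> n" t x] step_fun_eq_0[of "\<psi> n" s x] \<phi>[of _ _ _ n] \<psi>[of _ _ _ n]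
          by (auto simp: step_fun_append_neg step_fun_before indicator_def)
        then show ?thesis by simp
      qed
    qed
    also have "\<dots> = 2 * (\<integral>\<^sup>+ x\<in>{0..t}. ennreal ((step_fun (\<phi> n) x - f x)\<^sup>2) \<partial>lborel)
      + 2 * (\<integral>\<^sup>+ x\<in>{0..s}. ennreal ((step_fun (\<psi> n) x - f x)\<^sup>2) \<partial>lborel)"
      unfolding f0 by (subst nn_integral_add) (auto simp: nn_integral_cmult)
    finally show ?thesis .
  qed
  moreover have "(\<lambda>n. 2 * (\<integral>\<^sup>+ x\<in>{0..t}. ennreal ((step_fun (\<phi> n) x - f x)\<^sup>2) \<partial>lborel)
      + 2 * (\<integral>\<^sup>+ x\<in>{0..s}. ennreal ((step_fun (\<psi> n) x - f x)\<^sup>2) \<partial>lborel)) \<longlonglongrightarrow> 2 * 0 + 2 * 0"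
    by (intro tendsto_add ennreal_tendsto_cmult) (use \<phi>_lim(1) \<psi>_lim(1) in auto)
  ultimately have \<eta>0: "(\<lambda>n. \<integral>\<^sup>+ \<omega>. ennreal ((step_wiener W (?\<eta> n) \<omega>)\<^sup>2) \<partial>P) \<longlonglongrightarrow> 0"
    by (rule tendsto_0_ennreal_le) simp
  have "(\<integral>\<^sup>+ \<omega>. ennreal ((step_wiener W (?\<theta> n) \<omega> - (I t \<omega> - I s \<omega>))\<^sup>2) \<partial>P)
    \<le> 3 * (\<integral>\<^sup>+ \<omega>. ennreal ((step_wiener W (\<phi> n) \<omega> - I t \<omega>)\<^sup>2) \<partial>P)
      + 3 * (\<integral>\<^sup>+ \<omega>. ennreal ((step_wiener W (\<psi> n) \<omega> - I s \<omega>)\<^sup>2) \<partial>P)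
      + 3 * (\<integral>\<^sup>+ \<omega>. ennreal ((step_wiener W (?\<eta> n) \<omega>)\<^sup>2) \<partial>P)" for n
  proof -
    have "(\<integral>\<^sup>+ \<omega>. ennreal ((step_wiener W (?\<theta> n) \<omega> - (I t \<omega> - I s \<omega>))\<^sup>2) \<partial>P)
      \<le> (\<integral>\<^sup>+ \<omega>. 3 * ennreal ((step_wiener W (\<phi> n) \<omega> - I t \<omega>)\<^sup>2)
      + 3 * ennreal ((step_wiener W (\<psi> n) \<omega> - I s \<omega>)\<^sup>2)
      + 3 * ennreal ((step_wiener W (?\<eta> n) \<omega>)\<^sup>2) \<partial>P)"
    proof (intro nn_integral_mono)
      fix \<omega>
      have "(step_wiener W (?\<theta> n) \<omega> - (I t \<omega> - I s \<omega>))\<^sup>2 \<le> 3 * (step_wiener W (\<phi> n) \<omega> - I t \<omega>)\<^sup>2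
          + 3 * (- (step_wiener W (\<psi> n) \<omega> - I s \<omega>))\<^sup>2 + 3 * (- step_wiener W (?\<eta> n) \<omega>)\<^sup>2"
        using square_triangle[of "step_wiener W (\<phi> n) \<omega> - I t \<omega>" "- (step_wiener W (\<psi> n) \<omega> - I s \<omega>)"
            "- step_wiener W (?\<eta> n) \<omega>"]
        by (simp add: step_wiener_append_neg step_wiener_split[of W "\<phi> n" \<omega> s] algebra_simps)
      then have "ennreal ((step_wiener W (?\<theta> n) \<omega> - (I t \<omega> - I s \<omega>))\<^sup>2)
          \<le> ennreal (3 * (step_wiener W (\<phi> n) \<omega> - I t \<omega>)\<^sup>2
          + 3 * (step_wiener W (\<psi> n) \<omega> - I s \<omega>)\<^sup>2 + 3 * (step_wiener W (?\<eta> n) \<omega>)\<^sup>2)"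
        by (intro ennreal_leI) (simp only: power2_minus)
      then show "ennreal ((step_wiener W (?\<theta> n) \<omega> - (I t \<omega> - I s \<omega>))\<^sup>2)
          \<le> 3 * ennreal ((step_wiener W (\<phi> n) \<omega> - I t \<omega>)\<^sup>2)
          + 3 * ennreal ((step_wiener W (\<psi> n) \<omega> - I s \<omega>)\<^sup>2) + 3 * ennreal ((step_wiener W (?\<eta> n) \<omega>)\<^sup>2)"
        by (simp add: ennreal_plus ennreal_mult)
    qed
    also have "\<dots> = 3 * (\<integral>\<^sup>+ \<omega>. ennreal ((step_wiener W (\<phi> n) \<omega> - I t \<omega>)\<^sup>2) \<partial>P)
      + 3 * (\<integral>\<^sup>+ \<omega>. ennreal ((step_wiener W (\<psi> n) \<omega> - I s \<omega>)\<^sup>2) \<partial>P)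
      + 3 * (\<integral>\<^sup>+ \<omega>. ennreal ((step_wiener W (?\<eta> n) \<omega>)\<^sup>2) \<partial>P)"
      by (simp add: nn_integral_add nn_integral_cmult)
    finally show ?thesis .
  qed
  moreover have "(\<lambda>n. 3 * (\<integral>\<^sup>+ \<omega>. ennreal ((step_wiener W (\<phi> n) \<omega> - I t \<omega>)\<^sup>2) \<partial>P)
      + 3 * (\<integral>\<^sup>+ \<omega>. ennreal ((step_wiener W (\<psi> n) \<omega> - I s \<omega>)\<^sup>2) \<partial>P)
      + 3 * (\<integral>\<^sup>+ \<omega>. ennreal ((step_wiener W (?\<eta> n) \<omega>)\<^sup>2) \<partial>P)) \<longlonglongrightarrow> 3 * 0 + 3 * 0 + 3 * 0"
    by (intro tendsto_add ennreal_tendsto_cmult) (use \<phi>_lim(2) \<psi>_lim(2) \<eta>0 in auto)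
  ultimately have 2: "(\<lambda>n. \<integral>\<^sup>+ \<omega>. ennreal ((step_wiener W (?\<theta> n) \<omega> - (I t \<omega> - I s \<omega>))\<^sup>2) \<partial>P) \<longlonglongrightarrow> 0"
    by (rule tendsto_0_ennreal_le) simp
  show ?thesis
    using \<theta> 1 2 by (intro exI[of _ ?\<theta>]) blast
qed

definition noise_variance :: "real \<Rightarrow> real \<Rightarrow> real" where
  "noise_variance s t = (\<integral>x. (indicator {s<..t} x * f x)\<^sup>2 \<partial>lborel)"

text \<open>The moments are those of the approximating steps. First and second moments, weighted with a variable \<open>h\<close>
known at time \<open>s\<close>, pass to the mean-square limit; the bound on the fourth moment follows from Fatou's lemma
along an almost surely convergent subsequence.\<close>

lemma increment_moments:
  assumes s: "0 \<le> s" "s \<le> t"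
    and h: "h \<in> borel_measurable (brownian_filtration P W (ereal s))" "\<And>\<omega>. \<bar>h \<omega>\<bar> \<le> (K::real)"
  shows "integrable P (\<lambda>\<omega>. I t \<omega> - I s \<omega>)" "integrable P (\<lambda>\<omega>. (I t \<omega> - I s \<omega>)\<^sup>2)"
    "expectation (\<lambda>\<omega>. h \<omega> * (I t \<omega> - I s \<omega>)) = 0"
    "expectation (\<lambda>\<omega>. h \<omega> * (I t \<omega> - I s \<omega>)\<^sup>2) = expectation h * noise_variance s t"
    "integrable P (\<lambda>\<omega>. (I t \<omega> - I s \<omega>) ^ 4)"
    "expectation (\<lambda>\<omega>. (I t \<omega> - I s \<omega>) ^ 4) \<le> 3 * (noise_variance s t)\<^sup>2"
proof -
  let ?D = "\<lambda>\<omega>. I t \<omega> - I s \<omega>"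
  obtain \<theta> where \<theta>: "\<And>n. steps_after s (\<theta> n)" and
    L1: "(\<lambda>n. \<integral>\<^sup>+ x. ennreal ((step_fun (\<theta> n) x - indicator {s<..t} x * f x)\<^sup>2) \<partial>lborel) \<longlonglongrightarrow> 0" and
    L2: "(\<lambda>n. \<integral>\<^sup>+ \<omega>. ennreal ((step_wiener W (\<theta> n) \<omega> - ?D \<omega>)\<^sup>2) \<partial>P) \<longlonglongrightarrow> 0"
    using increment_approximation[OF s] by blast
  let ?v = "\<lambda>n. \<integral>x. (step_fun (\<theta> n) x)\<^sup>2 \<partial>lborel"
  have \<theta>0: "steps_after 0 (\<theta> n)" for n
    using \<theta> s(1) by (rule steps_after_mono)
  note m = step_wiener_moments[OF \<theta>0]
  have hP[measurable]: "h \<in> borel_measurable P" by (rule filtration_measurable[OF h(1)])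
  have hi: "integrable P h"
    using h(2) by (intro integrable_const_bound[of _ K]) auto
  have [measurable]: "step_wiener W (\<theta> n) \<in> borel_measurable P" for n
    by (rule borel_measurable_integrable[OF m(2)])
  have [measurable]: "I s \<in> borel_measurable P" "I t \<in> borel_measurable P"
    using s by (auto intro!: I_measurable)
  have f[measurable]: "(\<lambda>x. indicator {s<..t} x * f x) \<in> borel_measurable lborel"
  proof -
    have "(\<lambda>x. indicator {s<..t} x * f x) = (\<lambda>x. indicator {s<..t} x * f (max 0 x))"
      using s by (auto simp: indicator_def)
    moreover have "continuous_on UNIV (\<lambda>x. f (max 0 x))"
      by (rule continuous_on_compose2[OF f_cont]) (auto intro!: continuous_intros)
    then have "(\<lambda>x. f (max 0 x)) \<in> borel_measurable borel" by (rule borel_measurable_continuous_onI)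
    ultimately show ?thesis by simp
  qed
  have "(\<lambda>n. \<integral>x. 1 * (step_fun (\<theta> n) x)\<^sup>2 \<partial>lborel)
      \<longlonglongrightarrow> (\<integral>x. 1 * (indicator {s<..t} x * f x)\<^sup>2 \<partial>lborel)"
    by (rule L2_limit(2)[where K = 1]) (use L1 m(1) in auto)
  then have v: "?v \<longlonglongrightarrow> noise_variance s t" by (simp add: noise_variance_def)
  show D2: "integrable P (\<lambda>\<omega>. (?D \<omega>)\<^sup>2)"
    by (rule L2_limit(1)[where h = h and K = K, OF _ _ _ _ L2]) (use m(4) h(2) in auto)
  then show "integrable P ?D"
    by (rule square_integrable_imp_integrable[rotated]) (use s in \<open>auto intro!: I_measurable borel_measurable_diff\<close>)
  have ind: "indep_var borel h borel (step_wiener W (\<theta> n))" for n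
    by (rule filtration_indep_step_wiener[OF s(1) \<theta> h(1)])
  have "expectation (\<lambda>\<omega>. h \<omega> * step_wiener W (\<theta> n) \<omega>) = 0" for n
    using indep_var_lebesgue_integral[OF ind[of n] hi m(2)] m(3) by simp
  moreover have "(\<lambda>n. expectation (\<lambda>\<omega>. h \<omega> * step_wiener W (\<theta> n) \<omega>)) \<longlonglongrightarrow> expectation (\<lambda>\<omega>. h \<omega> * ?D \<omega>)"
    by (rule L2_limit_integral[where K = K, OF _ _ _ _ L2]) (use m(4) h(2) in auto)
  ultimately show "expectation (\<lambda>\<omega>. h \<omega> * ?D \<omega>) = 0"
    by (simp add: LIMSEQ_const_iff)
  have "indep_var borel (id \<circ> h) borel ((\<lambda>x. x\<^sup>2) \<circ> step_wiener W (\<theta> n))" for n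
    by (rule indep_var_compose[OF ind]) auto
  then have "expectation (\<lambda>\<omega>. h \<omega> * (step_wiener W (\<theta> n) \<omega>)\<^sup>2) = expectation h * ?v n" for n
    using indep_var_lebesgue_integral[of h "\<lambda>\<omega>. (step_wiener W (\<theta> n) \<omega>)\<^sup>2"] hi m(4)[of n] m(5)[of n]
    by (simp add: comp_def)
  moreover have "(\<lambda>n. expectation (\<lambda>\<omega>. h \<omega> * (step_wiener W (\<theta> n) \<omega>)\<^sup>2)) \<longlonglongrightarrow> expectation (\<lambda>\<omega>. h \<omega> * (?D \<omega>)\<^sup>2)"
    by (rule L2_limit(2)[where K = K, OF _ _ _ _ L2]) (use m(4) h(2) in auto)
  ultimately have "(\<lambda>n. expectation h * ?v n) \<longlonglongrightarrow> expectation (\<lambda>\<omega>. h \<omega> * (?D \<omega>)\<^sup>2)" by simp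
  then show "expectation (\<lambda>\<omega>. h \<omega> * (?D \<omega>)\<^sup>2) = expectation h * noise_variance s t"
    by (rule LIMSEQ_unique) (intro tendsto_intros v)
  have d2: "integrable P (\<lambda>\<omega>. (step_wiener W (\<theta> n) \<omega> - ?D \<omega>)\<^sup>2)" for n
  proof (rule Bochner_Integration.integrable_bound)
    show "integrable P (\<lambda>\<omega>. 2 * (step_wiener W (\<theta> n) \<omega>)\<^sup>2 + 2 * (?D \<omega>)\<^sup>2)" using D2 m(4) by auto
    show "AE \<omega> in P. norm ((step_wiener W (\<theta> n) \<omega> - ?D \<omega>)\<^sup>2) \<le> norm (2 * (step_wiener W (\<theta> n) \<omega>)\<^sup>2 + 2 * (?D \<omega>)\<^sup>2)"
      using square_diff_le by auto
  qed auto
  have "(\<lambda>n. \<integral>\<omega>. norm ((step_wiener W (\<theta> n) \<omega> - ?D \<omega>)\<^sup>2) \<partial>P) \<longlonglongrightarrow> 0"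
    using tendsto_enn2real[of _ 0] L2 by (subst integral_eq_nn_integral) auto
  then obtain r where r: "strict_mono r" "AE \<omega> in P. (\<lambda>n. (step_wiener W (\<theta> (r n)) \<omega> - ?D \<omega>)\<^sup>2) \<longlonglongrightarrow> 0"
    using tendsto_L1_AE_subseq[of P "\<lambda>n \<omega>. (step_wiener W (\<theta> n) \<omega> - ?D \<omega>)\<^sup>2", OF d2] by blast
  have "(\<integral>\<^sup>+ \<omega>. ennreal ((?D \<omega>) ^ 4) \<partial>P)
      = (\<integral>\<^sup>+ \<omega>. liminf (\<lambda>n. ennreal ((step_wiener W (\<theta> (r n)) \<omega>) ^ 4)) \<partial>P)"
  proof (rule nn_integral_cong_AE)
    show "AE \<omega> in P. ennreal ((?D \<omega>) ^ 4) = liminf (\<lambda>n. ennreal ((step_wiener W (\<theta> (r n)) \<omega>) ^ 4))"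
      using r(2)
    proof eventually_elim
      case (elim \<omega>)
      then have "(\<lambda>n. step_wiener W (\<theta> (r n)) \<omega>) \<longlonglongrightarrow> ?D \<omega>"
        by (simp add: LIM_zero_iff)
      then have "(\<lambda>n. ennreal ((step_wiener W (\<theta> (r n)) \<omega>) ^ 4)) \<longlonglongrightarrow> ennreal ((?D \<omega>) ^ 4)"
        by (intro tendsto_intros)
      from lim_imp_Liminf[OF _ this] show ?case by (metis sequentially_bot)
    qed
  qed
  also have "\<dots> \<le> liminf (\<lambda>n. \<integral>\<^sup>+ \<omega>. ennreal ((step_wiener W (\<theta> (r n)) \<omega>) ^ 4) \<partial>P)"
    by (rule nn_integral_liminf) auto
  also have "(\<lambda>n. \<integral>\<^sup>+ \<omega>. ennreal ((step_wiener W (\<theta> (r n)) \<omega>) ^ 4) \<partial>P) = (\<lambda>n. ennreal (3 * (?v (r n))\<^sup>2))"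
    using m(6,7) by (subst nn_integral_eq_integral) auto
  also have "liminf (\<lambda>n. ennreal (3 * (?v (r n))\<^sup>2)) = ennreal (3 * (noise_variance s t)\<^sup>2)"
    using LIMSEQ_subseq_LIMSEQ[OF v r(1)] by (intro lim_imp_Liminf tendsto_intros) (auto simp: comp_def)
  finally have 4: "(\<integral>\<^sup>+ \<omega>. ennreal ((?D \<omega>) ^ 4) \<partial>P) \<le> ennreal (3 * (noise_variance s t)\<^sup>2)" .
  then show i4: "integrable P (\<lambda>\<omega>. (?D \<omega>) ^ 4)"
    by (intro integrableI_bounded) (auto intro: order_le_less_trans)
  show "expectation (\<lambda>\<omega>. (?D \<omega>) ^ 4) \<le> 3 * (noise_variance s t)\<^sup>2"
    using 4 i4 by (subst (asm) nn_integral_eq_integral) auto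
qed

end

section \<open>A second-order Taylor bound\<close>

lemma continuous_Icc_bounded:
  fixes g :: "real \<Rightarrow> real"
  assumes "continuous_on {a..c} g"
  shows "\<exists>C. \<forall>s\<in>{a..c}. \<bar>g s\<bar> \<le> C"
proof -
  have "bounded (g ` {a..c})"
    by (intro compact_imp_bounded compact_continuous_image assms compact_Icc)
  then show ?thesis by (auto simp: bounded_iff)
qed

lemma taylor_second_order:
  fixes g g1 g2 :: "real \<Rightarrow> real"
  assumes "\<And>x. (g has_real_derivative g1 x) (at x)" "\<And>x. (g1 has_real_derivative g2 x) (at x)"
  shows "\<exists>\<zeta>. \<bar>\<zeta> - x\<bar> \<le> \<bar>z\<bar> \<and> g (x + z) = g x + z * g1 x + z\<^sup>2 / 2 * g2 \<zeta>"
proof (cases "z = 0")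
  case True
  then show ?thesis by auto
next
  case False
  let ?diff = "\<lambda>m::nat. if m = 0 then g else if m = 1 then g1 else g2"
  have "\<exists>\<zeta>. (if x + z < x then x + z < \<zeta> \<and> \<zeta> < x else x < \<zeta> \<and> \<zeta> < x + z) \<and>
    g (x + z) = (\<Sum>m<2. ?diff m x / fact m * (x + z - x) ^ m) + ?diff 2 \<zeta> / fact 2 * (x + z - x) ^ 2"
    by (rule Taylor[where a = "min x (x + z)" and b = "max x (x + z)"]) (use assms False in \<open>auto simp: less_2_cases_iff\<close>)
  then obtain \<zeta> where "(if x + z < x then x + z < \<zeta> \<and> \<zeta> < x else x < \<zeta> \<and> \<zeta> < x + z)"
    "g (x + z) = g x + z * g1 x + z\<^sup>2 / 2 * g2 \<zeta>"
    by (auto simp: numeral_2_eq_2 field_simps)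
  then show ?thesis by (intro exI[of _ \<zeta>]) (auto split: if_splits)
qed

lemma continuous_strip_bounded:
  fixes F :: "real \<Rightarrow> real \<Rightarrow> real"
  assumes "continuous_on ({0<..} \<times> UNIV) (\<lambda>(t, x). F t x :: real)" "0 < \<epsilon>"
  shows "\<exists>B. \<forall>t\<in>{\<epsilon>..T}. \<forall>x\<in>{-R..R::real}. \<bar>F t x\<bar> \<le> B"
proof -
  have "compact ((\<lambda>(t, x). F t x) ` ({\<epsilon>..T} \<times> {-R..R}))"
    using assms(2) by (intro compact_continuous_image continuous_on_subset[OF assms(1)] compact_Times compact_Icc)
      (auto intro: less_le_trans)
  then have "bounded ((\<lambda>(t, x). F t x) ` ({\<epsilon>..T} \<times> {-R..R}))" by (rule compact_imp_bounded)
  then obtain B where "\<forall>y\<in>(\<lambda>(t, x). F t x) ` ({\<epsilon>..T} \<times> {-R..R}). norm y \<le> B"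
    unfolding bounded_iff by blast
  then show ?thesis by (intro exI[of _ B]) force
qed

lemma continuous_strip_uniformly:
  fixes F :: "real \<Rightarrow> real \<Rightarrow> real"
  assumes "continuous_on ({0<..} \<times> UNIV) (\<lambda>(t, x). F t x :: real)" "0 < \<epsilon>" "0 < e"
  shows "\<exists>d>0. \<forall>t\<in>{\<epsilon>..T}. \<forall>x\<in>{-R..R::real}. \<forall>t'\<in>{\<epsilon>..T}. \<forall>x'\<in>{-R..R}.
    \<bar>t' - t\<bar> + \<bar>x' - x\<bar> < d \<longrightarrow> \<bar>F t' x' - F t x\<bar> \<le> e"
proof -
  have "uniformly_continuous_on ({\<epsilon>..T} \<times> {-R..R}) (\<lambda>(t, x). F t x)"
    using assms(2) by (intro compact_uniformly_continuous continuous_on_subset[OF assms(1)] compact_Times compact_Icc)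
      (auto intro: less_le_trans)
  then obtain d where d: "d > 0" "\<And>p p'. p \<in> {\<epsilon>..T} \<times> {-R..R} \<Longrightarrow> p' \<in> {\<epsilon>..T} \<times> {-R..R} \<Longrightarrow> dist p' p < d \<Longrightarrow>
      dist (case p' of (t, x) \<Rightarrow> F t x) (case p of (t, x) \<Rightarrow> F t x) < e"
    unfolding uniformly_continuous_on_def using \<open>0 < e\<close> by metis
  have "\<bar>F t' x' - F t x\<bar> \<le> e" if "t \<in> {\<epsilon>..T}" "x \<in> {-R..R}" "t' \<in> {\<epsilon>..T}" "x' \<in> {-R..R}"
      "\<bar>t' - t\<bar> + \<bar>x' - x\<bar> < d" for t x t' x'
  proof -
    have "dist (t', x') (t, x) \<le> \<bar>t' - t\<bar> + \<bar>x' - x\<bar>"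
      using sqrt_sum_squares_le_sum_abs[of "t' - t" "x' - x"] by (simp add: dist_Pair_Pair dist_real_def)
    then show ?thesis using d(2)[of "(t, x)" "(t', x')"] that by (simp add: dist_real_def)
  qed
  then show ?thesis using d(1) by blast
qed

text \<open>This is Taylor's formula in the form needed for a displacement \<open>a + y\<close> with drift part \<open>a = O(h)\<close> and noise
part \<open>y\<close> of typical size \<open>sqrt h\<close>. For small \<open>y\<close> the remainder is governed by the modulus of continuity
of \<open>Ut\<close> and \<open>Uxx\<close> on a compact set. A large \<open>y\<close> may leave that set, but then \<open>y ^ 4\<close> is bounded below, so
boundedness of \<open>U\<close> suffices. The fourth moment of the noise makes that part \<open>O(h\<^sup>2)\<close>.\<close>

lemma ito_taylor_bound:
  assumes U: "classical_derivatives U Ut Ux Uxx"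
    and M: "\<And>t x. 0 \<le> t \<Longrightarrow> \<bar>U t x\<bar> \<le> M"
    and "0 < \<epsilon>" "0 < \<eta>" "0 \<le> K"
  shows "\<exists>C \<delta>. 0 \<le> C \<and> 0 < \<delta> \<and> (\<forall>t\<in>{\<epsilon>..T}. \<forall>x\<in>{-R..R}. \<forall>h a y. 0 < h \<and> h \<le> \<delta> \<and> \<bar>a\<bar> \<le> K * h \<longrightarrow>
    \<bar>U (t + h) (x + a + y) - U t x - h * Ut t x - (a + y) * Ux t x - y\<^sup>2 / 2 * Uxx t x\<bar>
      \<le> \<eta> * (h + y\<^sup>2) + C * y ^ 4)"
proof -
  have der: "((\<lambda>s. U s x) has_real_derivative Ut t x) (at t)" "(U t has_real_derivative Ux t x) (at x)"
      "(Ux t has_real_derivative Uxx t x) (at x)" if "0 < t" for t x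
    using U that by (auto simp: classical_derivatives_def)
  have cont: "continuous_on ({0<..} \<times> UNIV) (\<lambda>(t, x). Ut t x)" "continuous_on ({0<..} \<times> UNIV) (\<lambda>(t, x). Ux t x)"
    "continuous_on ({0<..} \<times> UNIV) (\<lambda>(t, x). Uxx t x)"
    using U by (auto simp: classical_derivatives_def)
  have M0: "0 \<le> M" using M[of 0 0] by simp
  let ?T = "T + 1" and ?R = "R + 2"
  obtain B1 where B1: "\<forall>t\<in>{\<epsilon>..?T}. \<forall>x\<in>{-?R..?R}. \<bar>Ut t x\<bar> \<le> B1"
    using continuous_strip_bounded[OF cont(1) \<open>0 < \<epsilon>\<close>] by blast
  obtain B2 where B2: "\<forall>t\<in>{\<epsilon>..?T}. \<forall>x\<in>{-?R..?R}. \<bar>Ux t x\<bar> \<le> B2"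
    using continuous_strip_bounded[OF cont(2) \<open>0 < \<epsilon>\<close>] by blast
  obtain B3 where B3: "\<forall>t\<in>{\<epsilon>..?T}. \<forall>x\<in>{-?R..?R}. \<bar>Uxx t x\<bar> \<le> B3"
    using continuous_strip_bounded[OF cont(3) \<open>0 < \<epsilon>\<close>] by blast
  define B where "B = \<bar>B1\<bar> + \<bar>B2\<bar> + \<bar>B3\<bar>"
  have B: "0 \<le> B" "\<And>t x. t \<in> {\<epsilon>..?T} \<Longrightarrow> x \<in> {-?R..?R} \<Longrightarrow> \<bar>Ut t x\<bar> \<le> B \<and> \<bar>Ux t x\<bar> \<le> B \<and> \<bar>Uxx t x\<bar> \<le> B"
    using B1 B2 B3 unfolding B_def by fastforce+
  define e where "e = \<eta> / (2 * (1 + K\<^sup>2))"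
  have e: "0 < e" "e * (1 + K\<^sup>2) = \<eta> / 2"
    using \<open>0 < \<eta>\<close> add_pos_nonneg[of 1 "K\<^sup>2"] by (auto simp: e_def field_simps)
  obtain d1 where d1: "0 < d1" "\<forall>t\<in>{\<epsilon>..?T}. \<forall>x\<in>{-?R..?R}. \<forall>t'\<in>{\<epsilon>..?T}. \<forall>x'\<in>{-?R..?R}.
      \<bar>t' - t\<bar> + \<bar>x' - x\<bar> < d1 \<longrightarrow> \<bar>Ut t' x' - Ut t x\<bar> \<le> e"
    using continuous_strip_uniformly[OF cont(1) \<open>0 < \<epsilon>\<close> e(1)] by blast
  obtain d3 where d3: "0 < d3" "\<forall>t\<in>{\<epsilon>..?T}. \<forall>x\<in>{-?R..?R}. \<forall>t'\<in>{\<epsilon>..?T}. \<forall>x'\<in>{-?R..?R}.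
      \<bar>t' - t\<bar> + \<bar>x' - x\<bar> < d3 \<longrightarrow> \<bar>Uxx t' x' - Uxx t x\<bar> \<le> e"
    using continuous_strip_uniformly[OF cont(3) \<open>0 < \<epsilon>\<close> e(1)] by blast
  define d where "d = min d1 d3"
  have d: "0 < d" "\<And>t x t' x'. t \<in> {\<epsilon>..?T} \<Longrightarrow> x \<in> {-?R..?R} \<Longrightarrow> t' \<in> {\<epsilon>..?T} \<Longrightarrow> x' \<in> {-?R..?R} \<Longrightarrow>
      \<bar>t' - t\<bar> + \<bar>x' - x\<bar> < d \<Longrightarrow> \<bar>Ut t' x' - Ut t x\<bar> \<le> e \<and> \<bar>Uxx t' x' - Uxx t x\<bar> \<le> e"
    using d1 d3 unfolding d_def by auto
  \<comment> \<open>The four bounds serve, in order: \<open>h \<le> 1\<close>; staying within the modulus of continuity; the mixed terms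
    in \<open>a\<close> and \<open>y\<close>; and \<open>\<bar>a\<bar> \<le> 1\<close>.\<close>
  define \<delta> where "\<delta> = Min {1, d / (3 + K), \<eta> / (2 * (B * (K\<^sup>2 + K) + 1)), 1 / (K + 1)}"
  have BK: "0 \<le> B * (K\<^sup>2 + K)" using B(1) \<open>0 \<le> K\<close> by simp
  have "0 < \<delta>" unfolding \<delta>_def
    using d(1) \<open>0 < \<eta>\<close> \<open>0 \<le> K\<close> BK by (subst Min_gr_iff) auto
  have "\<delta> \<le> 1" by (auto simp: \<delta>_def)
  have "\<delta> \<le> d / (3 + K)" by (auto simp: \<delta>_def)
  then have "\<delta> * (3 + K) \<le> d" using \<open>0 \<le> K\<close> by (simp add: field_simps)
  then have dd: "\<delta> + K * \<delta> + \<delta> < d" using \<open>0 < \<delta>\<close> by (simp add: algebra_simps)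
  have "\<delta> \<le> 1 / (K + 1)" by (auto simp: \<delta>_def)
  then have K1: "K * \<delta> \<le> 1" using \<open>0 \<le> K\<close> \<open>0 < \<delta>\<close> by (simp add: field_simps)
  have "\<delta> \<le> \<eta> / (2 * (B * (K\<^sup>2 + K) + 1))" by (auto simp: \<delta>_def)
  then have "2 * (\<delta> * (B * (K\<^sup>2 + K) + 1)) \<le> \<eta>" using BK by (simp add: field_simps)
  then have B\<delta>: "B * (K\<^sup>2 + K) * \<delta> \<le> \<eta> / 2" using \<open>0 < \<delta>\<close> by (simp add: algebra_simps)
  define C where "C = (2 * M + 4 * B) / \<delta> ^ 4"
  have C: "0 \<le> C" using M0 B(1) \<open>0 < \<delta>\<close> by (simp add: C_def)
  have "\<bar>U (t + h) (x + a + y) - U t x - h * Ut t x - (a + y) * Ux t x - y\<^sup>2 / 2 * Uxx t x\<bar>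
      \<le> \<eta> * (h + y\<^sup>2) + C * y ^ 4"
    if t: "t \<in> {\<epsilon>..T}" and x: "x \<in> {-R..R}" and h: "0 < h" "h \<le> \<delta>" and a: "\<bar>a\<bar> \<le> K * h" for t x h a y
  proof -
    have tx: "t \<in> {\<epsilon>..?T}" "x \<in> {-?R..?R}" using t x by auto
    have Kh: "K * h \<le> K * \<delta>" using h \<open>0 \<le> K\<close> by (intro mult_left_mono) auto
    have a1: "\<bar>a\<bar> \<le> 1" using a Kh K1 by linarith
    show ?thesis
    proof (cases "\<bar>y\<bar> \<le> \<delta>")
      case True
      have z: "x + a + y \<in> {-?R..?R}" using True a1 \<open>\<delta> \<le> 1\<close> x by auto
      obtain \<theta> where \<theta>: "t < \<theta>" "\<theta> < t + h" "U (t + h) (x + a + y) - U t (x + a + y) = h * Ut \<theta> (x + a + y)"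
        using MVT2[of t "t + h" "\<lambda>s. U s (x + a + y)" "\<lambda>s. Ut s (x + a + y)"] der(1) t h \<open>0 < \<epsilon>\<close> by fastforce
      have \<theta>1: "\<bar>Ut \<theta> (x + a + y) - Ut t x\<bar> \<le> e"
        using d(2)[of t x \<theta> "x + a + y"] tx z \<theta> t h \<open>\<delta> \<le> 1\<close> True a Kh dd by auto
      obtain \<zeta> where \<zeta>: "\<bar>\<zeta> - x\<bar> \<le> \<bar>a + y\<bar>" "U t (x + (a + y)) = U t x + (a + y) * Ux t x + (a + y)\<^sup>2 / 2 * Uxx t \<zeta>"
        using taylor_second_order[of "U t" "Ux t" "Uxx t" x "a + y"] der(2,3) t \<open>0 < \<epsilon>\<close> by fastforce
      have \<zeta>1: "\<bar>Uxx t \<zeta> - Uxx t x\<bar> \<le> e"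
      proof -
        have "\<zeta> \<in> {-?R..?R}" using \<zeta>(1) True a1 \<open>\<delta> \<le> 1\<close> x by auto
        moreover have "\<bar>\<zeta> - x\<bar> < d" using \<zeta>(1) True a Kh dd \<open>0 < \<delta>\<close> by linarith
        ultimately show ?thesis using d(2)[of t x t \<zeta>] tx by auto
      qed
      have "U (t + h) (x + a + y) - U t x - h * Ut t x - (a + y) * Ux t x - y\<^sup>2 / 2 * Uxx t x
        = h * (Ut \<theta> (x + a + y) - Ut t x) + (a + y)\<^sup>2 / 2 * (Uxx t \<zeta> - Uxx t x)
          + (a\<^sup>2 + 2 * a * y) / 2 * Uxx t x"
        using \<theta>(3) \<zeta>(2) by (simp add: add.assoc power2_eq_square field_simps)
      then have "\<bar>U (t + h) (x + a + y) - U t x - h * Ut t x - (a + y) * Ux t x - y\<^sup>2 / 2 * Uxx t x\<bar>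
        \<le> h * \<bar>Ut \<theta> (x + a + y) - Ut t x\<bar> + (a + y)\<^sup>2 / 2 * \<bar>Uxx t \<zeta> - Uxx t x\<bar>
          + \<bar>a\<^sup>2 + 2 * a * y\<bar> / 2 * \<bar>Uxx t x\<bar>"
        using h by (auto simp: abs_mult intro!: order_trans[OF abs_triangle_ineq] add_mono)
      also have "\<dots> \<le> h * e + (K\<^sup>2 * h + y\<^sup>2) * e + (K\<^sup>2 * \<delta> + K * \<delta>) * h * B"
      proof (intro add_mono mult_mono)
        have "a\<^sup>2 \<le> (K * h)\<^sup>2" using a by (simp add: abs_le_square_iff[symmetric])
        also have "\<dots> = K\<^sup>2 * h * h" by (simp add: power2_eq_square)
        finally have a2: "a\<^sup>2 \<le> K\<^sup>2 * h * h" .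
        have h1: "K\<^sup>2 * h * h \<le> K\<^sup>2 * h * \<delta>" "K\<^sup>2 * h * \<delta> \<le> K\<^sup>2 * h * 1"
          using h \<open>\<delta> \<le> 1\<close> by (intro mult_left_mono; simp)+
        have "(a + y)\<^sup>2 / 2 \<le> a\<^sup>2 + y\<^sup>2"
          using zero_le_power2[of "a - y"] by (simp add: power2_eq_square algebra_simps)
        then show "(a + y)\<^sup>2 / 2 \<le> K\<^sup>2 * h + y\<^sup>2" using a2 h1 by linarith
        have "\<bar>a * y\<bar> \<le> K * h * \<delta>" unfolding abs_mult using a True h \<open>0 \<le> K\<close> by (intro mult_mono) auto
        moreover have "\<bar>a\<^sup>2 + 2 * a * y\<bar> \<le> a\<^sup>2 + 2 * \<bar>a * y\<bar>"
          using abs_triangle_ineq[of "a\<^sup>2" "2 * a * y"] by (simp add: abs_mult)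
        ultimately have "\<bar>a\<^sup>2 + 2 * a * y\<bar> \<le> K\<^sup>2 * h * \<delta> + 2 * (K * h * \<delta>)" using a2 h1
          by linarith
        moreover have "0 \<le> K\<^sup>2 * h * \<delta>" using h \<open>0 < \<delta>\<close> by simp
        ultimately show "\<bar>a\<^sup>2 + 2 * a * y\<bar> / 2 \<le> (K\<^sup>2 * \<delta> + K * \<delta>) * h"
          by (simp add: algebra_simps)
        show "\<bar>Uxx t x\<bar> \<le> B" using B(2)[OF tx] by simp
      qed (use h \<theta>1 \<zeta>1 e \<open>0 \<le> K\<close> \<open>0 < \<delta>\<close> in auto)
      also have "\<dots> = h * (e * (1 + K\<^sup>2) + B * (K\<^sup>2 + K) * \<delta>) + y\<^sup>2 * e"
        by (simp add: algebra_simps)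
      also have "\<dots> \<le> h * \<eta> + y\<^sup>2 * \<eta>"
      proof (intro add_mono mult_left_mono)
        show "e * (1 + K\<^sup>2) + B * (K\<^sup>2 + K) * \<delta> \<le> \<eta>" using e(2) B\<delta> by linarith
        have "e * 1 \<le> e * (1 + K\<^sup>2)" using e(1) by (intro mult_left_mono) auto
        then show "e \<le> \<eta>" using e(2) \<open>0 < \<eta>\<close> by simp
      qed (use h in auto)
      also have "\<dots> \<le> \<eta> * (h + y\<^sup>2) + C * y ^ 4"
        using C by (simp add: algebra_simps)
      finally show ?thesis .
    next
      case False
      have "1 \<le> \<bar>y\<bar> / \<delta>" using False \<open>0 < \<delta>\<close> by simp
      then have p: "(\<bar>y\<bar> / \<delta>) ^ k \<le> (\<bar>y\<bar> / \<delta>) ^ 4" if "k \<le> 4" for k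
        using that by (rule power_increasing[rotated])
      have y4: "(\<bar>y\<bar> / \<delta>) ^ 4 = y ^ 4 / \<delta> ^ 4" by (simp add: power_divide)
      have y0: "1 \<le> y ^ 4 / \<delta> ^ 4" using p[of 0] y4 by simp
      have "\<bar>y\<bar> \<le> \<bar>y\<bar> / \<delta>" using \<open>0 < \<delta>\<close> \<open>\<delta> \<le> 1\<close> by (simp add: field_simps mult_left_le_one_le)
      then have y1: "\<bar>y\<bar> \<le> y ^ 4 / \<delta> ^ 4" using p[of 1] y4 by simp
      have "y\<^sup>2 \<le> (\<bar>y\<bar> / \<delta>)\<^sup>2"
        using \<open>\<bar>y\<bar> \<le> \<bar>y\<bar> / \<delta>\<close> power_mono[of "\<bar>y\<bar>" "\<bar>y\<bar> / \<delta>" 2] by simp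
      then have y2: "y\<^sup>2 \<le> y ^ 4 / \<delta> ^ 4" using p[of 2] y4 by simp
      have y2': "\<bar>y\<^sup>2 / 2\<bar> \<le> y ^ 4 / \<delta> ^ 4"
        using y2 zero_le_power2[of y] by linarith
      have "\<bar>U (t + h) (x + a + y)\<bar> \<le> M" "\<bar>U t x\<bar> \<le> M" using M t h \<open>0 < \<epsilon>\<close> by auto
      moreover have "\<bar>h * Ut t x\<bar> \<le> 1 * B" unfolding abs_mult
        using h \<open>\<delta> \<le> 1\<close> B(2)[OF tx] by (intro mult_mono) auto
      moreover have "\<bar>(a + y) * Ux t x\<bar> \<le> (1 + y ^ 4 / \<delta> ^ 4) * B" unfolding abs_mult
        using a1 y1 B(2)[OF tx] by (intro mult_mono) auto
      moreover have "\<bar>y\<^sup>2 / 2 * Uxx t x\<bar> \<le> (y ^ 4 / \<delta> ^ 4) * B" unfolding abs_mult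
        using y2' B(2)[OF tx] by (intro mult_mono) auto
      ultimately have "\<bar>U (t + h) (x + a + y) - U t x - h * Ut t x - (a + y) * Ux t x - y\<^sup>2 / 2 * Uxx t x\<bar>
        \<le> 2 * M + 1 * B + (1 + y ^ 4 / \<delta> ^ 4) * B + (y ^ 4 / \<delta> ^ 4) * B" by linarith
      also have "\<dots> = 2 * M * 1 + 2 * B * 1 + 2 * B * (y ^ 4 / \<delta> ^ 4)" by (simp add: algebra_simps)
      also have "\<dots> \<le> 2 * M * (y ^ 4 / \<delta> ^ 4) + 2 * B * (y ^ 4 / \<delta> ^ 4) + 2 * B * (y ^ 4 / \<delta> ^ 4)"
        using y0 M0 B(1) by (intro add_mono mult_left_mono) auto
      also have "\<dots> = C * y ^ 4" by (simp add: C_def add_divide_distrib algebra_simps)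
      also have "\<dots> \<le> \<eta> * (h + y\<^sup>2) + C * y ^ 4" using h \<open>0 < \<eta>\<close> by simp
      finally show ?thesis .
    qed
  qed
  then show ?thesis using C \<open>0 < \<delta>\<close> by blast
qed

lemma section_measurable:
  assumes "continuous_on (S \<times> UNIV) (\<lambda>(t, x). F t x)" "t \<in> S"
  shows "(F t :: real \<Rightarrow> real) \<in> borel_measurable borel"
proof -
  have "continuous_on UNIV (\<lambda>z. case (t, z) of (s, z) \<Rightarrow> F s z)"
    by (rule continuous_on_compose2[OF assms(1)]) (use assms(2) in \<open>auto intro!: continuous_intros\<close>)
  then show ?thesis by (simp add: borel_measurable_continuous_onI)
qed

section \<open>Paths up to explosion\<close>

text \<open>The value of a solution at and after explosion is arbitrary; \<open>0\<close> replaces it so that the process is adapted.\<close>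

definition killed :: "(real \<Rightarrow> real) \<Rightarrow> ereal \<Rightarrow> real \<Rightarrow> real" where
  "killed x \<theta> t = (if ereal t < \<theta> then x t else 0)"

text \<open>The path stays in \<open>[-R, R]\<close> up to time \<open>t\<close>. It is tested at rational times only, so that it is an event of the
filtration at time \<open>t\<close>; for the paths in question it then holds at all times (\<open>confined_iff\<close>).\<close>

definition confined :: "(real \<Rightarrow> real) \<Rightarrow> ereal \<Rightarrow> real \<Rightarrow> real \<Rightarrow> bool" where
  "confined x \<theta> R t \<longleftrightarrow> ereal t < \<theta> \<and>
     (\<forall>q :: rat. 0 \<le> real_of_rat q \<and> real_of_rat q \<le> t \<longrightarrow> \<bar>killed x \<theta> (real_of_rat q)\<bar> \<le> R)"

definition exit_time :: "(real \<Rightarrow> real) \<Rightarrow> ereal \<Rightarrow> real \<Rightarrow> real \<Rightarrow> real" where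
  "exit_time x \<theta> R T = Sup {t \<in> {0..T}. confined x \<theta> R t}"

text \<open>The next two add up to the change of \<open>U(t, X\<^sub>t)\<close> over \<open>[t, t + h]\<close>, on the event that the path is confined
up to time \<open>t\<close>. The first leads to the Euler prediction, the second from there to the path.\<close>

definition predicted_gain :: "(real \<Rightarrow> real \<Rightarrow> real) \<Rightarrow> (real \<Rightarrow> real \<Rightarrow> real) \<Rightarrow> (real \<Rightarrow> real) \<Rightarrow> (real \<Rightarrow> real) \<Rightarrow>
    ereal \<Rightarrow> real \<Rightarrow> real \<Rightarrow> real \<Rightarrow> real" where
  "predicted_gain U b x i \<theta> R h t = of_bool (confined x \<theta> R t) *
     (U (t + h) (killed x \<theta> t + b t (killed x \<theta> t) * h + (i (t + h) - i t)) - U t (killed x \<theta> t))"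

definition prediction_error :: "(real \<Rightarrow> real \<Rightarrow> real) \<Rightarrow> (real \<Rightarrow> real \<Rightarrow> real) \<Rightarrow> (real \<Rightarrow> real) \<Rightarrow> (real \<Rightarrow> real) \<Rightarrow>
    ereal \<Rightarrow> real \<Rightarrow> real \<Rightarrow> real \<Rightarrow> real" where
  "prediction_error U b x i \<theta> R h t = of_bool (confined x \<theta> R t) *
     (U (t + h) (killed x \<theta> (t + h)) - U (t + h) (killed x \<theta> t + b t (killed x \<theta> t) * h + (i (t + h) - i t)))"

lemma confined_antimono: "confined x \<theta> R t \<Longrightarrow> s \<le> t \<Longrightarrow> confined x \<theta> R s"
  unfolding confined_def by (meson ereal_less_eq(3) order_le_less_trans order_trans)

lemma interval_subset_closure_rat:
  fixes t :: real
  assumes "0 < t"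
  shows "{0..t} \<subseteq> closure (\<rat> \<inter> {0..t})"
proof -
  have "{0<..<t} \<subseteq> closure ({0<..<t} \<inter> \<rat>)"
    using open_Int_closure_subset[of "{0<..<t}" \<rat>] by (simp add: Rats_closure_real)
  also have "\<dots> \<subseteq> closure (\<rat> \<inter> {0..t})" by (intro closure_mono) auto
  finally have "closure {0<..<t} \<subseteq> closure (\<rat> \<inter> {0..t})"
    by (rule closure_minimal) simp
  then show ?thesis using assms by simp
qed

lemma drift_jointly_continuous:
  assumes lip: "locally_lipschitz_unif b" and cont: "\<And>x. continuous_on {0..} (\<lambda>s. b s x)"
  shows "continuous_on ({0..} \<times> UNIV) (\<lambda>(s, x). b s x)"
  unfolding continuous_on_def
proof safe
  fix s0 x0 :: real assume s0: "0 \<le> s0"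
  let ?F = "at (s0, x0) within {0..} \<times> UNIV"
  obtain L where L: "\<And>s. s \<in> {0..s0 + 1} \<Longrightarrow> L-lipschitz_on {-(\<bar>x0\<bar> + 1)..\<bar>x0\<bar> + 1} (b s)"
    using lip s0 unfolding locally_lipschitz_unif_def
    by (metis abs_ge_zero add_nonneg_pos less_numeral_extra(1))
  have lim: "(fst \<longlongrightarrow> s0) ?F" "(snd \<longlongrightarrow> x0) ?F"
    using tendsto_fst[OF tendsto_ident_at, of "(s0, x0)"] tendsto_snd[OF tendsto_ident_at, of "(s0, x0)"] by auto
  have "continuous_on ({0..} \<times> UNIV) (\<lambda>p :: real \<times> real. b (fst p) x0)"
    by (rule continuous_on_compose2[OF cont]) (auto intro!: continuous_intros)
  then have 1: "((\<lambda>p. b (fst p) x0) \<longlongrightarrow> b s0 x0) ?F"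
    using s0 unfolding continuous_on_def by auto
  have 2: "((\<lambda>p. b (fst p) (snd p) - b (fst p) x0) \<longlongrightarrow> 0) ?F"
  proof (rule Lim_null_comparison)
    have "eventually (\<lambda>p. p \<in> {0..} \<times> UNIV) ?F" by (simp add: eventually_at_filter)
    moreover have "eventually (\<lambda>p. fst p < s0 + 1) ?F" using order_tendstoD(2)[OF lim(1)] by simp
    moreover have "eventually (\<lambda>p. snd p < x0 + 1) ?F" "eventually (\<lambda>p. x0 - 1 < snd p) ?F"
      using order_tendstoD[OF lim(2)] by simp_all
    ultimately show "eventually (\<lambda>p. norm (b (fst p) (snd p) - b (fst p) x0) \<le> L * \<bar>snd p - x0\<bar>) ?F"
    proof eventually_elim
      case (elim p)
      then have "L-lipschitz_on {-(\<bar>x0\<bar> + 1)..\<bar>x0\<bar> + 1} (b (fst p))" by (intro L) auto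
      then have "dist (b (fst p) (snd p)) (b (fst p) x0) \<le> L * dist (snd p) x0"
        by (rule lipschitz_onD) (use elim in auto)
      then show ?case by (simp add: dist_real_def)
    qed
    have "((\<lambda>p. L * \<bar>snd p - x0\<bar>) \<longlongrightarrow> L * \<bar>x0 - x0\<bar>) ?F" by (intro tendsto_intros lim)
    then show "((\<lambda>p. L * \<bar>snd p - x0\<bar>) \<longlongrightarrow> 0) ?F" by simp
  qed
  show "((\<lambda>(s, x). b s x) \<longlongrightarrow> b s0 x0) ?F"
    using tendsto_add[OF 2 1] by (simp add: case_prod_unfold)
qed

lemma sum_of_bool_initial_segment:
  fixes v :: "nat \<Rightarrow> real"
  assumes C: "\<And>k l. k \<le> l \<Longrightarrow> C l \<Longrightarrow> C k"
  shows "\<exists>\<nu>\<le>N. (\<forall>k<N. C k \<longleftrightarrow> k < \<nu>) \<and> (\<Sum>k<N. of_bool (C k) * (v (Suc k) - v k)) = v \<nu> - v 0"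
proof (induction N)
  case 0
  then show ?case by simp
next
  case (Suc N)
  then obtain \<nu> where \<nu>: "\<nu> \<le> N" "\<forall>k<N. C k \<longleftrightarrow> k < \<nu>"
    "(\<Sum>k<N. of_bool (C k) * (v (Suc k) - v k)) = v \<nu> - v 0" by blast
  show ?case
  proof (cases "C N")
    case True
    then have "\<forall>k<N. C k" using C less_imp_le by blast
    then have "\<nu> = N" using \<nu> by (meson le_neq_implies_less less_irrefl)
    then show ?thesis using True \<nu> by (intro exI[of _ "Suc N"]) (auto simp: less_Suc_eq)
  next
    case False
    then show ?thesis using \<nu> by (intro exI[of _ \<nu>]) (auto simp: less_Suc_eq)
  qed
qed

text \<open>The properties of almost every path of the solution: \<open>x\<close> is the path, \<open>i\<close> the noise and \<open>\<theta>\<close> the explosion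
time.\<close>

locale explosive_path =
  fixes b :: "real \<Rightarrow> real \<Rightarrow> real" and \<xi> :: real and x i :: "real \<Rightarrow> real" and \<theta> :: ereal
  assumes b_lipschitz: "locally_lipschitz_unif b"
    and b_continuous: "\<And>y. continuous_on {0..} (\<lambda>s. b s y)"
    and \<theta>_pos: "0 < \<theta>"
    and x_cont: "continuous_on {t. 0 \<le> t \<and> ereal t < \<theta>} x"
    and x_eq: "\<And>t. 0 \<le> t \<Longrightarrow> ereal t < \<theta> \<Longrightarrow> x t = \<xi> + integral {0..t} (\<lambda>s. b s (x s)) + i t"
    and x_explodes: "\<theta> < \<infinity> \<Longrightarrow> Limsup (at_left (real_of_ereal \<theta>)) (\<lambda>t. ereal \<bar>x t\<bar>) = \<infinity>"
    and i_cont: "continuous_on {0..} i"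
    and i_0: "i 0 = 0"
begin

abbreviation "y \<equiv> killed x \<theta>"

lemma x_0: "x 0 = \<xi>"
  using x_eq[of 0] \<theta>_pos i_0 by (simp add: zero_ereal_def)

lemma below_lifetime: "0 \<le> s \<Longrightarrow> s \<le> t \<Longrightarrow> ereal t < \<theta> \<Longrightarrow> s \<in> {t. 0 \<le> t \<and> ereal t < \<theta>}"
  by (auto intro: order_le_less_trans[of "ereal s" "ereal t"])

lemma drift_continuous: "continuous_on {t. 0 \<le> t \<and> ereal t < \<theta>} (\<lambda>s. b s (x s))"
proof -
  have "continuous_on {t. 0 \<le> t \<and> ereal t < \<theta>} (\<lambda>s. case (s, x s) of (s, z) \<Rightarrow> b s z)"
    by (rule continuous_on_compose2[OF drift_jointly_continuous[OF b_lipschitz b_continuous]])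
      (auto intro!: continuous_intros x_cont)
  then show ?thesis by simp
qed

lemma drift_continuous_Icc:
  "0 \<le> s \<Longrightarrow> ereal t < \<theta> \<Longrightarrow> continuous_on {s..t} (\<lambda>s. b s (x s))"
  by (rule continuous_on_subset[OF drift_continuous]) (use below_lifetime in auto)

lemma x_continuous_Icc: "0 \<le> s \<Longrightarrow> ereal t < \<theta> \<Longrightarrow> continuous_on {s..t} x"
  by (rule continuous_on_subset[OF x_cont]) (use below_lifetime in auto)

lemma x_increment:
  assumes "0 \<le> s" "s \<le> t" "ereal t < \<theta>"
  shows "x t = x s + integral {s..t} (\<lambda>r. b r (x r)) + (i t - i s)"
proof -
  have "integral {0..s} (\<lambda>r. b r (x r)) + integral {s..t} (\<lambda>r. b r (x r)) = integral {0..t} (\<lambda>r. b r (x r))"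
    using assms by (intro Henstock_Kurzweil_Integration.integral_combine integrable_continuous_real drift_continuous_Icc) auto
  then show ?thesis
    using x_eq[of s] x_eq[of t] below_lifetime[OF assms] assms by simp
qed

text \<open>The prediction and the path share the noise increment, so they differ by \<open>\<integral> (b r (x r) - b s (x s)) dr\<close>.\<close>

lemma predictor_close:
  assumes s: "0 \<le> s" "0 < h" "ereal (s + h) < \<theta>"
    and R: "\<bar>x (s + h)\<bar> \<le> R'"
    and e: "\<And>r. r \<in> {s..s + h} \<Longrightarrow> \<bar>b r (x r) - b s (x s)\<bar> \<le> e" "e * h \<le> c"
    and V: "\<And>z. (V has_real_derivative V' z) (at z)"
      "\<And>z. \<bar>z\<bar> \<le> R' + c \<Longrightarrow> \<bar>V' z\<bar> \<le> B"
  shows "\<bar>V (x (s + h)) - V (x s + b s (x s) * h + (i (s + h) - i s))\<bar> \<le> B * (e * h)"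
proof -
  let ?p = "x s + b s (x s) * h + (i (s + h) - i s)"
  have e0: "0 \<le> e" using e(1)[of s] s by auto
  have "((\<lambda>r. b r (x r) - b s (x s)) has_integral
      (integral {s..s + h} (\<lambda>r. b r (x r)) - (s + h - s) *\<^sub>R b s (x s))) {s..s + h}"
    using s drift_continuous_Icc[of s "s + h"] has_integral_const_real[of "b s (x s)" s "s + h"]
    by (intro has_integral_diff integrable_integral integrable_continuous_real) auto
  then have "norm (integral {s..s + h} (\<lambda>r. b r (x r)) - (s + h - s) *\<^sub>R b s (x s)) \<le> e * measure lborel {s..s + h}"
    using e(1) e0 by (intro has_integral_bound_real) auto
  then have close: "\<bar>x (s + h) - ?p\<bar> \<le> e * h"
    using x_increment[of s "s + h"] s by (simp add: algebra_simps)
  have c: "0 \<le> c" using e e0 s by (smt (verit) mult_nonneg_nonneg)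
  have "norm (V (x (s + h)) - V ?p) \<le> B * norm (x (s + h) - ?p)"
  proof (rule field_differentiable_bound[of "{-(R' + c)..R' + c}"])
    show "(V has_field_derivative V' z) (at z within {- (R' + c)..R' + c})" for z
      using V(1) by (rule has_field_derivative_at_within)
    show "norm (V' z) \<le> B" if "z \<in> {- (R' + c)..R' + c}" for z using V(2)[of z] that by auto
    show "x (s + h) \<in> {- (R' + c)..R' + c}" using R c by auto
    show "?p \<in> {- (R' + c)..R' + c}" using R close e(2) unfolding atLeastAtMost_iff by linarith
  qed simp
  moreover have "0 \<le> B" using V(2)[of "x (s + h)"] R c by auto
  ultimately show ?thesis using close by (smt (verit) mult_left_mono real_norm_def)
qed

lemma confined_iff:
  assumes "0 \<le> t"
  shows "confined x \<theta> R t \<longleftrightarrow> ereal t < \<theta> \<and> (\<forall>s\<in>{0..t}. \<bar>x s\<bar> \<le> R)"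
proof (cases "ereal t < \<theta>")
  case True
  have killed: "killed x \<theta> s = x s" if "s \<in> {0..t}" for s
    using below_lifetime[of s t] that True by (auto simp: killed_def)
  have "\<bar>x s\<bar> \<le> R" if *: "\<And>q :: rat. real_of_rat q \<in> {0..t} \<Longrightarrow> \<bar>x (real_of_rat q)\<bar> \<le> R" and s: "s \<in> {0..t}" for s
  proof (cases "t = 0")
    case True
    then show ?thesis using *[of 0] s by simp
  next
    case False
    show ?thesis
    proof (rule continuous_le_on_closure[of "\<rat> \<inter> {0..t}" "\<lambda>s. \<bar>x s\<bar>"])
      have "closure (\<rat> \<inter> {0..t}) \<subseteq> {0..t}" by (rule closure_minimal) auto
      then show "continuous_on (closure (\<rat> \<inter> {0..t})) (\<lambda>s. \<bar>x s\<bar>)"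
        using True by (intro continuous_on_subset[OF continuous_on_rabs[OF x_continuous_Icc]]) auto
      show "s \<in> closure (\<rat> \<inter> {0..t})" using interval_subset_closure_rat[of t] s False assms by auto
    qed (use * in \<open>auto elim!: Rats_cases\<close>)
  qed
  then show ?thesis using True killed by (auto simp: confined_def)
qed (simp add: confined_def)

text \<open>By continuity the supremum is attained. It is less than the explosion time because a path that stays in
\<open>[-R, R]\<close> up to a time does not explode there.\<close>

lemma exit_time:
  assumes R: "\<bar>\<xi>\<bar> \<le> R" and T: "0 \<le> T"
  shows "0 \<le> exit_time x \<theta> R T" "exit_time x \<theta> R T \<le> T" "ereal (exit_time x \<theta> R T) < \<theta>"
    "\<And>t. t \<in> {0..T} \<Longrightarrow> confined x \<theta> R t \<longleftrightarrow> t \<le> exit_time x \<theta> R T"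
proof -
  let ?S = "{t \<in> {0..T}. confined x \<theta> R t}" and ?\<sigma> = "exit_time x \<theta> R T"
  have 0: "0 \<in> ?S" using R T \<theta>_pos by (auto simp: confined_iff x_0 zero_ereal_def)
  have bdd: "bdd_above ?S" by (auto intro!: bdd_aboveI[of _ T])
  show \<sigma>0: "0 \<le> ?\<sigma>" unfolding exit_time_def by (rule cSup_upper[OF 0 bdd])
  show \<sigma>T: "?\<sigma> \<le> T" unfolding exit_time_def using 0 by (intro cSup_least) auto
  have less: "confined x \<theta> R t" if t: "0 \<le> t" "t < ?\<sigma>" for t
  proof -
    obtain t' where "t' \<in> ?S" "t < t'"
      using less_cSupE[of t ?S] t(2) 0 unfolding exit_time_def by blast
    then show ?thesis using confined_antimono[of x \<theta> R t' t] by auto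
  qed
  have bound: "\<bar>x s\<bar> \<le> R" if "0 \<le> s" "s < ?\<sigma>" for s
    using less[OF that] that by (auto simp: confined_iff)
  show \<sigma>\<theta>: "ereal ?\<sigma> < \<theta>"
  proof (rule ccontr)
    assume "\<not> ereal ?\<sigma> < \<theta>"
    then have le: "\<theta> \<le> ereal ?\<sigma>" by simp
    then obtain r where r: "\<theta> = ereal r" using \<theta>_pos by (cases \<theta>) auto
    then have "0 < r" "r \<le> ?\<sigma>" using le \<theta>_pos by auto
    have "eventually (\<lambda>s. s \<in> {0<..<r}) (at_left r)"
      using \<open>0 < r\<close> by (rule eventually_at_left_real)
    then have "eventually (\<lambda>s. ereal \<bar>x s\<bar> \<le> ereal R) (at_left r)"
      by eventually_elim (use \<open>r \<le> ?\<sigma>\<close> in \<open>auto intro!: bound\<close>)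
    then have "Limsup (at_left r) (\<lambda>s. ereal \<bar>x s\<bar>) \<le> ereal R" by (rule Limsup_bounded)
    then show False using x_explodes r by simp
  qed
  have "confined x \<theta> R ?\<sigma>"
  proof (cases "?\<sigma> = 0")
    case True
    then show ?thesis using 0 by simp
  next
    case False
    have "\<bar>x s\<bar> \<le> R" if "s \<in> {0..?\<sigma>}" for s
    proof (rule continuous_le_on_closure[of "{0<..<?\<sigma>}" "\<lambda>s. \<bar>x s\<bar>"])
      show "continuous_on (closure {0<..<?\<sigma>}) (\<lambda>s. \<bar>x s\<bar>)"
        using False \<sigma>0 \<sigma>\<theta> by (simp, intro continuous_on_rabs x_continuous_Icc) auto
      show "s \<in> closure {0<..<?\<sigma>}" using that False \<sigma>0 by simp
    qed (use bound in auto)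
    then show ?thesis using \<sigma>0 \<sigma>\<theta> by (simp add: confined_iff)
  qed
  then show "confined x \<theta> R t \<longleftrightarrow> t \<le> ?\<sigma>" if "t \<in> {0..T}" for t
    using confined_antimono[of x \<theta> R ?\<sigma> t] cSup_upper[of t ?S, OF _ bdd] that
    by (auto simp: exit_time_def)
qed

lemma y_value_continuous:
  assumes U: "continuous_on ({0..} \<times> UNIV) (\<lambda>(t, z). U t z :: real)"
  shows "continuous_on {t. 0 \<le> t \<and> ereal t < \<theta>} (\<lambda>t. U t (y t))"
proof -
  have "continuous_on {t. 0 \<le> t \<and> ereal t < \<theta>} (\<lambda>t. case (t, x t) of (t, z) \<Rightarrow> U t z)"
    by (rule continuous_on_compose2[OF U]) (auto intro!: continuous_intros x_cont)
  then show ?thesis by (rule continuous_on_eq) (simp add: killed_def)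
qed

lemma y_value_tendsto:
  assumes U: "continuous_on ({0..} \<times> UNIV) (\<lambda>(t, z). U t z :: real)"
    and s: "\<And>n. 0 \<le> s n" "s \<longlonglongrightarrow> m" "0 \<le> m" "ereal m < \<theta>"
  shows "(\<lambda>n. U (s n) (y (s n))) \<longlonglongrightarrow> U m (y m)"
proof -
  have "((\<lambda>n. ereal (s n)) \<longlongrightarrow> ereal m) sequentially" using s(2) by simp
  then have "eventually (\<lambda>n. ereal (s n) < \<theta>) sequentially"
    using s(4) by (rule order_tendstoD(2))
  then have ev: "eventually (\<lambda>n. s n \<in> {t. 0 \<le> t \<and> ereal t < \<theta>}) sequentially"
    by eventually_elim (use s in auto)
  show ?thesis
    by (rule continuous_on_tendsto_compose[OF y_value_continuous[OF U] s(2) _ ev]) (use s in auto)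
qed

text \<open>Each sum telescopes to the value at the first grid point after the exit time, or at \<open>T\<close> if there is none. As
the mesh tends to \<open>0\<close>, these points tend to the exit time, or to \<open>\<epsilon>\<close> if that is later.\<close>

lemma stopped_value_tendsto:
  assumes U: "continuous_on ({0..} \<times> UNIV) (\<lambda>(t, z). U t z :: real)"
    and \<epsilon>: "0 < \<epsilon>" "\<epsilon> < T" and R: "\<bar>\<xi>\<bar> \<le> R"
  defines "h \<equiv> \<lambda>n. (T - \<epsilon>) / real (Suc n)" and "m \<equiv> max \<epsilon> (exit_time x \<theta> R T)"
  shows "(\<lambda>n. U \<epsilon> (y \<epsilon>) + (\<Sum>k<Suc n. of_bool (confined x \<theta> R (\<epsilon> + real k * h n)) *
      (U (\<epsilon> + real (Suc k) * h n) (y (\<epsilon> + real (Suc k) * h n)) - U (\<epsilon> + real k * h n) (y (\<epsilon> + real k * h n)))))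
    \<longlonglongrightarrow> U m (y m)"
proof -
  let ?\<sigma> = "exit_time x \<theta> R T"
  let ?s = "\<lambda>n k. \<epsilon> + real k * h n"
  note \<sigma> = exit_time[OF R, of T]
  have T: "0 \<le> T" using \<epsilon> by simp
  have h: "0 < h n" "real (Suc n) * h n = T - \<epsilon>" for n using \<epsilon> by (auto simp: h_def)
  have sT: "?s n k \<le> T" if "k \<le> Suc n" for n k
  proof -
    have "real k * h n \<le> real (Suc n) * h n" using that h(1)[of n] by (intro mult_right_mono) auto
    then show ?thesis using h(2)[of n] by simp
  qed
  have "\<exists>\<nu>. \<nu> \<le> Suc n \<and> (\<forall>k<Suc n. confined x \<theta> R (?s n k) \<longleftrightarrow> k < \<nu>) \<and>
      (\<Sum>k<Suc n. of_bool (confined x \<theta> R (?s n k)) * (U (?s n (Suc k)) (y (?s n (Suc k))) - U (?s n k) (y (?s n k))))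
        = U (?s n \<nu>) (y (?s n \<nu>)) - U (?s n 0) (y (?s n 0))" for n
  proof -
    have "confined x \<theta> R (?s n k)" if "k \<le> l" "confined x \<theta> R (?s n l)" for k l
      using that h(1)[of n] by (intro confined_antimono[OF that(2)]) (auto intro!: mult_right_mono)
    then show ?thesis
      using sum_of_bool_initial_segment[of "\<lambda>k. confined x \<theta> R (?s n k)" "Suc n" "\<lambda>k. U (?s n k) (y (?s n k))"]
      by blast
  qed
  then obtain \<nu> where \<nu>: "\<And>n. \<nu> n \<le> Suc n" "\<And>n k. k < Suc n \<Longrightarrow> confined x \<theta> R (?s n k) \<longleftrightarrow> k < \<nu> n"
    "\<And>n. (\<Sum>k<Suc n. of_bool (confined x \<theta> R (?s n k)) * (U (?s n (Suc k)) (y (?s n (Suc k))) - U (?s n k) (y (?s n k))))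
        = U (?s n (\<nu> n)) (y (?s n (\<nu> n))) - U (?s n 0) (y (?s n 0))"
    by metis
  have conf: "k < \<nu> n \<longleftrightarrow> ?s n k \<le> ?\<sigma>" if "k < Suc n" for n k
    using \<nu>(2)[OF that] \<sigma>(4)[OF T, of "?s n k"] sT[of k n] that \<epsilon> h(1)[of n] by simp
  have limit: "(\<lambda>n. U (?s n (\<nu> n)) (y (?s n (\<nu> n)))) \<longlonglongrightarrow> U m (y m)"
  proof (cases "?\<sigma> < \<epsilon>")
    case True
    then have "\<nu> n = 0" for n using conf[of 0 n] by auto
    then show ?thesis using True by (simp add: m_def)
  next
    case False
    then have m: "m = ?\<sigma>" by (simp add: m_def)
    have lower: "?\<sigma> \<le> ?s n (\<nu> n)" for n
    proof (cases "\<nu> n < Suc n")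
      case True
      then show ?thesis using conf[of "\<nu> n" n] by auto
    next
      case False
      then have "\<nu> n = Suc n" using \<nu>(1)[of n] by simp
      then show ?thesis using h(2)[of n] \<sigma>(2)[OF T] by simp
    qed
    have upper: "?s n (\<nu> n) \<le> ?\<sigma> + h n" for n
    proof -
      have "0 < \<nu> n" using conf[of 0 n] False by auto
      then obtain l where l: "\<nu> n = Suc l" by (cases "\<nu> n") auto
      then have "?s n l \<le> ?\<sigma>" using conf[of l n] \<nu>(1)[of n] by auto
      then show ?thesis by (simp add: l algebra_simps)
    qed
    have "h \<longlonglongrightarrow> 0"
      unfolding h_def by (rule LIMSEQ_Suc[OF lim_const_over_n])
    then have h0: "(\<lambda>n. ?\<sigma> + h n) \<longlonglongrightarrow> ?\<sigma>" using tendsto_add[OF tendsto_const, of h 0] by fastforce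
    have "(\<lambda>n. ?s n (\<nu> n)) \<longlonglongrightarrow> m"
      unfolding m
    proof (rule tendsto_sandwich[OF _ _ tendsto_const h0])
      show "eventually (\<lambda>n. ?\<sigma> \<le> ?s n (\<nu> n)) sequentially" using lower by simp
      show "eventually (\<lambda>n. ?s n (\<nu> n) \<le> ?\<sigma> + h n) sequentially" using upper by simp
    qed
    then show ?thesis
      using h(1) \<epsilon> \<sigma>[OF T] m by (intro y_value_tendsto[OF U]) (auto simp: less_imp_le)
  qed
  show ?thesis unfolding \<nu>(3) using limit by simp
qed

end

section \<open>Prediction errors along a path and behaviour at explosion\<close>

context explosive_path begin

lemma y_step:
  assumes "0 \<le> s" "0 \<le> h" "ereal (s + h) < \<theta>"
  shows "y s = x s" "y (s + h) = x (s + h)"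
  using below_lifetime[of s "s + h"] assms by (auto simp: killed_def)

text \<open>If the path is confined over the whole step, the drift changes by at most \<open>2 * K\<close>, which costs \<open>O(h)\<close>. The
step during which the path leaves \<open>[-R, R]\<close> may be wild, but there is at most one, and it costs at most
\<open>2 * M\<close>; the differences of consecutive indicators count it.\<close>

lemma prediction_error_sum_bound:
  assumes \<epsilon>: "0 < \<epsilon>" "\<epsilon> < T"
    and K: "\<And>s z. s \<in> {0..T} \<Longrightarrow> \<bar>z\<bar> \<le> R \<Longrightarrow> \<bar>b s z\<bar> \<le> K"
    and U: "\<And>t z. 0 < t \<Longrightarrow> (U t has_real_derivative Ux t z) (at z)"
    and M: "\<And>t z. 0 \<le> t \<Longrightarrow> \<bar>U t z\<bar> \<le> M"
    and B: "\<And>t z. t \<in> {\<epsilon>..T} \<Longrightarrow> \<bar>z\<bar> \<le> R + 2 * K * T \<Longrightarrow> \<bar>Ux t z\<bar> \<le> B"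
    and nonneg: "0 \<le> K" "0 \<le> B"
  defines "h \<equiv> \<lambda>n. (T - \<epsilon>) / real (Suc n)"
  shows "\<bar>\<Sum>k<Suc n. prediction_error U b x i \<theta> R (h n) (\<epsilon> + real k * h n)\<bar> \<le> 2 * B * K * T + 2 * M"
proof -
  let ?s = "\<lambda>k. \<epsilon> + real k * h n"
  let ?c = "\<lambda>k. of_bool (confined x \<theta> R (?s k)) :: real"
  have M0: "0 \<le> M" using M[of 0 0] by simp
  have h: "0 < h n" "real (Suc n) * h n = T - \<epsilon>" using \<epsilon> by (auto simp: h_def)
  have s_Suc: "?s (Suc k) = ?s k + h n" for k by (simp add: algebra_simps)
  have s: "0 < ?s k" "\<epsilon> \<le> ?s k" for k using \<epsilon> h(1) by (auto simp: add_pos_nonneg)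
  have sT: "?s k + h n \<le> T" if "k < Suc n" for k
  proof -
    have "real (Suc k) * h n \<le> real (Suc n) * h n" using that h(1) by (intro mult_right_mono) auto
    then show ?thesis using h(2) by (simp add: algebra_simps)
  qed
  have hT: "h n \<le> T" using sT[of 0] \<epsilon> by simp
  have step_bound: "\<bar>prediction_error U b x i \<theta> R (h n) (?s k)\<bar> \<le> B * (2 * K * h n) + 2 * M * (?c k - ?c (Suc k))"
    if k: "k < Suc n" for k
  proof (cases "confined x \<theta> R (?s (Suc k))")
    case True
    then have conf: "confined x \<theta> R (?s k)"
      by (rule confined_antimono) (use h(1) in \<open>simp add: algebra_simps\<close>)
    have c: "ereal (?s k + h n) < \<theta>" "\<And>r. r \<in> {0..?s k + h n} \<Longrightarrow> \<bar>x r\<bar> \<le> R"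
      using True s(1)[of k] h(1) unfolding s_Suc by (auto simp: confined_iff)
    have bK: "\<bar>b r (x r)\<bar> \<le> K" if "r \<in> {?s k..?s k + h n}" for r
      using that s(1)[of k] sT[OF k] by (intro K c(2)) auto
    have "\<bar>U (?s k + h n) (x (?s k + h n))
        - U (?s k + h n) (x (?s k) + b (?s k) (x (?s k)) * h n + (i (?s k + h n) - i (?s k)))\<bar> \<le> B * (2 * K * h n)"
    proof (rule predictor_close[where R' = R and c = "2 * K * T" and V' = "Ux (?s k + h n)"])
      show "\<bar>b r (x r) - b (?s k) (x (?s k))\<bar> \<le> 2 * K" if "r \<in> {?s k..?s k + h n}" for r
        using bK[OF that] bK[of "?s k"] h(1) by auto
      show "2 * K * h n \<le> 2 * K * T" using hT nonneg by (intro mult_left_mono) auto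
      show "(U (?s k + h n) has_real_derivative Ux (?s k + h n) z) (at z)" for z
        using s(1)[of k] h(1) by (intro U) simp
      show "\<bar>Ux (?s k + h n) z\<bar> \<le> B" if "\<bar>z\<bar> \<le> R + 2 * K * T" for z
        using s(2)[of k] h(1) sT[OF k] that by (intro B) auto
    qed (use s(1)[of k] h(1) c in auto)
    then show ?thesis
      using True conf y_step[of "?s k" "h n"] s(1)[of k] h(1) c(1) by (simp add: prediction_error_def)
  next
    case False
    have "\<bar>U (?s k + h n) (y (?s k + h n))
        - U (?s k + h n) (y (?s k) + b (?s k) (y (?s k)) * h n + (i (?s k + h n) - i (?s k)))\<bar> \<le> M + M"
      using s(1)[of k] h(1) by (intro order_trans[OF abs_triangle_ineq4] add_mono M) auto
    then have "\<bar>prediction_error U b x i \<theta> R (h n) (?s k)\<bar> \<le> 2 * M * ?c k"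
      by (auto simp: prediction_error_def abs_mult)
    moreover have "0 \<le> B * (2 * K * h n)" using nonneg h(1) by simp
    moreover have "?c (Suc k) = 0" using False by simp
    ultimately show ?thesis by (simp only: diff_zero)
  qed
  have "\<bar>\<Sum>k<Suc n. prediction_error U b x i \<theta> R (h n) (?s k)\<bar>
      \<le> (\<Sum>k<Suc n. B * (2 * K * h n) + 2 * M * (?c k - ?c (Suc k)))"
    by (rule order_trans[OF sum_abs]) (intro sum_mono step_bound, simp)
  also have "\<dots> = 2 * B * K * (real (Suc n) * h n) + 2 * M * (\<Sum>k<Suc n. ?c k - ?c (Suc k))"
    by (simp only: sum.distrib sum_distrib_left[symmetric] sum_constant card_lessThan)
  also have "(\<Sum>k<Suc n. ?c k - ?c (Suc k)) = ?c 0 - ?c (Suc n)"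
    by (rule sum_lessThan_telescope')
  also have "2 * B * K * (real (Suc n) * h n) + 2 * M * (?c 0 - ?c (Suc n)) \<le> 2 * B * K * T + 2 * M * 1"
    using nonneg M0 \<epsilon> unfolding h(2) by (intro add_mono mult_left_mono) auto
  finally show ?thesis by simp
qed

text \<open>On a fixed path, all steps under consideration end before some \<open>\<sigma>'\<close> between the exit time and the
explosion time once the mesh is small. Up to \<open>\<sigma>'\<close> the drift along the path is uniformly continuous.\<close>

lemma prediction_error_sum_tendsto:
  assumes \<epsilon>: "0 < \<epsilon>" "\<epsilon> < T" and R: "\<bar>\<xi>\<bar> \<le> R"
    and U: "\<And>t z. 0 < t \<Longrightarrow> (U t has_real_derivative Ux t z) (at z)"
    and Ux: "continuous_on ({0<..} \<times> UNIV) (\<lambda>(t, z). Ux t z)"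
  defines "h \<equiv> \<lambda>n. (T - \<epsilon>) / real (Suc n)"
  shows "(\<lambda>n. \<Sum>k<Suc n. prediction_error U b x i \<theta> R (h n) (\<epsilon> + real k * h n)) \<longlonglongrightarrow> 0"
proof (rule LIMSEQ_I)
  fix e :: real assume e: "0 < e"
  let ?\<sigma> = "exit_time x \<theta> R T"
  have T: "0 \<le> T" using \<epsilon> by simp
  note \<sigma> = exit_time[OF R T]
  obtain \<sigma>' where \<sigma>': "?\<sigma> < \<sigma>'" "ereal \<sigma>' < \<theta>"
    using ereal_dense2[OF \<sigma>(3)] by auto
  obtain R' where R': "\<And>s. s \<in> {0..\<sigma>'} \<Longrightarrow> \<bar>x s\<bar> \<le> R'"
    using continuous_Icc_bounded[OF x_continuous_Icc[OF order_refl \<sigma>'(2)]] by blast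
  obtain B where B0: "\<forall>t\<in>{\<epsilon>..T}. \<forall>z\<in>{-(R' + 1)..R' + 1}. \<bar>Ux t z\<bar> \<le> B"
    using continuous_strip_bounded[OF Ux \<epsilon>(1)] by blast
  define B' where "B' = \<bar>B\<bar>"
  have B: "\<bar>Ux t z\<bar> \<le> B'" if "t \<in> {\<epsilon>..T}" "\<bar>z\<bar> \<le> R' + 1" for t z
  proof -
    have "z \<in> {-(R' + 1)..R' + 1}" using that(2) by auto
    then have "\<bar>Ux t z\<bar> \<le> B" using B0 that(1) by blast
    then show ?thesis by (simp add: B'_def)
  qed
  define e' where "e' = min 1 (e / (B' * T + 1))"
  have B'0: "0 \<le> B'" by (simp add: B'_def)
  have e': "0 < e'" "e' \<le> 1" using e \<epsilon> B'0 T by (auto simp: e'_def add_nonneg_pos)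
  have "0 < B' * T + 1" using B'0 T by (simp add: add_nonneg_pos)
  moreover have "e' \<le> e / (B' * T + 1)" by (simp add: e'_def)
  ultimately have "e' * (B' * T + 1) \<le> e" by (simp only: pos_le_divide_eq)
  then have e'': "B' * e' * T < e" using e'(1) by (simp add: algebra_simps)
  have "uniformly_continuous_on {0..\<sigma>'} (\<lambda>s. b s (x s))"
    using \<sigma>' by (intro compact_uniformly_continuous drift_continuous_Icc compact_Icc) auto
  then obtain \<delta> where \<delta>: "0 < \<delta>" "\<And>s r. s \<in> {0..\<sigma>'} \<Longrightarrow> r \<in> {0..\<sigma>'} \<Longrightarrow> dist r s < \<delta> \<Longrightarrow> dist (b r (x r)) (b s (x s)) < e'"
    unfolding uniformly_continuous_on_def using e'(1) by metis
  have h0: "h \<longlonglongrightarrow> 0" unfolding h_def by (rule LIMSEQ_Suc[OF lim_const_over_n])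
  define d where "d = min \<delta> (min 1 (\<sigma>' - ?\<sigma>))"
  have "0 < d" using \<delta> \<sigma>'(1) by (simp add: d_def)
  then have "eventually (\<lambda>n. h n < d) sequentially" using h0 by (intro order_tendstoD(2)) auto
  then obtain N where N: "\<And>n. N \<le> n \<Longrightarrow> h n < d" unfolding eventually_sequentially by blast
  show "\<exists>N. \<forall>n\<ge>N. norm ((\<Sum>k<Suc n. prediction_error U b x i \<theta> R (h n) (\<epsilon> + real k * h n)) - 0) < e"
  proof (intro exI[of _ N] allI impI)
    fix n assume n: "N \<le> n"
    let ?s = "\<lambda>k. \<epsilon> + real k * h n"
    have h: "0 < h n" "real (Suc n) * h n = T - \<epsilon>" using \<epsilon> by (auto simp: h_def)
    have hd: "h n < \<delta>" "h n < 1" "h n < \<sigma>' - ?\<sigma>" using N[OF n] by (auto simp: d_def)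
    have s: "0 < ?s k" "\<epsilon> \<le> ?s k" for k using \<epsilon> h(1) by (auto simp: add_pos_nonneg)
    have sT: "?s k + h n \<le> T" if "k < Suc n" for k
    proof -
      have "real (Suc k) * h n \<le> real (Suc n) * h n" using that h(1) by (intro mult_right_mono) auto
      then show ?thesis using h(2) by (simp add: algebra_simps)
    qed
    have step_bound: "\<bar>prediction_error U b x i \<theta> R (h n) (?s k)\<bar> \<le> B' * (e' * h n)" if k: "k < Suc n" for k
    proof (cases "confined x \<theta> R (?s k)")
      case True
      have "?s k \<le> ?\<sigma>" using True \<sigma>(4)[of "?s k"] s(1)[of k] sT[OF k] h(1) by auto
      then have s\<sigma>': "?s k + h n \<le> \<sigma>'" using hd by simp
      then have s\<theta>: "ereal (?s k + h n) < \<theta>" using \<sigma>'(2) by (meson ereal_less_eq(3) order_le_less_trans)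
      have "\<bar>U (?s k + h n) (x (?s k + h n))
        - U (?s k + h n) (x (?s k) + b (?s k) (x (?s k)) * h n + (i (?s k + h n) - i (?s k)))\<bar> \<le> B' * (e' * h n)"
      proof (rule predictor_close[where R' = R' and c = 1 and V' = "Ux (?s k + h n)"])
        show "\<bar>b r (x r) - b (?s k) (x (?s k))\<bar> \<le> e'" if "r \<in> {?s k..?s k + h n}" for r
        proof -
          have "dist (b r (x r)) (b (?s k) (x (?s k))) < e'"
            using that s(1)[of k] s\<sigma>' hd by (intro \<delta>(2)) (auto simp: dist_real_def)
          then show ?thesis by (simp add: dist_real_def)
        qed
        show "e' * h n \<le> 1" using e' h(1) hd by (intro mult_le_one) auto
        show "\<bar>x (?s k + h n)\<bar> \<le> R'" using s\<sigma>' s(1)[of k] h(1) by (intro R') auto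
        show "(U (?s k + h n) has_real_derivative Ux (?s k + h n) z) (at z)" for z
          using s(1)[of k] h(1) by (intro U) simp
        show "\<bar>Ux (?s k + h n) z\<bar> \<le> B'" if "\<bar>z\<bar> \<le> R' + 1" for z
          using s(2)[of k] h(1) sT[OF k] that by (intro B) auto
      qed (use s(1)[of k] h(1) s\<theta> in auto)
      then show ?thesis
        using True y_step[of "?s k" "h n"] s(1)[of k] h(1) s\<theta> by (simp add: prediction_error_def)
    next
      case False
      then show ?thesis using B'0 e'(1) h(1) by (simp add: prediction_error_def)
    qed
    have "\<bar>\<Sum>k<Suc n. prediction_error U b x i \<theta> R (h n) (?s k)\<bar> \<le> (\<Sum>k<Suc n. B' * (e' * h n))"
      by (rule order_trans[OF sum_abs]) (intro sum_mono step_bound, simp)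
    also have "\<dots> = B' * e' * (real (Suc n) * h n)" by simp
    also have "\<dots> \<le> B' * e' * T" unfolding h(2) using B'0 e'(1) \<epsilon> by (intro mult_left_mono) auto
    also have "\<dots> < e" by (rule e'')
    finally show "norm ((\<Sum>k<Suc n. prediction_error U b x i \<theta> R (h n) (?s k)) - 0) < e" by simp
  qed
qed

lemma exit_time_eventually_ge:
  assumes "0 \<le> t" "ereal t < \<theta>"
  shows "eventually (\<lambda>n. t \<le> exit_time x \<theta> (real n) (real n)) sequentially"
proof -
  obtain R' where R': "\<And>s. s \<in> {0..t} \<Longrightarrow> \<bar>x s\<bar> \<le> R'"
    using continuous_Icc_bounded[OF x_continuous_Icc[OF order_refl assms(2)]] by blast
  have "eventually (\<lambda>n. max t (max R' \<bar>\<xi>\<bar>) \<le> real n) sequentially"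
    by (rule eventually_sequentiallyI[of "nat \<lceil>max t (max R' \<bar>\<xi>\<bar>)\<rceil>"]) linarith
  then show ?thesis
  proof eventually_elim
    case (elim n)
    then have "confined x \<theta> (real n) t" using assms R' by (fastforce simp: confined_iff)
    then show ?case using exit_time(4)[of "real n" "real n" t] elim assms by auto
  qed
qed

text \<open>Up to the bounded noise the path is nondecreasing. It cannot explode downwards, and once it is high it stays
high.\<close>

lemma explodes_upwards:
  assumes b_nonneg: "\<And>s z. 0 \<le> s \<Longrightarrow> 0 \<le> b s z" and r: "\<theta> = ereal r"
  shows "filterlim x at_top (at_left r)"
  unfolding filterlim_at_top
proof
  fix Z :: real
  have "0 < r" using \<theta>_pos r by simp
  have "continuous_on {0..r} i" by (rule continuous_on_subset[OF i_cont]) auto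
  then obtain C where C: "\<And>s. s \<in> {0..r} \<Longrightarrow> \<bar>i s\<bar> \<le> C"
    using continuous_Icc_bounded by blast
  let ?Z = "\<bar>Z\<bar> + \<bar>\<xi>\<bar> + 2 * \<bar>C\<bar>"
  have "\<exists>t\<in>{0<..<r}. ?Z < \<bar>x t\<bar>"
  proof (rule ccontr)
    assume none: "\<not> ?thesis"
    have "eventually (\<lambda>s. s \<in> {0<..<r}) (at_left r)"
      using \<open>0 < r\<close> by (rule eventually_at_left_real)
    then have "eventually (\<lambda>s. ereal \<bar>x s\<bar> \<le> ereal ?Z) (at_left r)"
      by eventually_elim (use none in \<open>auto simp: not_less\<close>)
    then have "Limsup (at_left r) (\<lambda>s. ereal \<bar>x s\<bar>) \<le> ereal ?Z" by (rule Limsup_bounded)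
    then show False using x_explodes r by simp
  qed
  then obtain t where t: "0 < t" "t < r" "?Z < \<bar>x t\<bar>" by auto
  have mono: "0 \<le> integral {s..t} (\<lambda>r. b r (x r))" if "0 \<le> s" "ereal t < \<theta>" for s t
    using that
    by (intro Henstock_Kurzweil_Integration.integral_nonneg integrable_continuous_real drift_continuous_Icc)
      (auto intro: b_nonneg)
  have xt: "?Z < x t"
    using x_eq[of t] mono[of 0 t] C[of t] t r by auto
  have "Z \<le> x s" if s: "t < s" "s < r" for s
    using x_increment[of t s] mono[of t s] C[of t] C[of s] t s r xt by auto
  moreover have "eventually (\<lambda>s. s \<in> {t<..<r}) (at_left r)"
    using t(2) by (rule eventually_at_left_real)
  ultimately show "eventually (\<lambda>s. Z \<le> x s) (at_left r)"
    by (auto elim!: eventually_mono)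
qed

lemma discounted_exit_value_tendsto:
  assumes b_nonneg: "\<And>s z. 0 \<le> s \<Longrightarrow> 0 \<le> b s z"
    and M: "\<And>t z. 0 \<le> t \<Longrightarrow> \<bar>u t z\<bar> \<le> M"
    and boundary: "boundary_value_at_infinity u (\<lambda>_. 1)" and lam: "0 < lam"
  shows "(\<lambda>n. exp (- lam * exit_time x \<theta> (real n) (real n)) *
      u (exit_time x \<theta> (real n) (real n)) (y (exit_time x \<theta> (real n) (real n))))
    \<longlonglongrightarrow> (if \<theta> = \<infinity> then 0 else exp (- lam * real_of_ereal \<theta>))"
proof -
  let ?\<sigma> = "\<lambda>n. exit_time x \<theta> (real n) (real n)"
  have "eventually (\<lambda>n. \<bar>\<xi>\<bar> \<le> real n) sequentially"
    by (rule eventually_sequentiallyI[of "nat \<lceil>\<bar>\<xi>\<bar>\<rceil>"]) linarith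
  then have ev: "eventually (\<lambda>n. 0 \<le> ?\<sigma> n \<and> ereal (?\<sigma> n) < \<theta>) sequentially"
    by eventually_elim (use exit_time in auto)
  show ?thesis
  proof (cases "\<theta> = \<infinity>")
    case True
    have \<sigma>: "filterlim ?\<sigma> at_top sequentially"
      unfolding filterlim_at_top
    proof
      fix Z :: real
      have "eventually (\<lambda>n. max 0 Z \<le> ?\<sigma> n) sequentially"
        by (rule exit_time_eventually_ge) (simp_all add: True del: ereal_max)
      then show "eventually (\<lambda>n. Z \<le> ?\<sigma> n) sequentially" by eventually_elim simp
    qed
    have "(\<lambda>n. exp (- lam * ?\<sigma> n) * u (?\<sigma> n) (y (?\<sigma> n))) \<longlonglongrightarrow> 0"
    proof (rule Lim_null_comparison)
      show "eventually (\<lambda>n. norm (exp (- lam * ?\<sigma> n) * u (?\<sigma> n) (y (?\<sigma> n))) \<le> exp (- lam * ?\<sigma> n) * M) sequentially"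
        using ev by eventually_elim (auto simp: abs_mult intro!: mult_left_mono M)
      have "filterlim (\<lambda>n. lam * ?\<sigma> n) at_top sequentially"
        by (rule filterlim_tendsto_pos_mult_at_top[OF tendsto_const lam \<sigma>])
      then have "filterlim (\<lambda>n. - (lam * ?\<sigma> n)) at_bot sequentially"
        by (simp add: filterlim_uminus_at_top)
      then have "((\<lambda>n. exp (- (lam * ?\<sigma> n))) \<longlongrightarrow> 0) sequentially"
        by (rule filterlim_compose[OF exp_at_bot])
      then show "((\<lambda>n. exp (- lam * ?\<sigma> n) * M) \<longlongrightarrow> 0) sequentially"
        using tendsto_mult_right[of _ 0 sequentially M] by simp
    qed
    then show ?thesis using True by simp
  next
    case False
    then obtain r where r: "\<theta> = ereal r" using \<theta>_pos by (cases \<theta>) auto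
    have "0 < r" using \<theta>_pos r by simp
    have lim: "?\<sigma> \<longlonglongrightarrow> r"
    proof (rule order_tendstoI)
      fix a assume "a < r"
      then obtain a' where a': "max 0 a < a'" "a' < r" using \<open>0 < r\<close> dense[of "max 0 a" r] by auto
      have "eventually (\<lambda>n. a' \<le> ?\<sigma> n) sequentially"
        by (rule exit_time_eventually_ge) (use a' r in auto)
      then show "eventually (\<lambda>n. a < ?\<sigma> n) sequentially" by eventually_elim (use a' in auto)
    next
      fix a assume "r < a"
      show "eventually (\<lambda>n. ?\<sigma> n < a) sequentially"
        using ev by eventually_elim (use r \<open>r < a\<close> in auto)
    qed
    have left: "filterlim ?\<sigma> (at_left r) sequentially"
      unfolding filterlim_at
      by (intro conjI lim eventually_mono[OF ev]) (use r in auto)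
    have "filterlim (\<lambda>n. x (?\<sigma> n)) at_top sequentially"
      by (rule filterlim_compose[OF explodes_upwards[OF b_nonneg r] left])
    then have "filterlim (\<lambda>n. (?\<sigma> n, x (?\<sigma> n))) (nhds r \<times>\<^sub>F at_top) sequentially"
      by (intro filterlim_Pair lim)
    moreover have "((\<lambda>(s, z). u s z) \<longlongrightarrow> 1) (nhds r \<times>\<^sub>F at_top)"
      using boundary \<open>0 < r\<close> by (simp add: boundary_value_at_infinity_def)
    ultimately have "(\<lambda>n. (\<lambda>(s, z). u s z) (?\<sigma> n, x (?\<sigma> n))) \<longlonglongrightarrow> 1"
      by (rule filterlim_compose[rotated])
    then have "(\<lambda>n. u (?\<sigma> n) (x (?\<sigma> n))) \<longlonglongrightarrow> 1" by simp
    moreover have "eventually (\<lambda>n. u (?\<sigma> n) (x (?\<sigma> n)) = u (?\<sigma> n) (y (?\<sigma> n))) sequentially"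
      using ev by eventually_elim (simp add: killed_def)
    ultimately have "(\<lambda>n. u (?\<sigma> n) (y (?\<sigma> n))) \<longlonglongrightarrow> 1"
      by (rule Lim_transform_eventually)
    then have "(\<lambda>n. exp (- lam * ?\<sigma> n) * u (?\<sigma> n) (y (?\<sigma> n))) \<longlonglongrightarrow> exp (- lam * r) * 1"
      by (intro tendsto_intros lim)
    then show ?thesis using r by simp
  qed
qed

end

section \<open>The expected gain of a predicted step\<close>

context brownian begin

lemma filtration_mono:
  assumes "e \<le> e'"
  shows "sets (brownian_filtration P W e) \<subseteq> sets (brownian_filtration P W e')"
proof -
  have "ereal s \<le> e'" if "ereal s \<le> e" for s
    using that assms by (rule order_trans)
  then show ?thesis
    unfolding sets_filtration by (intro sigma_sets_mono') blast
qed

lemma filtration_measurable_mono: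
  assumes "h \<in> measurable (brownian_filtration P W e) N" "e \<le> e'"
  shows "h \<in> measurable (brownian_filtration P W e') N"
  using assms(1) measurable_mono[of N N "brownian_filtration P W e" "brownian_filtration P W e'"]
    filtration_mono[OF assms(2)]
  by (auto simp: space_filtration)

text \<open>Completeness makes an almost sure limit measurable. The limits below are values at exit times, whose
measurability is most easily seen this way.\<close>

lemma bounded_convergence:
  fixes G :: "'a \<Rightarrow> real"
  assumes "\<And>n. g n \<in> borel_measurable P"
    and M: "\<And>n. AE \<omega> in P. \<bar>g n \<omega>\<bar> \<le> M" and lim: "AE \<omega> in P. (\<lambda>n. g n \<omega>) \<longlonglongrightarrow> G \<omega>"
  shows "G \<in> borel_measurable P" "(\<lambda>n. expectation (g n)) \<longlonglongrightarrow> expectation G"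
proof -
  let ?L = "\<lambda>\<omega>. lim (\<lambda>n. g n \<omega>)"
  have L: "?L \<in> borel_measurable P" by (rule borel_measurable_lim_metric) (rule assms(1))
  have eq: "AE \<omega> in P. ?L \<omega> = G \<omega>" using lim by eventually_elim (rule limI)
  show G: "G \<in> borel_measurable P"
  proof (rule measurableI)
    fix A :: "real set" assume A: "A \<in> sets borel"
    show "G -` A \<inter> space P \<in> sets P"
    proof (rule in_sets_AE[of "?L -` A \<inter> space P"])
      show "AE \<omega> in P. \<omega> \<in> ?L -` A \<inter> space P \<longleftrightarrow> \<omega> \<in> G -` A \<inter> space P"
        using eq by eventually_elim simp
      show "?L -` A \<inter> space P \<in> sets P" by (rule measurable_sets[OF L A])
    qed simp
  qed simp
  show "(\<lambda>n. expectation (g n)) \<longlonglongrightarrow> expectation G"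
  proof (rule integral_dominated_convergence[where w = "\<lambda>_. M"])
    show "AE \<omega> in P. norm (g n \<omega>) \<le> M" for n using M[of n] by simp
  qed (use G assms(1) lim in simp_all)
qed

end

context wiener_integral begin

lemma I_0: "AE \<omega> in P. I 0 \<omega> = 0"
proof -
  have [measurable]: "I 0 \<in> borel_measurable P" by (rule I_measurable) simp
  obtain \<phi> where \<phi>: "\<And>n. \<forall>(c, a, b)\<in>set (\<phi> n). 0 \<le> a \<and> a \<le> b \<and> b \<le> 0"
    and lim: "(\<lambda>n. \<integral>\<^sup>+ \<omega>. ennreal ((step_wiener W (\<phi> n) \<omega> - I 0 \<omega>)\<^sup>2) \<partial>P) \<longlonglongrightarrow> 0"
    using wiener_integral_at[of 0] unfolding is_wiener_integral_def by auto
  have "step_wiener W \<psi> \<omega> = 0" if "\<forall>(c, a, b)\<in>set \<psi>. 0 \<le> a \<and> a \<le> b \<and> b \<le> 0" for \<psi> \<omega>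
    using that
  proof (induction \<psi>)
    case (Cons p \<psi>)
    obtain c a b where p: "p = (c, a, b)" by (cases p)
    have "a = 0" "b = 0" using Cons.prems p by auto
    then show ?case using Cons by (simp add: step_wiener_def p)
  qed (simp add: step_wiener_def)
  then have "(\<lambda>n :: nat. \<integral>\<^sup>+ \<omega>. ennreal ((I 0 \<omega>)\<^sup>2) \<partial>P) \<longlonglongrightarrow> 0"
    using lim \<phi> by simp
  then have "(\<integral>\<^sup>+ \<omega>. ennreal ((I 0 \<omega>)\<^sup>2) \<partial>P) = 0" by (simp add: LIMSEQ_const_iff)
  then have "AE \<omega> in P. ennreal ((I 0 \<omega>)\<^sup>2) = 0" by (simp add: nn_integral_0_iff_AE)
  then show ?thesis by eventually_elim simp
qed

lemma I_continuous: "AE \<omega> in P. continuous_on {0..} (\<lambda>t. I t \<omega>)"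
  using I by (auto simp: wiener_integral_process_def)

lemma noise_variance_close:
  assumes s: "0 \<le> s" "s \<le> t" and c: "\<And>r. r \<in> {s..t} \<Longrightarrow> \<bar>(f r)\<^sup>2 - c\<bar> \<le> e"
  shows "\<bar>noise_variance s t - c * (t - s)\<bar> \<le> e * (t - s)"
proof -
  have "continuous_on {s..t} (\<lambda>r. (f r)\<^sup>2)"
    using s by (intro continuous_intros continuous_on_subset[OF f_cont]) auto
  then have "set_integrable lborel {s..t} (\<lambda>r. (f r)\<^sup>2)"
    by (rule borel_integrable_atLeastAtMost')
  then have "set_integrable lborel {s<..t} (\<lambda>r. (f r)\<^sup>2)"
    by (rule set_integrable_subset) auto
  then have int: "integrable lborel (\<lambda>r. indicator {s<..t} r * (f r)\<^sup>2)"
    by (simp add: set_integrable_def)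
  have ind: "integrable lborel (\<lambda>r. indicator {s<..t} r * d)" "(\<integral>r. indicator {s<..t} r * d \<partial>lborel) = d * (t - s)" for d :: real
    using s by auto
  have nv: "noise_variance s t = (\<integral>r. indicator {s<..t} r * (f r)\<^sup>2 \<partial>lborel)"
    unfolding noise_variance_def by (intro Bochner_Integration.integral_cong) (auto simp: indicator_def)
  have bounds: "indicator {s<..t} r * (f r)\<^sup>2 \<le> indicator {s<..t} r * (c + e)"
    "indicator {s<..t} r * (c - e) \<le> indicator {s<..t} r * (f r)\<^sup>2" for r
    using c[of r] by (cases "r \<in> {s<..t}"; simp add: abs_le_iff)+
  have "noise_variance s t \<le> (\<integral>r. indicator {s<..t} r * (c + e) \<partial>lborel)"
    unfolding nv by (rule integral_mono[OF int ind(1) bounds(1)])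
  moreover have "(\<integral>r. indicator {s<..t} r * (c - e) \<partial>lborel) \<le> noise_variance s t"
    unfolding nv by (rule integral_mono[OF ind(1) int bounds(2)])
  ultimately show ?thesis unfolding ind(2) by (simp add: abs_le_iff algebra_simps)
qed

end

locale explosive_sde = wiener_integral P W f I for P :: "'a measure" and W f I +
  fixes b :: "real \<Rightarrow> real \<Rightarrow> real" and \<xi> :: real and X :: "real \<Rightarrow> 'a \<Rightarrow> real" and \<tau> :: "'a \<Rightarrow> ereal"
  assumes b_lipschitz: "locally_lipschitz_unif b"
    and b_continuous: "\<And>x. continuous_on {0..} (\<lambda>s. b s x)"
    and X: "solution_up_to_explosion P W b I \<xi> X \<tau>"
begin

lemma AE_explosive_path:
  "AE \<omega> in P. explosive_path b \<xi> (\<lambda>t. X t \<omega>) (\<lambda>t. I t \<omega>) (\<tau> \<omega>)"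
proof -
  have "AE \<omega> in P. 0 < \<tau> \<omega> \<and> continuous_on {t. 0 \<le> t \<and> ereal t < \<tau> \<omega>} (\<lambda>t. X t \<omega>) \<and>
        (\<forall>t\<ge>0. ereal t < \<tau> \<omega> \<longrightarrow> X t \<omega> = \<xi> + integral {0..t} (\<lambda>s. b s (X s \<omega>)) + I t \<omega>) \<and>
        (\<tau> \<omega> < \<infinity> \<longrightarrow> Limsup (at_left (real_of_ereal (\<tau> \<omega>))) (\<lambda>t. ereal \<bar>X t \<omega>\<bar>) = \<infinity>)"
    using X unfolding solution_up_to_explosion_def by (elim conjE)
  then show ?thesis
    using I_0 I_continuous
  proof eventually_elim
    case (elim \<omega>)
    note path = elim(1)[THEN conjunct1] elim(1)[THEN conjunct2, THEN conjunct1]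
      elim(1)[THEN conjunct2, THEN conjunct2, THEN conjunct1, rule_format]
      elim(1)[THEN conjunct2, THEN conjunct2, THEN conjunct2, rule_format]
    show ?case
      by (rule explosive_path.intro[OF b_lipschitz b_continuous path elim(3) elim(2)])
  qed
qed

abbreviation Y :: "real \<Rightarrow> 'a \<Rightarrow> real" where
  "Y t \<omega> \<equiv> killed (\<lambda>t. X t \<omega>) (\<tau> \<omega>) t"

abbreviation conf :: "real \<Rightarrow> real \<Rightarrow> 'a \<Rightarrow> bool" where
  "conf R t \<omega> \<equiv> confined (\<lambda>t. X t \<omega>) (\<tau> \<omega>) R t"

abbreviation exit :: "real \<Rightarrow> real \<Rightarrow> 'a \<Rightarrow> real" where
  "exit R T \<omega> \<equiv> exit_time (\<lambda>t. X t \<omega>) (\<tau> \<omega>) R T"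

lemma explosion_stopping_time: "stopping_time (brownian_filtration P W) \<tau>"
  using X unfolding solution_up_to_explosion_def by (elim conjE)

lemma explosion_measurable: "\<tau> \<in> borel_measurable P"
  by (rule measurable_stopping_time[OF explosion_stopping_time])
    (rule sets_filtration_subset, rule space_filtration)

lemma Y_adapted: "0 \<le> t \<Longrightarrow> Y t \<in> borel_measurable (brownian_filtration P W (ereal t))"
  using X unfolding solution_up_to_explosion_def killed_def by (elim conjE) blast

lemma Y_measurable: "0 \<le> t \<Longrightarrow> Y t \<in> borel_measurable P"
  by (rule filtration_measurable[OF Y_adapted])

lemma conf_adapted:
  assumes "0 \<le> t"
  shows "Measurable.pred (brownian_filtration P W (ereal t)) (conf R t)"
proof -
  let ?F = "brownian_filtration P W (ereal t)"
  have alive: "Measurable.pred ?F (\<lambda>\<omega>. ereal t < \<tau> \<omega>)"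
    by (rule stopping_timeD2[OF explosion_stopping_time])
  have at_q: "Measurable.pred ?F (\<lambda>\<omega>. 0 \<le> real_of_rat q \<and> real_of_rat q \<le> t \<longrightarrow> \<bar>Y (real_of_rat q) \<omega>\<bar> \<le> R)" for q :: rat
  proof (cases "0 \<le> real_of_rat q \<and> real_of_rat q \<le> t")
    case True
    then have [measurable]: "Y (real_of_rat q) \<in> borel_measurable ?F"
      by (intro filtration_measurable_mono[OF Y_adapted]) auto
    show ?thesis by measurable
  next
    case False
    then have "(\<lambda>\<omega>. 0 \<le> real_of_rat q \<and> real_of_rat q \<le> t \<longrightarrow> \<bar>Y (real_of_rat q) \<omega>\<bar> \<le> R) = (\<lambda>\<omega>. True)"
      by blast
    then show ?thesis by simp
  qed
  show ?thesis
    unfolding confined_def by (rule pred_intros_logic(3)[OF alive pred_intros_countable(1)[OF at_q]])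
qed

lemma drift_bounded: "\<exists>K\<ge>0. \<forall>s\<in>{0..T}. \<forall>z. \<bar>z\<bar> \<le> R \<longrightarrow> \<bar>b s z\<bar> \<le> K"
proof -
  have "bounded ((\<lambda>(s, z). b s z) ` ({0..T} \<times> {-R..R}))"
    by (intro compact_imp_bounded compact_continuous_image compact_Times compact_Icc
        continuous_on_subset[OF drift_jointly_continuous[OF b_lipschitz b_continuous]]) auto
  then obtain K where K: "\<And>y. y \<in> (\<lambda>(s, z). b s z) ` ({0..T} \<times> {-R..R}) \<Longrightarrow> norm y \<le> K"
    unfolding bounded_iff by blast
  have "\<bar>b s z\<bar> \<le> \<bar>K\<bar>" if "s \<in> {0..T}" "\<bar>z\<bar> \<le> R" for s z
  proof -
    have "(s, z) \<in> {0..T} \<times> {-R..R}" using that by auto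
    then have "b s z \<in> (\<lambda>(s, z). b s z) ` ({0..T} \<times> {-R..R})" by (rule rev_image_eqI) simp
    then show ?thesis using K by fastforce
  qed
  then show ?thesis by (intro exI[of _ "\<bar>K\<bar>"]) auto
qed

lemma drift_measurable: "0 \<le> t \<Longrightarrow> b t \<in> borel_measurable borel"
  by (rule section_measurable[OF drift_jointly_continuous[OF b_lipschitz b_continuous]]) simp

end

text \<open>The backward equation of \<open>X\<close>. It makes \<open>U(t, X\<^sub>t)\<close> a martingale up to exit from a bounded interval.\<close>

locale backward_equation = explosive_sde P W f I b \<xi> X \<tau> for P :: "'a measure" and W f I b \<xi> X \<tau> +
  fixes U Ut Ux Uxx :: "real \<Rightarrow> real \<Rightarrow> real" and M :: real
  assumes U: "classical_derivatives U Ut Ux Uxx"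
    and M: "\<And>t x. 0 \<le> t \<Longrightarrow> \<bar>U t x\<bar> \<le> M"
    and pde: "\<And>t x. 0 < t \<Longrightarrow> Ut t x + 1 / 2 * (f t)\<^sup>2 * Uxx t x + b t x * Ux t x = 0"
begin

lemma U_cont: "continuous_on ({0..} \<times> UNIV) (\<lambda>(t, x). U t x)"
  and U_derivs: "\<And>t x. 0 < t \<Longrightarrow> (U t has_real_derivative Ux t x) (at x)"
  and Ux_cont: "continuous_on ({0<..} \<times> UNIV) (\<lambda>(t, x). Ux t x)"
  and Uxx_cont: "continuous_on ({0<..} \<times> UNIV) (\<lambda>(t, x). Uxx t x)"
  using U by (auto simp: classical_derivatives_def)

lemma U_measurable: "0 \<le> t \<Longrightarrow> U t \<in> borel_measurable borel"
  by (rule section_measurable[OF U_cont]) simp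

abbreviation gain :: "real \<Rightarrow> real \<Rightarrow> real \<Rightarrow> 'a \<Rightarrow> real" where
  "gain R h t \<omega> \<equiv> predicted_gain U b (\<lambda>t. X t \<omega>) (\<lambda>t. I t \<omega>) (\<tau> \<omega>) R h t"

abbreviation pred_error :: "real \<Rightarrow> real \<Rightarrow> real \<Rightarrow> 'a \<Rightarrow> real" where
  "pred_error R h t \<omega> \<equiv> prediction_error U b (\<lambda>t. X t \<omega>) (\<lambda>t. I t \<omega>) (\<tau> \<omega>) R h t"

lemma gain_measurable:
  assumes "0 \<le> t" "0 \<le> h"
  shows "gain R h t \<in> borel_measurable P" "pred_error R h t \<in> borel_measurable P"
proof -
  have [measurable]: "U t \<in> borel_measurable borel" "U (t + h) \<in> borel_measurable borel" "b t \<in> borel_measurable borel"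
    "Y t \<in> borel_measurable P" "Y (t + h) \<in> borel_measurable P" "I t \<in> borel_measurable P" "I (t + h) \<in> borel_measurable P"
    "Measurable.pred P (conf R t)"
    using assms by (auto intro!: U_measurable drift_measurable Y_measurable I_measurable
        filtration_measurable[OF conf_adapted])
  show "gain R h t \<in> borel_measurable P" unfolding predicted_gain_def by measurable
  show "pred_error R h t \<in> borel_measurable P" unfolding prediction_error_def by measurable
qed

lemma gain_bounded:
  assumes "0 \<le> t" "0 \<le> h"
  shows "\<bar>gain R h t \<omega>\<bar> \<le> 2 * M"
proof -
  have "\<bar>U (t + h) z - U t z'\<bar> \<le> 2 * M" for z z'
    using M[OF assms(1), of z'] M[OF add_nonneg_nonneg[OF assms], of z] by linarith
  moreover have "0 \<le> M" using M[of 0 0] by simp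
  ultimately show ?thesis unfolding predicted_gain_def by (cases "conf R t \<omega>") auto
qed

text \<open>By \<open>ito_taylor_bound\<close> the gain differs from
\<open>h (Ut + b Ux) + D Ux + D\<^sup>2 Uxx / 2\<close>, where \<open>D\<close> is the noise increment, by a term of expectation \<open>o(h)\<close>. The
backward equation turns \<open>h (Ut + b Ux)\<close> into \<open>- h f\<^sup>2 Uxx / 2\<close>. By independence \<open>D Ux\<close> has expectation
\<open>0\<close> and \<open>D\<^sup>2\<close> may be replaced by the variance of \<open>D\<close>, which is \<open>h f\<^sup>2 + o(h)\<close>.\<close>

lemma expected_gain_small:
  assumes \<epsilon>: "0 < \<epsilon>" and \<eta>: "0 < \<eta>"
  shows "\<exists>\<delta>>0. \<forall>t\<in>{\<epsilon>..T}. \<forall>h. 0 < h \<and> h \<le> \<delta> \<longrightarrow> \<bar>expectation (gain R h t)\<bar> \<le> \<eta> * h"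
proof -
  obtain K where K: "0 \<le> K" "\<And>s z. s \<in> {0..T} \<Longrightarrow> \<bar>z\<bar> \<le> R \<Longrightarrow> \<bar>b s z\<bar> \<le> K"
    using drift_bounded[of T R] by blast
  obtain B1 where B1: "\<forall>t\<in>{\<epsilon>..T}. \<forall>x\<in>{-R..R}. \<bar>Ux t x\<bar> \<le> B1"
    using continuous_strip_bounded[OF Ux_cont \<epsilon>] by blast
  obtain B2 where B2: "\<forall>t\<in>{\<epsilon>..T}. \<forall>x\<in>{-R..R}. \<bar>Uxx t x\<bar> \<le> B2"
    using continuous_strip_bounded[OF Uxx_cont \<epsilon>] by blast
  define B where "B = \<bar>B1\<bar> + \<bar>B2\<bar>"
  have B: "0 \<le> B" "\<bar>Ux t x\<bar> \<le> B" "\<bar>Uxx t x\<bar> \<le> B" if "t \<in> {\<epsilon>..T}" "\<bar>x\<bar> \<le> R" for t x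
  proof -
    have "x \<in> {-R..R}" using that(2) by auto
    then have "\<bar>Ux t x\<bar> \<le> B1" "\<bar>Uxx t x\<bar> \<le> B2" using B1 B2 that(1) by blast+
    then show "\<bar>Ux t x\<bar> \<le> B" "\<bar>Uxx t x\<bar> \<le> B" by (auto simp: B_def)
  qed (simp add: B_def)
  have B0: "0 \<le> B" by (simp add: B_def)
  have f2: "continuous_on {0..T + 1} (\<lambda>r. (f r)\<^sup>2)"
    by (intro continuous_intros continuous_on_subset[OF f_cont]) auto
  obtain F0 where F0: "\<forall>r\<in>{0..T + 1}. \<bar>(f r)\<^sup>2\<bar> \<le> F0"
    using continuous_Icc_bounded[OF f2] by blast
  define F where "F = \<bar>F0\<bar>"
  have F: "0 \<le> F" "\<And>r. r \<in> {0..T + 1} \<Longrightarrow> \<bar>(f r)\<^sup>2 - 0\<bar> \<le> F"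
    using F0 by (fastforce simp: F_def)+
  define \<eta>1 where "\<eta>1 = \<eta> / (3 * (1 + F))"
  have \<eta>1: "0 < \<eta>1" "\<eta>1 * (1 + F) = \<eta> / 3" using \<eta> F(1) by (auto simp: \<eta>1_def field_simps)
  define \<eta>2 where "\<eta>2 = \<eta> / (3 * (B + 1))"
  have \<eta>2: "0 < \<eta>2" "\<eta>2 * (B + 1) = \<eta> / 3" using \<eta> B0 by (auto simp: \<eta>2_def field_simps)
  obtain C \<delta>1 where C: "0 \<le> C" "0 < \<delta>1" and taylor: "\<forall>t\<in>{\<epsilon>..T}. \<forall>x\<in>{-R..R}. \<forall>h a y. 0 < h \<and> h \<le> \<delta>1 \<and> \<bar>a\<bar> \<le> K * h \<longrightarrow>
    \<bar>U (t + h) (x + a + y) - U t x - h * Ut t x - (a + y) * Ux t x - y\<^sup>2 / 2 * Uxx t x\<bar>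
      \<le> \<eta>1 * (h + y\<^sup>2) + C * y ^ 4"
    using ito_taylor_bound[OF U M \<epsilon> \<eta>1(1) K(1)] by blast
  have "uniformly_continuous_on {0..T + 1} (\<lambda>r. (f r)\<^sup>2)"
    by (intro compact_uniformly_continuous f2 compact_Icc)
  then obtain \<delta>2 where \<delta>2: "0 < \<delta>2" "\<And>s r. s \<in> {0..T + 1} \<Longrightarrow> r \<in> {0..T + 1} \<Longrightarrow> dist r s < \<delta>2 \<Longrightarrow> dist ((f r)\<^sup>2) ((f s)\<^sup>2) < \<eta>2"
    unfolding uniformly_continuous_on_def using \<eta>2(1) by metis
  \<comment> \<open>The last bound controls the contribution \<open>3 * C * F\<^sup>2 * h\<^sup>2\<close> of the fourth moment.\<close>
  define \<delta> where "\<delta> = Min {1, \<delta>1, \<delta>2 / 2, \<eta> / (9 * (C * F\<^sup>2) + 1)}"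
  have CF: "0 \<le> C * F\<^sup>2" using C by simp
  have \<delta>: "0 < \<delta>" using C \<delta>2 \<eta> CF by (auto simp: \<delta>_def add_nonneg_pos)
  have \<delta>_le: "\<delta> \<le> 1" "\<delta> \<le> \<delta>1" "\<delta> \<le> \<delta>2 / 2" "\<delta> \<le> \<eta> / (9 * (C * F\<^sup>2) + 1)"
    unfolding \<delta>_def by (rule Min_le; simp)+
  have "0 < 9 * (C * F\<^sup>2) + 1" using CF by simp
  then have "\<delta> * (9 * (C * F\<^sup>2) + 1) \<le> \<eta>" using \<delta>_le(4) by (simp only: pos_le_divide_eq)
  then have \<delta>C: "3 * (C * F\<^sup>2) * \<delta> \<le> \<eta> / 3" using \<delta> by (simp add: algebra_simps)
  have "\<bar>expectation (gain R h t)\<bar> \<le> \<eta> * h" if t: "t \<in> {\<epsilon>..T}" and h: "0 < h" "h \<le> \<delta>" for t h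
  proof -
    let ?D = "\<lambda>\<omega>. I (t + h) \<omega> - I t \<omega>" and ?v = "noise_variance t (t + h)"
    let ?F = "brownian_filtration P W (ereal t)"
    have t0: "0 < t" "0 \<le> t" "t \<le> t + h" using t \<epsilon> h by auto
    \<comment> \<open>The second condition follows from the first only for almost every path; it makes the coefficients
      below bounded everywhere.\<close>
    define J :: "'a \<Rightarrow> real" where "J \<omega> = of_bool (conf R t \<omega> \<and> \<bar>Y t \<omega>\<bar> \<le> R)" for \<omega>
    define p1 where "p1 \<omega> = J \<omega> * Ux t (Y t \<omega>)" for \<omega>
    define p2 where "p2 \<omega> = J \<omega> * Uxx t (Y t \<omega>)" for \<omega>
    note [measurable] = Y_adapted[OF t0(2)] conf_adapted[OF t0(2)]
    have [measurable]: "Ux t \<in> borel_measurable borel" "Uxx t \<in> borel_measurable borel"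
      using t0 by (auto intro!: section_measurable[OF Ux_cont] section_measurable[OF Uxx_cont])
    have J_meas: "J \<in> borel_measurable ?F" unfolding J_def by measurable
    then have p1_meas: "p1 \<in> borel_measurable ?F" and p2_meas: "p2 \<in> borel_measurable ?F"
      unfolding p1_def p2_def by measurable
    have p_bound: "\<bar>p1 \<omega>\<bar> \<le> B" "\<bar>p2 \<omega>\<bar> \<le> B" for \<omega>
      using B[OF t, of "Y t \<omega>"] B0 by (auto simp: p1_def p2_def J_def)
    note m1 = increment_moments[OF t0(2,3) p1_meas p_bound(1)]
    note m2 = increment_moments[OF t0(2,3) p2_meas p_bound(2)]
    have one: "expectation (\<lambda>\<omega>. 1 * (?D \<omega>)\<^sup>2) = expectation (\<lambda>_. 1) * ?v"
      by (rule increment_moments(4)[OF t0(2,3), where K = 1]) auto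
    then have D2: "expectation (\<lambda>\<omega>. (?D \<omega>)\<^sup>2) = ?v" by (simp add: prob_space)
    have hT: "t + h \<le> T + 1" using t h \<delta>_le(1) by auto
    have v_le: "\<bar>?v\<bar> \<le> F * h"
      using noise_variance_close[OF t0(2,3), of 0 F] F(2) t0 hT by fastforce
    have v_close: "\<bar>?v - (f t)\<^sup>2 * h\<bar> \<le> \<eta>2 * h"
    proof -
      have "\<bar>(f r)\<^sup>2 - (f t)\<^sup>2\<bar> \<le> \<eta>2" if "r \<in> {t..t + h}" for r
        using \<delta>2(2)[of t r] that t0 hT h \<delta>_le(3) \<delta>2(1) by (auto simp: dist_real_def)
      then show ?thesis using noise_variance_close[OF t0(2,3), of "(f t)\<^sup>2" \<eta>2] by simp
    qed
    have v0: "0 \<le> ?v" unfolding noise_variance_def by simp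
    have [measurable]: "p1 \<in> borel_measurable P" "p2 \<in> borel_measurable P"
      using p1_meas p2_meas filtration_measurable by blast+
    note [measurable] = I_measurable[OF t0(2)]
    have [measurable]: "I (t + h) \<in> borel_measurable P" using t0 h by (intro I_measurable) simp
    define main where "main \<omega> = p1 \<omega> * ?D \<omega> + (p2 \<omega> * (?D \<omega>)\<^sup>2) / 2 - ((f t)\<^sup>2 * h / 2) * p2 \<omega>" for \<omega>
    have bounded_mult: "integrable P (\<lambda>\<omega>. p \<omega> * q \<omega>)"
      if [measurable]: "p \<in> borel_measurable P" and "\<And>\<omega>. \<bar>p \<omega>\<bar> \<le> B" and q: "integrable P q" for p q :: "'a \<Rightarrow> real"
    proof (rule Bochner_Integration.integrable_bound[where f = "\<lambda>\<omega>. B * q \<omega>"])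
      show "AE \<omega> in P. norm (p \<omega> * q \<omega>) \<le> norm (B * q \<omega>)"
        using that(2) B0 by (auto simp: abs_mult intro!: mult_right_mono)
    qed (use q in auto)
    have p2_int: "integrable P p2"
      using p_bound(2) by (intro integrable_const_bound[of _ B]) auto
    have int: "integrable P (\<lambda>\<omega>. p1 \<omega> * ?D \<omega>)" "integrable P (\<lambda>\<omega>. p2 \<omega> * (?D \<omega>)\<^sup>2)" "integrable P p2"
      using bounded_mult[OF _ p_bound(1) m1(1)] bounded_mult[OF _ p_bound(2) m2(2)] p2_int by auto
    then have main_int: "integrable P main" unfolding main_def by auto
    define p1D where "p1D \<omega> = p1 \<omega> * ?D \<omega>" for \<omega>
    define p2D where "p2D \<omega> = p2 \<omega> * (?D \<omega>)\<^sup>2" for \<omega>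
    have "main = (\<lambda>\<omega>. p1D \<omega> + p2D \<omega> / 2 - ((f t)\<^sup>2 * h / 2) * p2 \<omega>)"
      by (simp add: fun_eq_iff main_def p1D_def p2D_def)
    then have "expectation main = expectation p1D + expectation p2D / 2 - ((f t)\<^sup>2 * h / 2) * expectation p2"
      using int by (simp add: p1D_def[symmetric] p2D_def[symmetric])
    also have "expectation p1D = 0" unfolding p1D_def by (rule m1(3))
    also have "expectation p2D = expectation p2 * ?v" unfolding p2D_def by (rule m2(4))
    finally have "expectation main = expectation p2 / 2 * (?v - (f t)\<^sup>2 * h)"
      by (simp add: right_diff_distrib mult.commute)
    moreover have "\<bar>expectation p2\<bar> \<le> B"
      using p_bound(2) int(3) integral_le_const[OF int(3), of B] integral_ge_const[OF int(3), of "- B"]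
      by (auto simp: abs_le_iff minus_le_iff)
    ultimately have main_small: "\<bar>expectation main\<bar> \<le> B / 2 * (\<eta>2 * h)"
      using v_close B0 by (simp only: abs_mult) (intro mult_mono, auto)
    have pointwise: "AE \<omega> in P. \<bar>gain R h t \<omega> - main \<omega>\<bar> \<le> \<eta>1 * (h + (?D \<omega>)\<^sup>2) + C * (?D \<omega>) ^ 4"
      using AE_explosive_path
    proof eventually_elim
      case (elim \<omega>)
      interpret explosive_path b \<xi> "\<lambda>t. X t \<omega>" "\<lambda>t. I t \<omega>" "\<tau> \<omega>" by (rule elim)
      show ?case
      proof (cases "conf R t \<omega>")
        case True
        then have "ereal t < \<tau> \<omega>" "\<bar>X t \<omega>\<bar> \<le> R" using t0(2) by (auto simp: confined_iff)
        then have YR: "\<bar>Y t \<omega>\<bar> \<le> R" by (simp add: killed_def)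
        then have J: "J \<omega> = 1" using True by (simp add: J_def)
        have "\<bar>U (t + h) (Y t \<omega> + b t (Y t \<omega>) * h + ?D \<omega>) - U t (Y t \<omega>) - h * Ut t (Y t \<omega>)
            - (b t (Y t \<omega>) * h + ?D \<omega>) * Ux t (Y t \<omega>) - (?D \<omega>)\<^sup>2 / 2 * Uxx t (Y t \<omega>)\<bar>
          \<le> \<eta>1 * (h + (?D \<omega>)\<^sup>2) + C * (?D \<omega>) ^ 4"
        proof (rule taylor[rule_format])
          show "0 < h \<and> h \<le> \<delta>1 \<and> \<bar>b t (Y t \<omega>) * h\<bar> \<le> K * h"
            using h \<delta>_le K(2)[of t "Y t \<omega>"] t t0 YR by (auto simp: abs_mult)
        qed (use t YR in auto)
        moreover have "gain R h t \<omega> - main \<omega> = U (t + h) (Y t \<omega> + b t (Y t \<omega>) * h + ?D \<omega>) - U t (Y t \<omega>) - h * Ut t (Y t \<omega>)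
            - (b t (Y t \<omega>) * h + ?D \<omega>) * Ux t (Y t \<omega>) - (?D \<omega>)\<^sup>2 / 2 * Uxx t (Y t \<omega>)
            + h * (Ut t (Y t \<omega>) + 1 / 2 * (f t)\<^sup>2 * Uxx t (Y t \<omega>) + b t (Y t \<omega>) * Ux t (Y t \<omega>))"
          using True J by (simp add: predicted_gain_def main_def p1_def p2_def algebra_simps)
        ultimately show ?thesis unfolding pde[OF t0(1)] by simp
      next
        case False
        then have "J \<omega> = 0" by (simp add: J_def)
        then show ?thesis using False \<eta>1(1) C(1) h
          by (simp add: predicted_gain_def main_def p1_def p2_def)
      qed
    qed
    have gain_int: "integrable P (gain R h t)"
      using gain_measurable(1)[of t h R] gain_bounded[where t = t and h = h and R = R] t0 h
      by (intro integrable_const_bound[of _ "2 * M"]) auto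
    have "\<bar>expectation (gain R h t) - expectation main\<bar> = norm (expectation (\<lambda>\<omega>. gain R h t \<omega> - main \<omega>))"
      using gain_int main_int by simp
    also have "\<dots> \<le> expectation (\<lambda>\<omega>. norm (gain R h t \<omega> - main \<omega>))" by (rule integral_norm_bound)
    also have "\<dots> \<le> expectation (\<lambda>\<omega>. \<eta>1 * (h + (?D \<omega>)\<^sup>2) + C * (?D \<omega>) ^ 4)"
      using pointwise gain_int main_int m1(2,5) by (intro integral_mono_AE) auto
    also have "\<dots> = \<eta>1 * (h + ?v) + C * expectation (\<lambda>\<omega>. (?D \<omega>) ^ 4)"
      using m1(2,5) D2 by (simp add: prob_space)
    also have "\<dots> \<le> \<eta>1 * (h + F * h) + C * (3 * (F * h)\<^sup>2)"
    proof (intro add_mono mult_left_mono)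
      have "?v\<^sup>2 \<le> (F * h)\<^sup>2" using v_le v0 by (intro power_mono) auto
      then show "expectation (\<lambda>\<omega>. (?D \<omega>) ^ 4) \<le> 3 * (F * h)\<^sup>2" using m1(6) by linarith
    qed (use v_le v0 \<eta>1(1) C(1) in auto)
    finally have "\<bar>expectation (gain R h t) - expectation main\<bar> \<le> \<eta>1 * (h + F * h) + C * (3 * (F * h)\<^sup>2)" .
    then have "\<bar>expectation (gain R h t)\<bar> \<le> \<eta>1 * (h + F * h) + C * (3 * (F * h)\<^sup>2) + B / 2 * (\<eta>2 * h)"
      using main_small by linarith
    also have "\<dots> = h * (\<eta>1 * (1 + F) + 3 * (C * F\<^sup>2) * h + B / 2 * \<eta>2)"
      by (simp add: power2_eq_square algebra_simps)
    also have "\<dots> \<le> h * (\<eta> / 3 + \<eta> / 3 + \<eta> / 3)"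
    proof (intro mult_left_mono add_mono)
      show "\<eta>1 * (1 + F) \<le> \<eta> / 3" using \<eta>1 by simp
      have "3 * (C * F\<^sup>2) * h \<le> 3 * (C * F\<^sup>2) * \<delta>" using CF h by (intro mult_left_mono) auto
      then show "3 * (C * F\<^sup>2) * h \<le> \<eta> / 3" using \<delta>C by linarith
      have "\<eta>2 * (B / 2) \<le> \<eta>2 * (B + 1)" using \<eta>2(1) B0 by (intro mult_left_mono) auto
      then show "B / 2 * \<eta>2 \<le> \<eta> / 3" using \<eta>2(2) by (simp add: mult.commute)
    qed (use h in auto)
    finally show ?thesis by (simp add: mult.commute)
  qed
  then show ?thesis using \<delta> by blast
qed

end

section \<open>Optional stopping\<close>

context backward_equation begin

abbreviation exit_value :: "real \<Rightarrow> real \<Rightarrow> real \<Rightarrow> 'a \<Rightarrow> real" where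
  "exit_value R T \<epsilon> \<omega> \<equiv> U (max \<epsilon> (exit R T \<omega>)) (Y (max \<epsilon> (exit R T \<omega>)) \<omega>)"

lemma value_measurable: "0 \<le> t \<Longrightarrow> (\<lambda>\<omega>. U t (Y t \<omega>)) \<in> borel_measurable P"
  by (rule measurable_compose[OF Y_measurable U_measurable])

text \<open>The sum \<open>S n\<close> of the changes of \<open>U\<close> over the steps up to exit tends to the exit value. It splits into
gains, which vanish in the mean, and prediction errors, which vanish almost surely and boundedly.\<close>

lemma optional_stopping_from:
  assumes \<epsilon>: "0 < \<epsilon>" "\<epsilon> < T" and R: "\<bar>\<xi>\<bar> \<le> R"
  shows "exit_value R T \<epsilon> \<in> borel_measurable P"
    "expectation (exit_value R T \<epsilon>) = expectation (\<lambda>\<omega>. U \<epsilon> (Y \<epsilon> \<omega>))"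
proof -
  define h where "h n = (T - \<epsilon>) / real (Suc n)" for n
  define s where "s n k = \<epsilon> + real k * h n" for n k
  define S where "S n \<omega> = U \<epsilon> (Y \<epsilon> \<omega>) + (\<Sum>k<Suc n. of_bool (conf R (s n k) \<omega>) *
      (U (s n (Suc k)) (Y (s n (Suc k)) \<omega>) - U (s n k) (Y (s n k) \<omega>)))" for n \<omega>
  define gains where "gains n \<omega> = (\<Sum>k<Suc n. gain R (h n) (s n k) \<omega>)" for n \<omega>
  define errors where "errors n \<omega> = (\<Sum>k<Suc n. pred_error R (h n) (s n k) \<omega>)" for n \<omega>
  have h: "0 < h n" "real (Suc n) * h n = T - \<epsilon>" for n using \<epsilon> by (auto simp: h_def)
  have h0: "h \<longlonglongrightarrow> 0" unfolding h_def by (rule LIMSEQ_Suc[OF lim_const_over_n])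
  have s_pos: "\<epsilon> \<le> s n k" "0 \<le> s n k" for n k using \<epsilon> h(1)[of n] by (auto simp: s_def)
  have s_Suc: "s n (Suc k) = s n k + h n" for n k by (simp add: s_def algebra_simps)
  have s_T: "s n k \<le> T" if "k < Suc n" for n k
  proof -
    have "real k * h n \<le> real (Suc n) * h n" using that h(1)[of n] by (intro mult_right_mono) auto
    then show ?thesis using h(2)[of n] by (simp add: s_def)
  qed
  have step: "of_bool (conf R (s n k) \<omega>) * (U (s n (Suc k)) (Y (s n (Suc k)) \<omega>) - U (s n k) (Y (s n k) \<omega>))
      = gain R (h n) (s n k) \<omega> + pred_error R (h n) (s n k) \<omega>" for n k \<omega>
    by (simp add: predicted_gain_def prediction_error_def s_Suc algebra_simps)
  have S_eq: "S n \<omega> = U \<epsilon> (Y \<epsilon> \<omega>) + gains n \<omega> + errors n \<omega>" for n \<omega>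
    unfolding S_def gains_def errors_def step by (simp only: sum.distrib add.assoc)
  have U\<epsilon>_meas[measurable]: "(\<lambda>\<omega>. U \<epsilon> (Y \<epsilon> \<omega>)) \<in> borel_measurable P"
    using \<epsilon> by (intro value_measurable) simp
  have gain_meas: "gain R (h n) (s n k) \<in> borel_measurable P" for n k
    by (rule gain_measurable(1)) (use s_pos h(1) in \<open>auto simp: less_imp_le\<close>)
  have error_meas: "pred_error R (h n) (s n k) \<in> borel_measurable P" for n k
    by (rule gain_measurable(2)) (use s_pos h(1) in \<open>auto simp: less_imp_le\<close>)
  have gains_meas[measurable]: "gains n \<in> borel_measurable P" for n
    unfolding gains_def[abs_def] by (rule borel_measurable_sum) (rule gain_meas)
  have errors_meas[measurable]: "errors n \<in> borel_measurable P" for n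
    unfolding errors_def[abs_def] by (rule borel_measurable_sum) (rule error_meas)
  have S_meas: "S n \<in> borel_measurable P" for n
    unfolding S_eq[abs_def] by measurable
  have S_bound: "\<bar>S n \<omega>\<bar> \<le> M" for n \<omega>
  proof -
    have "conf R (s n k) \<omega>" if "k \<le> l" "conf R (s n l) \<omega>" for k l
      using that h(1)[of n] by (intro confined_antimono[OF that(2)]) (auto simp: s_def intro!: mult_right_mono)
    then obtain \<nu> where "(\<Sum>k<Suc n. of_bool (conf R (s n k) \<omega>) *
      (U (s n (Suc k)) (Y (s n (Suc k)) \<omega>) - U (s n k) (Y (s n k) \<omega>)))
      = U (s n \<nu>) (Y (s n \<nu>) \<omega>) - U (s n 0) (Y (s n 0) \<omega>)"
      using sum_of_bool_initial_segment[of "\<lambda>k. conf R (s n k) \<omega>" "Suc n" "\<lambda>k. U (s n k) (Y (s n k) \<omega>)"] by blast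
    then have "S n \<omega> = U (s n \<nu>) (Y (s n \<nu>) \<omega>)" by (simp add: S_def s_def)
    then show ?thesis using M s_pos by simp
  qed
  have S_lim: "AE \<omega> in P. (\<lambda>n. S n \<omega>) \<longlonglongrightarrow> exit_value R T \<epsilon> \<omega>"
    using AE_explosive_path
  proof eventually_elim
    case (elim \<omega>)
    interpret explosive_path b \<xi> "\<lambda>t. X t \<omega>" "\<lambda>t. I t \<omega>" "\<tau> \<omega>" by (rule elim)
    show ?case unfolding S_def s_def h_def by (rule stopped_value_tendsto[OF U_cont \<epsilon> R])
  qed
  show "exit_value R T \<epsilon> \<in> borel_measurable P"
    by (rule bounded_convergence(1)[OF S_meas _ S_lim, where M = M]) (simp add: S_bound)
  have lim1: "(\<lambda>n. expectation (S n)) \<longlonglongrightarrow> expectation (exit_value R T \<epsilon>)"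
    by (rule bounded_convergence(2)[OF S_meas _ S_lim, where M = M]) (simp add: S_bound)
  obtain K where K: "0 \<le> K" "\<forall>s\<in>{0..T}. \<forall>z. \<bar>z\<bar> \<le> R \<longrightarrow> \<bar>b s z\<bar> \<le> K"
    using drift_bounded[of T R] by blast
  obtain B where B: "\<forall>t\<in>{\<epsilon>..T}. \<forall>z\<in>{-(R + 2 * K * T)..R + 2 * K * T}. \<bar>Ux t z\<bar> \<le> B"
    using continuous_strip_bounded[OF Ux_cont \<epsilon>(1), of T "R + 2 * K * T"] by blast
  have B': "\<bar>Ux t z\<bar> \<le> \<bar>B\<bar>" if "t \<in> {\<epsilon>..T}" "\<bar>z\<bar> \<le> R + 2 * K * T" for t z
  proof -
    have "z \<in> {-(R + 2 * K * T)..R + 2 * K * T}" using that(2) by auto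
    then have "\<bar>Ux t z\<bar> \<le> B" using B that(1) by blast
    then show ?thesis by simp
  qed
  let ?E = "2 * \<bar>B\<bar> * K * T + 2 * M"
  have errors_bound: "AE \<omega> in P. \<bar>errors n \<omega>\<bar> \<le> ?E" for n
    using AE_explosive_path
  proof eventually_elim
    case (elim \<omega>)
    interpret explosive_path b \<xi> "\<lambda>t. X t \<omega>" "\<lambda>t. I t \<omega>" "\<tau> \<omega>" by (rule elim)
    show ?case unfolding errors_def s_def h_def
      by (rule prediction_error_sum_bound[OF \<epsilon> _ U_derivs M B' K(1) abs_ge_zero]) (use K(2) in auto)
  qed
  have errors_lim: "AE \<omega> in P. (\<lambda>n. errors n \<omega>) \<longlonglongrightarrow> 0"
    using AE_explosive_path
  proof eventually_elim
    case (elim \<omega>)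
    interpret explosive_path b \<xi> "\<lambda>t. X t \<omega>" "\<lambda>t. I t \<omega>" "\<tau> \<omega>" by (rule elim)
    show ?case unfolding errors_def s_def h_def
      by (rule prediction_error_sum_tendsto[OF \<epsilon> R U_derivs Ux_cont])
  qed
  have lim2: "(\<lambda>n. expectation (errors n)) \<longlonglongrightarrow> 0"
    using bounded_convergence(2)[OF errors_meas errors_bound errors_lim] by simp
  have gain_int: "integrable P (gain R (h n) (s n k))" for n k
    using gain_meas gain_bounded[where t = "s n k" and h = "h n" and R = R] s_pos h(1)[of n]
    by (intro integrable_const_bound[of _ "2 * M"]) auto
  have gains_exp: "expectation (gains n) = (\<Sum>k<Suc n. expectation (gain R (h n) (s n k)))" for n
    unfolding gains_def[abs_def] by (rule Bochner_Integration.integral_sum) (rule gain_int)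
  have lim3: "(\<lambda>n. expectation (gains n)) \<longlonglongrightarrow> 0"
  proof (rule LIMSEQ_I)
    fix e :: real assume e: "0 < e"
    define \<eta> where "\<eta> = e / (2 * (T - \<epsilon>))"
    have \<eta>: "0 < \<eta>" "\<eta> * (T - \<epsilon>) = e / 2" using e \<epsilon> by (auto simp: \<eta>_def field_simps)
    obtain \<delta> where \<delta>: "0 < \<delta>" "\<forall>t\<in>{\<epsilon>..T}. \<forall>h. 0 < h \<and> h \<le> \<delta> \<longrightarrow> \<bar>expectation (gain R h t)\<bar> \<le> \<eta> * h"
      using expected_gain_small[OF \<epsilon>(1) \<eta>(1), of T R] by blast
    have "eventually (\<lambda>n. h n < \<delta>) sequentially" using h0 \<delta>(1) by (rule order_tendstoD(2))
    then obtain N where N: "\<And>n. N \<le> n \<Longrightarrow> h n < \<delta>" unfolding eventually_sequentially by blast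
    show "\<exists>N. \<forall>n\<ge>N. norm (expectation (gains n) - 0) < e"
    proof (intro exI[of _ N] allI impI)
      fix n assume n: "N \<le> n"
      have "\<bar>expectation (gains n)\<bar> \<le> (\<Sum>k<Suc n. \<eta> * h n)"
        unfolding gains_exp
      proof (rule order_trans[OF sum_abs], rule sum_mono)
        fix k assume "k \<in> {..<Suc n}"
        then have "s n k \<in> {\<epsilon>..T}" using s_pos s_T by auto
        moreover have "0 < h n \<and> h n \<le> \<delta>" using h(1)[of n] N[OF n] by simp
        ultimately show "\<bar>expectation (gain R (h n) (s n k))\<bar> \<le> \<eta> * h n" using \<delta>(2) by blast
      qed
      also have "\<dots> = \<eta> * (real (Suc n) * h n)" by simp
      also have "\<dots> < e" unfolding h(2) \<eta>(2) using e by simp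
      finally show "norm (expectation (gains n) - 0) < e" by simp
    qed
  qed
  have int\<epsilon>: "integrable P (\<lambda>\<omega>. U \<epsilon> (Y \<epsilon> \<omega>))"
    using M[of \<epsilon>] \<epsilon> by (intro integrable_const_bound[of _ M]) auto
  have intg: "integrable P (gains n)" for n
    unfolding gains_def[abs_def] by (rule Bochner_Integration.integrable_sum) (rule gain_int)
  have inte: "integrable P (errors n)" for n
    using errors_bound[of n] by (intro integrable_const_bound[of _ ?E]) auto
  have "expectation (S n) = expectation (\<lambda>\<omega>. U \<epsilon> (Y \<epsilon> \<omega>)) + expectation (gains n) + expectation (errors n)" for n
    unfolding S_eq[abs_def] using int\<epsilon> intg[of n] inte[of n] by simp
  then have "(\<lambda>n. expectation (S n)) \<longlonglongrightarrow> expectation (\<lambda>\<omega>. U \<epsilon> (Y \<epsilon> \<omega>)) + 0 + 0"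
    by (simp only:) (intro tendsto_add tendsto_const lim2 lim3)
  then show "expectation (exit_value R T \<epsilon>) = expectation (\<lambda>\<omega>. U \<epsilon> (Y \<epsilon> \<omega>))"
    using LIMSEQ_unique[OF lim1] by simp
qed

lemma optional_stopping:
  assumes T: "0 < T" and R: "\<bar>\<xi>\<bar> \<le> R"
  shows "(\<lambda>\<omega>. U (exit R T \<omega>) (Y (exit R T \<omega>) \<omega>)) \<in> borel_measurable P"
    "expectation (\<lambda>\<omega>. U (exit R T \<omega>) (Y (exit R T \<omega>) \<omega>)) = U 0 \<xi>"
proof -
  define \<epsilon> where "\<epsilon> k = T / real (Suc (Suc k))" for k
  have \<epsilon>: "0 < \<epsilon> k" "\<epsilon> k < T" for k using T by (auto simp: \<epsilon>_def field_simps add_pos_nonneg)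
  have \<epsilon>0: "\<epsilon> \<longlonglongrightarrow> 0"
    unfolding \<epsilon>_def using LIMSEQ_Suc[OF LIMSEQ_Suc[OF lim_const_over_n[of T]]] by simp
  note stop = optional_stopping_from[OF \<epsilon> R]
  have bound: "\<bar>U (max (\<epsilon> k) z) z'\<bar> \<le> M" for k z z'
    using M \<epsilon>(1)[of k] by (simp add: max.coboundedI1 less_imp_le)
  have lim: "AE \<omega> in P. (\<lambda>k. exit_value R T (\<epsilon> k) \<omega>) \<longlonglongrightarrow> U (exit R T \<omega>) (Y (exit R T \<omega>) \<omega>)"
    using AE_explosive_path
  proof eventually_elim
    case (elim \<omega>)
    interpret explosive_path b \<xi> "\<lambda>t. X t \<omega>" "\<lambda>t. I t \<omega>" "\<tau> \<omega>" by (rule elim)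
    note \<sigma> = exit_time[OF R less_imp_le[OF T]]
    have "(\<lambda>k. max (\<epsilon> k) (exit R T \<omega>)) \<longlonglongrightarrow> max 0 (exit R T \<omega>)"
      by (intro tendsto_max \<epsilon>0 tendsto_const)
    then have "(\<lambda>k. max (\<epsilon> k) (exit R T \<omega>)) \<longlonglongrightarrow> exit R T \<omega>"
      using \<sigma>(1) by (simp add: max_absorb2)
    then show ?case
      using \<sigma> by (intro y_value_tendsto[OF U_cont]) (auto simp: max.coboundedI2)
  qed
  show "(\<lambda>\<omega>. U (exit R T \<omega>) (Y (exit R T \<omega>) \<omega>)) \<in> borel_measurable P"
    by (rule bounded_convergence(1)[OF stop(1) _ lim, where M = M]) (simp add: bound)
  have lim1: "(\<lambda>k. expectation (exit_value R T (\<epsilon> k))) \<longlonglongrightarrow> expectation (\<lambda>\<omega>. U (exit R T \<omega>) (Y (exit R T \<omega>) \<omega>))"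
    by (rule bounded_convergence(2)[OF stop(1) _ lim, where M = M]) (simp add: bound)
  have lim0: "AE \<omega> in P. (\<lambda>k. U (\<epsilon> k) (Y (\<epsilon> k) \<omega>)) \<longlonglongrightarrow> U 0 \<xi>"
    using AE_explosive_path
  proof eventually_elim
    case (elim \<omega>)
    interpret explosive_path b \<xi> "\<lambda>t. X t \<omega>" "\<lambda>t. I t \<omega>" "\<tau> \<omega>" by (rule elim)
    have "ereal 0 < \<tau> \<omega>" using \<theta>_pos by (simp add: zero_ereal_def)
    then have "(\<lambda>k. U (\<epsilon> k) (Y (\<epsilon> k) \<omega>)) \<longlonglongrightarrow> U 0 (Y 0 \<omega>)"
      using \<epsilon>(1) by (intro y_value_tendsto[OF U_cont] \<epsilon>0) (auto simp: less_imp_le)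
    then show ?case using x_0 \<open>ereal 0 < \<tau> \<omega>\<close> by (simp add: killed_def)
  qed
  have "(\<lambda>k. expectation (\<lambda>\<omega>. U (\<epsilon> k) (Y (\<epsilon> k) \<omega>))) \<longlonglongrightarrow> expectation (\<lambda>_. U 0 \<xi>)"
  proof (rule bounded_convergence(2)[OF _ _ lim0])
    show "(\<lambda>\<omega>. U (\<epsilon> k) (Y (\<epsilon> k) \<omega>)) \<in> borel_measurable P" for k
      using \<epsilon>(1)[of k] by (intro value_measurable) simp
    show "AE \<omega> in P. \<bar>U (\<epsilon> k) (Y (\<epsilon> k) \<omega>)\<bar> \<le> M" for k
      using M[of "\<epsilon> k"] \<epsilon>(1)[of k] by simp
  qed
  then have "(\<lambda>k. expectation (exit_value R T (\<epsilon> k))) \<longlonglongrightarrow> U 0 \<xi>"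
    unfolding stop(2) by (simp add: prob_space)
  then show "expectation (\<lambda>\<omega>. U (exit R T \<omega>) (Y (exit R T \<omega>) \<omega>)) = U 0 \<xi>"
    by (rule LIMSEQ_unique[OF lim1])
qed

end

section \<open>The Laplace transform of a random time\<close>

text \<open>Integrate \<open>lam * exp (- lam * s)\<close> over the \<open>s \<ge> T\<close> first, or over the sample space first.\<close>

lemma (in prob_space) laplace_transform_eq_distribution_integral:
  fixes T :: "'a \<Rightarrow> ereal"
  assumes T[measurable]: "T \<in> borel_measurable M" and pos: "AE \<omega> in M. 0 < T \<omega>" and lam: "0 < lam"
  shows "expectation (\<lambda>\<omega>. if T \<omega> = \<infinity> then 0 else exp (- lam * real_of_ereal (T \<omega>)))
    = lam * (LBINT s:{0..}. prob {\<omega> \<in> space M. T \<omega> \<le> ereal s} * exp (- lam * s))"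
proof -
  interpret pair_sigma_finite M lborel
    by (simp add: pair_sigma_finite_def sigma_finite_measure_axioms lborel.sigma_finite_measure_axioms)
  define \<phi> where "\<phi> s = lam * exp (- lam * s)" for s
  have \<phi>[measurable]: "\<phi> \<in> borel_measurable borel" unfolding \<phi>_def by measurable
  have \<phi>_pos: "0 \<le> \<phi> s" for s using lam by (simp add: \<phi>_def)
  let ?L = "\<lambda>\<omega>. if T \<omega> = \<infinity> then 0 else exp (- lam * real_of_ereal (T \<omega>))"
  have tail: "(\<integral>\<^sup>+ s. ennreal (\<phi> s) * indicator {a..} s \<partial>lborel) = ennreal (exp (- lam * a))" for a
  proof -
    have "(\<integral>\<^sup>+ s. ennreal (\<phi> s) * indicator {a..} s \<partial>lborel) = ennreal (0 - (- exp (- lam * a)))"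
    proof (rule nn_integral_FTC_atLeast)
      show "((\<lambda>s. - exp (- lam * s)) has_real_derivative \<phi> s) (at s)" for s
        unfolding \<phi>_def by (rule derivative_eq_intros refl | simp)+
      have "filterlim (\<lambda>s. lam * s) at_top at_top"
        by (rule filterlim_tendsto_pos_mult_at_top[OF tendsto_const lam filterlim_ident])
      then have "filterlim (\<lambda>s. - (lam * s)) at_bot at_top" by (simp add: filterlim_uminus_at_top)
      then have "((\<lambda>s. exp (- (lam * s))) \<longlongrightarrow> 0) at_top" by (rule filterlim_compose[OF exp_at_bot])
      then show "((\<lambda>s. - exp (- lam * s)) \<longlongrightarrow> 0) at_top" using tendsto_minus by fastforce
    qed (auto simp: \<phi>_pos)
    then show ?thesis by simp
  qed
  let ?\<Phi> = "\<lambda>\<omega> s. ennreal (\<phi> s) * indicator {0..} s * indicator {\<omega> \<in> space M. T \<omega> \<le> ereal s} \<omega>"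
  have inner: "AE \<omega> in M. ennreal (?L \<omega>) = (\<integral>\<^sup>+ s. ?\<Phi> \<omega> s \<partial>lborel)"
    using pos AE_space
  proof eventually_elim
    case (elim \<omega>)
    show ?case
    proof (cases "T \<omega>")
      case (real r)
      have "(\<integral>\<^sup>+ s. ?\<Phi> \<omega> s \<partial>lborel) = (\<integral>\<^sup>+ s. ennreal (\<phi> s) * indicator {r..} s \<partial>lborel)"
        using elim real by (intro nn_integral_cong) (auto simp: indicator_def)
      then show ?thesis using tail real by simp
    next
      case PInf
      then show ?thesis by simp
    next
      case MInf
      then show ?thesis using elim by simp
    qed
  qed
  have L[measurable]: "?L \<in> borel_measurable M" by measurable
  have "AE \<omega> in M. norm (?L \<omega>) \<le> 1"
    using pos
  proof eventually_elim
    case (elim \<omega>)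
    then show ?case using lam by (cases "T \<omega>") auto
  qed
  then have L_int: "integrable M ?L"
    using L by (rule integrable_const_bound)
  have "ennreal (expectation ?L) = (\<integral>\<^sup>+ \<omega>. ennreal (?L \<omega>) \<partial>M)"
    by (rule nn_integral_eq_integral[symmetric, OF L_int]) simp
  also have "\<dots> = (\<integral>\<^sup>+ \<omega>. \<integral>\<^sup>+ s. ?\<Phi> \<omega> s \<partial>lborel \<partial>M)"
    by (rule nn_integral_cong_AE[OF inner])
  also have "\<dots> = (\<integral>\<^sup>+ s. \<integral>\<^sup>+ \<omega>. ?\<Phi> \<omega> s \<partial>M \<partial>lborel)"
  proof (rule Fubini'[symmetric])
    have [measurable]: "(\<lambda>p. T (fst p)) \<in> borel_measurable (M \<Otimes>\<^sub>M lborel)" by measurable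
    have "Measurable.pred (M \<Otimes>\<^sub>M lborel) (\<lambda>p. T (fst p) \<le> ereal (snd p))" by measurable
    then have [measurable]: "{p \<in> space (M \<Otimes>\<^sub>M lborel). T (fst p) \<le> ereal (snd p)} \<in> sets (M \<Otimes>\<^sub>M lborel)"
      by (simp add: pred_def)
    have "(\<lambda>p. ennreal (\<phi> (snd p)) * indicator {0..} (snd p) *
        indicator {p \<in> space (M \<Otimes>\<^sub>M lborel). T (fst p) \<le> ereal (snd p)} p) \<in> borel_measurable (M \<Otimes>\<^sub>M lborel)"
      by measurable
    then show "(\<lambda>(\<omega>, s). ?\<Phi> \<omega> s) \<in> borel_measurable (M \<Otimes>\<^sub>M lborel)"
      by (rule measurable_cong[THEN iffD1, rotated]) (auto simp: space_pair_measure indicator_def)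
  qed
  also have "\<dots> = (\<integral>\<^sup>+ s. ennreal (indicator {0..} s * (prob {\<omega> \<in> space M. T \<omega> \<le> ereal s} * \<phi> s)) \<partial>lborel)"
  proof (rule nn_integral_cong)
    fix s :: real
    have "(\<integral>\<^sup>+ \<omega>. ?\<Phi> \<omega> s \<partial>M) = ennreal (\<phi> s) * indicator {0..} s * emeasure M {\<omega> \<in> space M. T \<omega> \<le> ereal s}"
      by (subst nn_integral_cmult_indicator) auto
    also have "\<dots> = ennreal (indicator {0..} s * (prob {\<omega> \<in> space M. T \<omega> \<le> ereal s} * \<phi> s))"
      using \<phi>_pos[of s] by (cases "s \<in> {0..}") (auto simp: emeasure_eq_measure ennreal_mult' mult.commute)
    finally show "(\<integral>\<^sup>+ \<omega>. ?\<Phi> \<omega> s \<partial>M) = \<dots>" .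
  qed
  finally have nn: "(\<integral>\<^sup>+ s. ennreal (indicator {0..} s * (prob {\<omega> \<in> space M. T \<omega> \<le> ereal s} * \<phi> s)) \<partial>lborel)
      = ennreal (expectation ?L)" by simp
  have "mono (\<lambda>s. prob {\<omega> \<in> space M. T \<omega> \<le> ereal s})"
    by (intro monoI finite_measure_mono) (auto intro: order_trans)
  then have [measurable]: "(\<lambda>s. prob {\<omega> \<in> space M. T \<omega> \<le> ereal s}) \<in> borel_measurable borel"
    by (rule borel_measurable_mono)
  have "(\<integral>s. indicator {0..} s * (prob {\<omega> \<in> space M. T \<omega> \<le> ereal s} * \<phi> s) \<partial>lborel) = expectation ?L"
    using nn \<phi>_pos by (intro integral_eq_nn_integral[THEN trans]) auto
  also have "(\<integral>s. indicator {0..} s * (prob {\<omega> \<in> space M. T \<omega> \<le> ereal s} * \<phi> s) \<partial>lborel)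
    = (\<integral>s. lam * (indicator {0..} s * (prob {\<omega> \<in> space M. T \<omega> \<le> ereal s} * exp (- lam * s))) \<partial>lborel)"
    by (intro Bochner_Integration.integral_cong) (auto simp: \<phi>_def)
  finally show ?thesis
    unfolding set_lebesgue_integral_def by simp
qed

section \<open>The representation of the Laplace transform by the equation\<close>

lemma classical_derivatives_discounted:
  assumes "classical_derivatives u ut ux uxx"
  shows "classical_derivatives (\<lambda>t x. exp (- lam * t) * u t x) (\<lambda>t x. exp (- lam * t) * (ut t x - lam * u t x))
    (\<lambda>t x. exp (- lam * t) * ux t x) (\<lambda>t x. exp (- lam * t) * uxx t x)"
proof -
  have u: "continuous_on ({0..} \<times> UNIV) (\<lambda>p. u (fst p) (snd p))"
    "continuous_on ({0<..} \<times> UNIV) (\<lambda>p. ut (fst p) (snd p))"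
    "continuous_on ({0<..} \<times> UNIV) (\<lambda>p. ux (fst p) (snd p))"
    "continuous_on ({0<..} \<times> UNIV) (\<lambda>p. uxx (fst p) (snd p))"
    and d: "\<And>t x. 0 < t \<Longrightarrow> ((\<lambda>s. u s x) has_real_derivative ut t x) (at t)"
    "\<And>t x. 0 < t \<Longrightarrow> (u t has_real_derivative ux t x) (at x)"
    "\<And>t x. 0 < t \<Longrightarrow> (ux t has_real_derivative uxx t x) (at x)"
    using assms by (auto simp: classical_derivatives_def case_prod_unfold)
  have u': "continuous_on ({0<..} \<times> UNIV) (\<lambda>p. u (fst p) (snd p))"
    by (rule continuous_on_subset[OF u(1)]) auto
  show ?thesis
    unfolding classical_derivatives_def case_prod_unfold
  proof (intro conjI allI impI)
    fix t x :: real assume t: "0 < t"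
    show "((\<lambda>s. exp (- lam * s) * u s x) has_real_derivative exp (- lam * t) * (ut t x - lam * u t x)) (at t)"
      by (rule derivative_eq_intros d(1)[OF t] refl | simp add: algebra_simps)+
    show "((\<lambda>x. exp (- lam * t) * u t x) has_real_derivative exp (- lam * t) * ux t x) (at x)"
      by (rule DERIV_cmult[OF d(2)[OF t]])
    show "((\<lambda>x. exp (- lam * t) * ux t x) has_real_derivative exp (- lam * t) * uxx t x) (at x)"
      by (rule DERIV_cmult[OF d(3)[OF t]])
  qed (intro continuous_intros u u')+
qed

theorem theorem22:
  fixes P :: "'a measure"
    and W I X :: "real \<Rightarrow> 'a \<Rightarrow> real"
    and \<tau> :: "'a \<Rightarrow> ereal"
    and b u ut ux uxx :: "real \<Rightarrow> real \<Rightarrow> real"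
    and f :: "real \<Rightarrow> real"
    and \<xi> lam :: real
  assumes "prob_space P" and "complete_measure P"
    and "standard_brownian_motion P W"
    and b_nonneg: "\<And>s x. 0 \<le> s \<Longrightarrow> 0 \<le> b s x"
    and b_lipschitz: "locally_lipschitz_unif b"
    and b_continuous: "\<And>x. continuous_on {0..} (\<lambda>s. b s x)"
    and f_continuous: "continuous_on {0..} f"
    and f_growth: "noise_growth_condition f"
    and I: "wiener_integral_process P W f I"
    and X: "unique_solution_up_to_explosion P W b I \<xi> X \<tau>"
    and "0 < lam"
    and u_bounded: "bounded ((\<lambda>(t, x). u t x) ` ({0..} \<times> UNIV))"
    and u_classical: "classical_derivatives u ut ux uxx"
    and pde: "\<And>t x. 0 < t \<Longrightarrow>
      - ut t x = 1 / 2 * (f t)\<^sup>2 * uxx t x + b t x * ux t x - lam * u t x"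
    and boundary: "boundary_value_at_infinity u (\<lambda>_. 1)"
  shows "lam * (LBINT s:{0..}. measure P {\<omega> \<in> space P. \<tau> \<omega> \<le> ereal s} * exp (- lam * s)) = u 0 \<xi>"
proof -
  obtain M where "\<And>y. y \<in> (\<lambda>(t, x). u t x) ` ({0..} \<times> UNIV) \<Longrightarrow> norm y \<le> M"
    using u_bounded unfolding bounded_iff by blast
  then have u_bound: "\<bar>u t x\<bar> \<le> M" if "0 \<le> t" for t x
    using that by force
  let ?U = "\<lambda>t x. exp (- lam * t) * u t x"
  have UM: "\<bar>?U t x\<bar> \<le> M" if "0 \<le> t" for t x
  proof -
    have "exp (- lam * t) * \<bar>u t x\<bar> \<le> 1 * \<bar>u t x\<bar>"
      using that \<open>0 < lam\<close> by (intro mult_right_mono) auto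
    then show ?thesis using u_bound[OF that, of x] by (simp add: abs_mult)
  qed
  have sol: "solution_up_to_explosion P W b I \<xi> X \<tau>"
    using X unfolding unique_solution_up_to_explosion_def by (elim conjE)
  interpret brownian P W
    using assms(1-3) by (simp add: brownian_def brownian_axioms_def)
  interpret wiener_integral P W f I
    using f_continuous I by unfold_locales
  interpret explosive_sde P W f I b \<xi> X \<tau>
    using b_lipschitz b_continuous sol by unfold_locales
  interpret backward_equation P W f I b \<xi> X \<tau> ?U "\<lambda>t x. exp (- lam * t) * (ut t x - lam * u t x)"
    "\<lambda>t x. exp (- lam * t) * ux t x" "\<lambda>t x. exp (- lam * t) * uxx t x" M
  proof unfold_locales
    show "classical_derivatives ?U (\<lambda>t x. exp (- lam * t) * (ut t x - lam * u t x))
      (\<lambda>t x. exp (- lam * t) * ux t x) (\<lambda>t x. exp (- lam * t) * uxx t x)"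
      by (rule classical_derivatives_discounted[OF u_classical])
    show "\<bar>?U t x\<bar> \<le> M" if "0 \<le> t" for t x by (rule UM[OF that])
    show "exp (- lam * t) * (ut t x - lam * u t x) + 1 / 2 * (f t)\<^sup>2 * (exp (- lam * t) * uxx t x)
      + b t x * (exp (- lam * t) * ux t x) = 0" if "0 < t" for t x
    proof -
      have "exp (- lam * t) * (ut t x - lam * u t x) + 1 / 2 * (f t)\<^sup>2 * (exp (- lam * t) * uxx t x)
          + b t x * (exp (- lam * t) * ux t x)
        = exp (- lam * t) * (ut t x + (1 / 2 * (f t)\<^sup>2 * uxx t x + b t x * ux t x - lam * u t x))"
        by (simp add: algebra_simps)
      then show ?thesis unfolding pde[OF that, symmetric] by simp
    qed
  qed
  let ?V = "\<lambda>n \<omega>. ?U (exit (real n) (real n) \<omega>) (Y (exit (real n) (real n) \<omega>) \<omega>)"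
  let ?L = "\<lambda>\<omega>. if \<tau> \<omega> = \<infinity> then 0 else exp (- lam * real_of_ereal (\<tau> \<omega>))"
  define N where "N = nat \<lceil>\<bar>\<xi>\<bar>\<rceil> + 1"
  have N: "0 < real (n + N)" "\<bar>\<xi>\<bar> \<le> real (n + N)" for n
    unfolding N_def by linarith+
  have lim: "AE \<omega> in P. (\<lambda>n. ?V (n + N) \<omega>) \<longlonglongrightarrow> ?L \<omega>"
    using AE_explosive_path
  proof eventually_elim
    case (elim \<omega>)
    interpret explosive_path b \<xi> "\<lambda>t. X t \<omega>" "\<lambda>t. I t \<omega>" "\<tau> \<omega>" by (rule elim)
    show ?case
      by (rule LIMSEQ_ignore_initial_segment[OF
            discounted_exit_value_tendsto[OF b_nonneg u_bound boundary \<open>0 < lam\<close>]])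
  qed
  have bound: "AE \<omega> in P. \<bar>?V (n + N) \<omega>\<bar> \<le> M" for n
    using AE_explosive_path
  proof eventually_elim
    case (elim \<omega>)
    interpret explosive_path b \<xi> "\<lambda>t. X t \<omega>" "\<lambda>t. I t \<omega>" "\<tau> \<omega>" by (rule elim)
    show ?case by (intro UM exit_time(1)[OF N(2) less_imp_le[OF N(1)]])
  qed
  have "(\<lambda>n. expectation (?V (n + N))) \<longlonglongrightarrow> expectation ?L"
    by (rule bounded_convergence(2)[OF optional_stopping(1)[OF N] bound lim])
  then have "expectation ?L = u 0 \<xi>"
    unfolding optional_stopping(2)[OF N] by (simp add: LIMSEQ_const_iff)
  moreover have "AE \<omega> in P. 0 < \<tau> \<omega>"
    using AE_explosive_path by eventually_elim (rule explosive_path.\<theta>_pos)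
  ultimately show ?thesis
    using laplace_transform_eq_distribution_integral[OF explosion_measurable _ \<open>0 < lam\<close>] by simp
qed

end
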